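(* Let $r\in(0,1)$ and $t=\sqrt{1-r^2}$. Let $\mu$ be a probability measure on $\mathbb T=\mathbb R/2\pi\mathbb Z$ that is absolutely continuous, $d\mu(\omega)=\tau(\omega)\,d\omega$, with density $\tau\in L^\infty(\mathbb T)$, and suppose that the support of $\mu$ contains a non-empty open set. Let $\{\omega_k^\uparrow\}_{k\in\mathbb Z}\cup\{\omega_k^\downarrow\}_{k\in\mathbb Z}$ be i.i.d. $\mathbb T$-valued random variables with law $\mu$, and let $U_\omega$ be the associated random quantum walk operator on $\mathbb C^2\otimes l^2(\mathbb Z)$ (defined in the context). Then there exist $C<\infty$ and $\alpha>0$ such that for any $j,k\in\mathbb Z$ and any $\sigma,\sigma'\in\{\uparrow,\downarrow\}$, $$\mathbb E\left[\ \sup_{f\in C(\mathbb S),\ \|f\|_\infty\le 1}\Big|\big\langle \sigma\otimes j,\ f(U_\omega)\,(\sigma'\otimes k)\big\rangle\Big|\ \right]\le C e^{-\alpha|j-k|}.$$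
   Context: Let $\{|\!\uparrow\rangle,|\!\downarrow\rangle\}$ be the canonical orthonormal basis of $\mathbb C^2$ and $\{|n\rangle\}_{n\in\mathbb Z}$ the canonical basis of $l^2(\mathbb Z)$; write $\sigma\otimes j$ for $|\sigma\rangle\otimes|j\rangle$. The random unitary operator $U_\omega$ on $\mathbb C^2\otimes l^2(\mathbb Z)$ is determined by $$U_\omega|\!\uparrow\rangle\otimes|n\rangle = e^{-i\omega_n^\uparrow}t\,|\!\uparrow\rangle\otimes|n+1\rangle+e^{-i\omega_n^\downarrow}r\,|\!\downarrow\rangle\otimes|n-1\rangle,$$ $$U_\omega|\!\downarrow\rangle\otimes|n\rangle = -e^{-i\omega_n^\uparrow}r\,|\!\uparrow\rangle\otimes|n+1\rangle+e^{-i\omega_n^\downarrow}t\,|\!\downarrow\rangle\otimes|n-1\rangle .$$ The probability space is $\Omega=\mathbb T^{\mathbb Z}$ with the cylinder $\sigma$-algebra and $\mathbb P=\otimes_{k\in\mathbb Z}\mu$, with $\omega_k^\uparrow=\omega_{2k}$, $\omega_k^\downarrow=\omega_{2k+1}$; $\mathbb E$ is the expectation with respect to $\mathbb P$. $\mathbb S\subset\mathbb C$ is the unit circle, $C(\mathbb S)$ the complex-valued continuous functions on it, and $f(U_\omega)$ is defined by the functional calculus for unitary operators. *)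

theory Defs
  imports "HOL-Probability.Probability"
begin

section \<open>The torus $R / 2 \pi Z$\<close>

quotient_type torus = real / "\<lambda>x y. \<exists>k::int. y - x = 2 * pi * of_int k"
proof (rule equivpI)
  show "reflp (\<lambda>x y. \<exists>k::int. y - x = 2 * pi * of_int k)"
    by (rule reflpI, rule exI[of _ 0]) simp
  show "symp (\<lambda>x y. \<exists>k::int. y - x = 2 * pi * of_int k)"
  proof (rule sympI)
    fix x y :: real
    assume "\<exists>k::int. y - x = 2 * pi * of_int k"
    then obtain k :: int where "y - x = 2 * pi * of_int k" ..
    then have "x - y = 2 * pi * of_int (- k)" by simp
    then show "\<exists>k::int. x - y = 2 * pi * of_int k" ..
  qed
  show "transp (\<lambda>x y. \<exists>k::int. y - x = 2 * pi * of_int k)"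
  proof (rule transpI)
    fix x y z :: real
    assume "\<exists>k::int. y - x = 2 * pi * of_int k" "\<exists>k::int. z - y = 2 * pi * of_int k"
    then obtain k l :: int where "y - x = 2 * pi * of_int k" "z - y = 2 * pi * of_int l"
      by blast
    then have "z - x = 2 * pi * of_int (k + l)" by (simp add: algebra_simps)
    then show "\<exists>k::int. z - x = 2 * pi * of_int k" ..
  qed
qed

text \<open>The quotient topology.\<close>

instantiation torus :: topological_space
begin

definition open_torus :: "torus set \<Rightarrow> bool"
  where "open_torus U \<longleftrightarrow> open (abs_torus -` U)"

instance
proof
  show "open (UNIV :: torus set)"
    by (simp add: open_torus_def)
  show "open (S \<inter> T)" if "open S" "open T" for S T :: "torus set"
    using that by (simp add: open_torus_def open_Int vimage_Int)
  show "open (\<Union>K)" if "\<forall>S\<in>K. open S" for K :: "torus set set"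
    using that by (auto simp: open_torus_def vimage_Union)
qed

end

lemma continuous_on_abs_torus: "continuous_on UNIV abs_torus"
  by (simp add: continuous_on_open_vimage open_torus_def)

lift_definition torus_phase :: "torus \<Rightarrow> complex" is "\<lambda>x. exp (- \<i> * complex_of_real x)"
proof -
  fix x y :: real
  assume "\<exists>k::int. y - x = 2 * pi * of_int k"
  then obtain k :: int where "y = x + 2 * pi * of_int k" by (auto simp: algebra_simps)
  then have "- \<i> * complex_of_real y
      = - \<i> * complex_of_real x + complex_of_real (2 * of_int (- k) * pi) * \<i>"
    by (simp add: algebra_simps)
  then show "exp (- \<i> * complex_of_real x) = exp (- \<i> * complex_of_real y)"
    unfolding exp_eq by (intro exI[of _ k]) (simp add: algebra_simps)
qed

text \<open>Unnormalised Lebesgue measure, of total mass $2 \pi$.\<close>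

definition lebesgue_torus :: "torus measure"
  where "lebesgue_torus = distr (restrict_space lborel {0..<2*pi}) borel abs_torus"

definition measure_support :: "'a::topological_space measure \<Rightarrow> 'a set"
  where "measure_support M = {x. \<forall>U. open U \<and> x \<in> U \<longrightarrow> emeasure M U > 0}"


section \<open>Square-summable functions\<close>

typedef 'a ell2 = "{f :: 'a \<Rightarrow> complex. (\<lambda>x. (cmod (f x))\<^sup>2) summable_on UNIV}"
  morphisms coord Abs_ell2
  by (rule exI[of _ "\<lambda>_. 0"]) simp

setup_lifting type_definition_ell2

lemma coord_square_summable: "(\<lambda>x. (cmod (coord \<psi> x))\<^sup>2) summable_on UNIV"
  using coord[of \<psi>] by simp

lemma square_summable_add:
  fixes f g :: "'a \<Rightarrow> complex"
  assumes "(\<lambda>x. (cmod (f x))\<^sup>2) summable_on A" "(\<lambda>x. (cmod (g x))\<^sup>2) summable_on A"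
  shows "(\<lambda>x. (cmod (f x + g x))\<^sup>2) summable_on A"
proof (rule summable_on_comparison_test)
  show "(\<lambda>x. 2 * (cmod (f x))\<^sup>2 + 2 * (cmod (g x))\<^sup>2) summable_on A"
    using assms by (intro summable_on_add summable_on_cmult_right)
  fix x
  have "(cmod (f x + g x))\<^sup>2 \<le> (cmod (f x) + cmod (g x))\<^sup>2"
    by (intro power_mono norm_triangle_ineq) auto
  also have "\<dots> \<le> 2 * (cmod (f x))\<^sup>2 + 2 * (cmod (g x))\<^sup>2"
    using sum_squares_bound[of "cmod (f x)" "cmod (g x)"] by (simp add: power2_sum)
  finally show "(cmod (f x + g x))\<^sup>2 \<le> 2 * (cmod (f x))\<^sup>2 + 2 * (cmod (g x))\<^sup>2" .
qed auto

lemma square_summable_mult: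
  fixes f :: "'a \<Rightarrow> complex"
  assumes "(\<lambda>x. (cmod (f x))\<^sup>2) summable_on A"
  shows "(\<lambda>x. (cmod (c * f x))\<^sup>2) summable_on A"
  using assms by (simp add: norm_mult power_mult_distrib summable_on_cmult_right)

instantiation ell2 :: (type) real_vector
begin

lift_definition zero_ell2 :: "'a ell2" is "\<lambda>_. 0" by simp

lift_definition plus_ell2 :: "'a ell2 \<Rightarrow> 'a ell2 \<Rightarrow> 'a ell2" is "\<lambda>f g x. f x + g x"
  by (rule square_summable_add)

lift_definition uminus_ell2 :: "'a ell2 \<Rightarrow> 'a ell2" is "\<lambda>f x. - f x" by simp

lift_definition minus_ell2 :: "'a ell2 \<Rightarrow> 'a ell2 \<Rightarrow> 'a ell2" is "\<lambda>f g x. f x - g x"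
  using square_summable_add[of _ UNIV "\<lambda>x. - _ x"] by simp

lift_definition scaleR_ell2 :: "real \<Rightarrow> 'a ell2 \<Rightarrow> 'a ell2" is "\<lambda>c f x. complex_of_real c * f x"
  by (rule square_summable_mult)

instance
  by standard (transfer; simp add: fun_eq_iff algebra_simps)+

end

lift_definition scaleC :: "complex \<Rightarrow> 'a ell2 \<Rightarrow> 'a ell2" is "\<lambda>c f x. c * f x"
  by (rule square_summable_mult)

definition cinner :: "'a ell2 \<Rightarrow> 'a ell2 \<Rightarrow> complex"
  where "cinner \<phi> \<psi> = (\<Sum>\<^sub>\<infinity>x. cnj (coord \<phi> x) * coord \<psi> x)"

lemma cinner_summable: "(\<lambda>x. cnj (coord \<phi> x) * coord \<psi> x) summable_on UNIV"
proof (rule abs_summable_summable, rule summable_on_comparison_test)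
  show "(\<lambda>x. (cmod (coord \<phi> x))\<^sup>2 + (cmod (coord \<psi> x))\<^sup>2) summable_on UNIV"
    by (intro summable_on_add coord_square_summable)
  show "cmod (cnj (coord \<phi> x) * coord \<psi> x) \<le> (cmod (coord \<phi> x))\<^sup>2 + (cmod (coord \<psi> x))\<^sup>2" for x
  proof -
    have "0 \<le> (cmod (coord \<phi> x) - cmod (coord \<psi> x))\<^sup>2 + (cmod (coord \<phi> x))\<^sup>2 + (cmod (coord \<psi> x))\<^sup>2"
      by simp
    then show ?thesis by (simp add: norm_mult power2_diff)
  qed
qed auto

lemma infsum_of_real_complex:
  assumes "f summable_on A"
  shows "(\<Sum>\<^sub>\<infinity>x\<in>A. complex_of_real (f x)) = complex_of_real (infsum f A)"
  using has_sum_of_real[OF has_sum_infsum[OF assms]] by (rule infsumI)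

lemma cinner_self: "cinner \<psi> \<psi> = complex_of_real (\<Sum>\<^sub>\<infinity>x. (cmod (coord \<psi> x))\<^sup>2)"
proof -
  have "cinner \<psi> \<psi> = (\<Sum>\<^sub>\<infinity>x. complex_of_real ((cmod (coord \<psi> x))\<^sup>2))"
    unfolding cinner_def by (intro infsum_cong) (metis complex_norm_square mult.commute)
  then show ?thesis by (simp only: infsum_of_real_complex coord_square_summable)
qed

lemma cinner_commute: "cinner \<phi> \<psi> = cnj (cinner \<psi> \<phi>)"
  unfolding cinner_def infsum_cnj[symmetric] by (simp add: mult.commute)

lemma cinner_add_left: "cinner (\<phi> + \<phi>') \<psi> = cinner \<phi> \<psi> + cinner \<phi>' \<psi>"
  unfolding cinner_def
  by (simp add: plus_ell2.rep_eq distrib_right infsum_add cinner_summable)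

lemma cinner_scaleC_left: "cinner (scaleC c \<phi>) \<psi> = cnj c * cinner \<phi> \<psi>"
  unfolding cinner_def
  by (simp add: scaleC.rep_eq infsum_cmult_right' mult.assoc)

lemma scaleR_scaleC: "scaleR c \<psi> = scaleC (complex_of_real c) \<psi>"
  by transfer simp

text \<open>The underlying real inner product, whose norm is the Hilbert space norm.\<close>

instantiation ell2 :: (type) real_inner
begin

definition inner_ell2 :: "'a ell2 \<Rightarrow> 'a ell2 \<Rightarrow> real"
  where "inner_ell2 \<phi> \<psi> = Re (cinner \<phi> \<psi>)"

definition norm_ell2 :: "'a ell2 \<Rightarrow> real"
  where "norm_ell2 \<psi> = sqrt (inner \<psi> \<psi>)"

definition sgn_ell2 :: "'a ell2 \<Rightarrow> 'a ell2"
  where "sgn_ell2 \<psi> = inverse (norm \<psi>) *\<^sub>R \<psi>"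

definition dist_ell2 :: "'a ell2 \<Rightarrow> 'a ell2 \<Rightarrow> real"
  where "dist_ell2 \<phi> \<psi> = norm (\<phi> - \<psi>)"

definition uniformity_ell2 :: "('a ell2 \<times> 'a ell2) filter"
  where "uniformity_ell2 = (INF e\<in>{0 <..}. principal {(x, y). dist x y < e})"

definition open_ell2 :: "'a ell2 set \<Rightarrow> bool"
  where "open_ell2 U \<longleftrightarrow> (\<forall>x\<in>U. eventually (\<lambda>(x', y). x' = x \<longrightarrow> y \<in> U) uniformity)"

instance
proof
  fix x y z :: "'a ell2" and r :: real
  show "dist x y = norm (x - y)" by (rule dist_ell2_def)
  show "sgn x = x /\<^sub>R norm x" by (rule sgn_ell2_def)
  show "uniformity = (INF e\<in>{0 <..}. principal {(x :: 'a ell2, y). dist x y < e})"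
    by (rule uniformity_ell2_def)
  show "open U = (\<forall>x\<in>U. \<forall>\<^sub>F (x', y) in uniformity. x' = x \<longrightarrow> y \<in> U)" for U :: "'a ell2 set"
    by (rule open_ell2_def)
  show "x \<bullet> y = y \<bullet> x"
    unfolding inner_ell2_def by (subst cinner_commute) simp
  show "(x + y) \<bullet> z = x \<bullet> z + y \<bullet> z"
    by (simp add: inner_ell2_def cinner_add_left)
  show "(r *\<^sub>R x) \<bullet> y = r * (x \<bullet> y)"
    by (simp add: inner_ell2_def scaleR_scaleC cinner_scaleC_left)
  show "0 \<le> x \<bullet> x"
    by (simp add: inner_ell2_def cinner_self infsum_nonneg)
  show "x \<bullet> x = 0 \<longleftrightarrow> x = 0"
  proof
    assume "x \<bullet> x = 0"
    then have "(\<Sum>\<^sub>\<infinity>i. (cmod (coord x i))\<^sup>2) = 0"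
      by (simp add: inner_ell2_def cinner_self)
    then have "(cmod (coord x i))\<^sup>2 = 0" for i
      using nonneg_infsum_le_0D[OF _ coord_square_summable, of x i] by simp
    then show "x = 0" by transfer (simp add: fun_eq_iff)
  next
    assume "x = 0"
    then show "x \<bullet> x = 0" by (simp add: inner_ell2_def cinner_def zero_ell2.rep_eq)
  qed
  show "norm x = sqrt (x \<bullet> x)" by (rule norm_ell2_def)
qed

end

lift_definition ket :: "'a \<Rightarrow> 'a ell2" is "\<lambda>a x. of_bool (x = a)"
  by (rule summable_on_cong_neutral[THEN iffD2, OF _ _ _ summable_on_finite[of "{_}"]]) auto


section \<open>Continuous functional calculus on the unit circle\<close>

definition bounded_clinear :: "('a ell2 \<Rightarrow> 'b ell2) \<Rightarrow> bool"
  where "bounded_clinear A \<longleftrightarrow>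
    bounded_linear A \<and> (\<forall>c \<psi>. A (scaleC c \<psi>) = scaleC c (A \<psi>))"

definition unitary :: "('a ell2 \<Rightarrow> 'b ell2) \<Rightarrow> bool"
  where "unitary U \<longleftrightarrow>
    bounded_clinear U \<and> (\<forall>\<phi> \<psi>. cinner (U \<phi>) (U \<psi>) = cinner \<phi> \<psi>) \<and> surj U"

text \<open>Elements of $C(S)$ are represented by functions on the complex plane whose restriction
  to the unit circle is continuous; only that restriction matters.\<close>

definition circle_continuous :: "(complex \<Rightarrow> complex) set"
  where "circle_continuous = {f. continuous_on (sphere 0 1) f}"

text \<open>For unitary \<open>U\<close>, there is exactly one unital \<open>*\<close>-homomorphism from $C(S)$ to the bounded
  operators that maps the identity function to \<open>U\<close>; it is automatically contractive.\<close>

definition circle_calculus ::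
    "('a ell2 \<Rightarrow> 'a ell2) \<Rightarrow> ((complex \<Rightarrow> complex) \<Rightarrow> 'a ell2 \<Rightarrow> 'a ell2) \<Rightarrow> bool"
  where "circle_calculus U \<Phi> \<longleftrightarrow>
    (\<forall>f\<in>circle_continuous. bounded_clinear (\<Phi> f)) \<and>
    (\<forall>f\<in>circle_continuous. \<forall>g\<in>circle_continuous.
       (\<forall>z\<in>sphere 0 1. f z = g z) \<longrightarrow> \<Phi> f = \<Phi> g) \<and>
    \<Phi> (\<lambda>z. 1) = id \<and>
    \<Phi> (\<lambda>z. z) = U \<and>
    (\<forall>f\<in>circle_continuous. \<forall>g\<in>circle_continuous.
       \<Phi> (\<lambda>z. f z + g z) = (\<lambda>\<psi>. \<Phi> f \<psi> + \<Phi> g \<psi>) \<and>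
       \<Phi> (\<lambda>z. f z * g z) = \<Phi> f \<circ> \<Phi> g) \<and>
    (\<forall>c. \<forall>f\<in>circle_continuous. \<Phi> (\<lambda>z. c * f z) = (\<lambda>\<psi>. scaleC c (\<Phi> f \<psi>))) \<and>
    (\<forall>f\<in>circle_continuous. \<forall>\<phi> \<psi>.
       cinner (\<Phi> f \<phi>) \<psi> = cinner \<phi> (\<Phi> (\<lambda>z. cnj (f z)) \<psi>))"

definition circle_fun :: "(complex \<Rightarrow> complex) \<Rightarrow> ('a ell2 \<Rightarrow> 'a ell2) \<Rightarrow> 'a ell2 \<Rightarrow> 'a ell2"
  where "circle_fun f U = (THE A. \<exists>\<Phi>. circle_calculus U \<Phi> \<and> A = \<Phi> f)"


definition sup_matrix_element :: "('a ell2 \<Rightarrow> 'a ell2) \<Rightarrow> 'a ell2 \<Rightarrow> 'a ell2 \<Rightarrow> ennreal"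
  where "sup_matrix_element U \<phi> \<psi> =
    (SUP f \<in> {f \<in> circle_continuous. \<forall>z\<in>sphere 0 1. cmod (f z) \<le> 1}.
      ennreal (cmod (cinner \<phi> (circle_fun f U \<psi>))))"


section \<open>The random quantum walk\<close>

datatype spin = Up | Down

text \<open>$C^2 \otimes l^2(Z)$ is realised as $l^2$ over \<open>spin \<times> int\<close>, the basis vector
  $\sigma \otimes j$ being \<open>ket (\<sigma>, j)\<close>.\<close>

type_synonym walk_space = "(spin \<times> int) ell2"

definition phase_Up :: "(int \<Rightarrow> torus) \<Rightarrow> int \<Rightarrow> complex"
  where "phase_Up \<omega> n = torus_phase (\<omega> (2 * n))"

definition phase_Down :: "(int \<Rightarrow> torus) \<Rightarrow> int \<Rightarrow> complex"
  where "phase_Down \<omega> n = torus_phase (\<omega> (2 * n + 1))"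

lemma square_summable_shift:
  assumes "(\<lambda>x. (cmod (f x))\<^sup>2) summable_on (UNIV :: (spin \<times> int) set)"
    and "\<And>n. cmod (p n) = 1"
  shows "(\<lambda>n. (cmod (p n * (a * f (Up, n + m) + b * f (Down, n + m)))::real)\<^sup>2)
    summable_on (UNIV :: int set)"
proof -
  have s: "(\<lambda>n. (cmod (f (\<sigma>, n + m)))\<^sup>2) summable_on (UNIV :: int set)" for \<sigma>
  proof -
    have "(\<lambda>x. (cmod (f x))\<^sup>2) summable_on range (\<lambda>n. (\<sigma>, n + m))"
      using assms(1) by (rule summable_on_subset_banach) simp
    moreover have "inj (\<lambda>n. (\<sigma>, n + m))" by (rule injI) simp
    ultimately show ?thesis by (simp add: summable_on_reindex o_def)
  qed
  show ?thesis
    using square_summable_add[OF square_summable_mult[OF s[of Up], of a]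
        square_summable_mult[OF s[of Down], of b]]
    by (simp add: norm_mult assms(2))
qed

lemma summable_on_spin:
  fixes g :: "spin \<times> int \<Rightarrow> real"
  assumes "(\<lambda>n. g (Up, n)) summable_on UNIV" "(\<lambda>n. g (Down, n)) summable_on UNIV"
  shows "g summable_on UNIV"
proof -
  have "g summable_on range (Pair \<sigma>)" for \<sigma>
    using assms by (cases \<sigma>) (simp_all add: summable_on_reindex inj_on_def o_def)
  then have "g summable_on (range (Pair Up) \<union> range (Pair Down))"
    by (intro summable_on_Un_disjoint) auto
  moreover have "range (Pair Up) \<union> range (Pair Down) = (UNIV :: (spin \<times> int) set)"
    by (auto, metis rangeI spin.exhaust)
  ultimately show ?thesis by simp
qed

lemma norm_torus_phase [simp]: "cmod (torus_phase x) = 1"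
  by transfer simp

text \<open>The walk in coordinates; the action on basis vectors is \<open>walk_ket_Up\<close> and
  \<open>walk_ket_Down\<close> below.\<close>

lift_definition walk :: "real \<Rightarrow> real \<Rightarrow> (int \<Rightarrow> torus) \<Rightarrow> walk_space \<Rightarrow> walk_space"
  is "\<lambda>r t \<omega> f (\<sigma>, n).
    case \<sigma> of
      Up \<Rightarrow> phase_Up \<omega> (n - 1) * (of_real t * f (Up, n - 1) - of_real r * f (Down, n - 1))
    | Down \<Rightarrow> phase_Down \<omega> (n + 1) * (of_real r * f (Up, n + 1) + of_real t * f (Down, n + 1))"
proof -
  fix r t :: real and \<omega> :: "int \<Rightarrow> torus" and f :: "spin \<times> int \<Rightarrow> complex"
  assume f: "(\<lambda>x. (cmod (f x))\<^sup>2) summable_on UNIV"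
  show "(\<lambda>x. (cmod (case x of (\<sigma>, n) \<Rightarrow> (case \<sigma> of
      Up \<Rightarrow> phase_Up \<omega> (n - 1) * (of_real t * f (Up, n - 1) - of_real r * f (Down, n - 1))
    | Down \<Rightarrow> phase_Down \<omega> (n + 1) * (of_real r * f (Up, n + 1) + of_real t * f (Down, n + 1)))))\<^sup>2)
    summable_on UNIV"
    using square_summable_shift[OF f, of "\<lambda>n. phase_Up \<omega> (n - 1)" "of_real t" "-1" "- of_real r"]
      square_summable_shift[OF f, of "\<lambda>n. phase_Down \<omega> (n + 1)" "of_real r" 1 "of_real t"]
    by (intro summable_on_spin) (simp_all add: phase_Up_def phase_Down_def)
qed

lemma walk_ket_Up:
  "walk r t \<omega> (ket (Up, n)) =
    scaleC (phase_Up \<omega> n * of_real t) (ket (Up, n + 1)) +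
    scaleC (phase_Down \<omega> n * of_real r) (ket (Down, n - 1))"
  by transfer (auto simp: fun_eq_iff split: spin.splits)

lemma walk_ket_Down:
  "walk r t \<omega> (ket (Down, n)) =
    scaleC (- phase_Up \<omega> n * of_real r) (ket (Up, n + 1)) +
    scaleC (phase_Down \<omega> n * of_real t) (ket (Down, n - 1))"
  by transfer (auto simp: fun_eq_iff split: spin.splits)

lemma summable_coord_slice:
  "(\<lambda>n. (cmod (coord \<psi> (\<sigma>, n + m)))\<^sup>2) summable_on (UNIV :: int set)"
proof -
  have "(\<lambda>x. (cmod (coord \<psi> x))\<^sup>2) summable_on range (\<lambda>n. (\<sigma>, n + m))"
    using coord_square_summable by (rule summable_on_subset_banach) simp
  moreover have "inj (\<lambda>n. (\<sigma>, n + m))" by (rule injI) simp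
  ultimately show ?thesis by (simp add: summable_on_reindex o_def)
qed

lemma cinner_spin:
  fixes \<phi> \<psi> :: walk_space
  shows "((\<lambda>n. cnj (coord \<phi> (Up, n + a)) * coord \<psi> (Up, n + a)
      + cnj (coord \<phi> (Down, n + b)) * coord \<psi> (Down, n + b)) has_sum cinner \<phi> \<psi>) UNIV"
proof -
  define g where "g = (\<lambda>x. cnj (coord \<phi> x) * coord \<psi> x)"
  define S where "S \<sigma> = infsum g (range (Pair \<sigma>))" for \<sigma>
  have gs: "g summable_on A" for A
    using cinner_summable[of \<phi> \<psi>] summable_on_subset_banach by (fastforce simp: g_def)
  have s: "((\<lambda>n. g (\<sigma>, n + m)) has_sum S \<sigma>) UNIV" for \<sigma> and m :: int
  proof -
    have r: "range (\<lambda>n. (\<sigma>, n + m)) = range (Pair \<sigma>)"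
      by (auto simp: image_iff) (metis diff_add_cancel)
    have "(g has_sum S \<sigma>) (range (\<lambda>n. (\<sigma>, n + m)))"
      unfolding r S_def by (rule has_sum_infsum[OF gs])
    then show ?thesis by (subst (asm) has_sum_reindex) (auto simp: inj_on_def o_def)
  qed
  have "S Up + S Down = infsum g (range (Pair Up) \<union> range (Pair Down))"
    unfolding S_def by (rule infsum_Un_disjoint[symmetric]) (auto simp: gs)
  also have "range (Pair Up) \<union> range (Pair Down) = (UNIV :: (spin \<times> int) set)"
    by (auto, metis rangeI spin.exhaust)
  finally have "cinner \<phi> \<psi> = S Up + S Down"
    by (simp add: cinner_def g_def)
  then show ?thesis
    using has_sum_add[OF s[of Up a] s[of Down b]] by (simp add: g_def)
qed

lemma unitary_walk:
  assumes "r\<^sup>2 + t\<^sup>2 = 1"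
  shows "unitary (walk r t \<omega>)"
proof -
  let ?U = "walk r t \<omega>"
  have rt: "of_real r * of_real r + of_real t * of_real t = (1 :: complex)"
    using assms by (simp add: power2_eq_square flip: of_real_mult of_real_add)
  have ph: "cnj (phase_Up \<omega> n) * phase_Up \<omega> n = 1" "cnj (phase_Down \<omega> n) * phase_Down \<omega> n = 1"
    "phase_Up \<omega> n * cnj (phase_Up \<omega> n) = 1" "phase_Down \<omega> n * cnj (phase_Down \<omega> n) = 1" for n
    by (simp_all add: phase_Up_def phase_Down_def complex_norm_square[symmetric] mult.commute)
  have add: "?U (\<phi> + \<psi>) = ?U \<phi> + ?U \<psi>" for \<phi> \<psi>
    by transfer (auto simp: fun_eq_iff algebra_simps split: spin.splits)
  have scale: "?U (scaleC c \<psi>) = scaleC c (?U \<psi>)" for c \<psi>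
    by transfer (auto simp: fun_eq_iff algebra_simps split: spin.splits)
  have iso: "cinner (?U \<phi>) (?U \<psi>) = cinner \<phi> \<psi>" for \<phi> \<psi>
  proof (rule has_sum_unique)
    show "((\<lambda>n. cnj (coord \<phi> (Up, n)) * coord \<psi> (Up, n)
      + cnj (coord \<phi> (Down, n)) * coord \<psi> (Down, n)) has_sum cinner \<phi> \<psi>) UNIV"
      using cinner_spin[of \<phi> 0 \<psi> 0] by simp
    have alg: "cnj (p * (t' * x - r' * y)) * (p * (t' * x' - r' * y'))
        + cnj (q * (r' * x + t' * y)) * (q * (r' * x' + t' * y')) = cnj x * x' + cnj y * y'"
      if "cnj p * p = 1" "cnj q * q = 1" "r' * r' + t' * t' = 1" "cnj r' = r'" "cnj t' = t'"
      for p q r' t' x x' y y'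
    proof -
      have "cnj (p * (t' * x - r' * y)) * (p * (t' * x' - r' * y'))
        + cnj (q * (r' * x + t' * y)) * (q * (r' * x' + t' * y'))
        = (cnj p * p) * ((t' * cnj x - r' * cnj y) * (t' * x' - r' * y'))
        + (cnj q * q) * ((r' * cnj x + t' * cnj y) * (r' * x' + t' * y'))"
        using that(4,5) by (simp add: mult_ac)
      also have "\<dots> = (r' * r' + t' * t') * (cnj x * x' + cnj y * y')"
        unfolding that(1,2) by (simp add: algebra_simps)
      finally show ?thesis using that(3) by simp
    qed
    show "((\<lambda>n. cnj (coord \<phi> (Up, n)) * coord \<psi> (Up, n)
      + cnj (coord \<phi> (Down, n)) * coord \<psi> (Down, n)) has_sum cinner (?U \<phi>) (?U \<psi>)) UNIV"
      using cinner_spin[of "?U \<phi>" 1 "?U \<psi>" "-1"]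
      by (simp add: walk.rep_eq alg ph rt del: complex_cnj_mult complex_cnj_add complex_cnj_diff)
  qed
  have "surj ?U"
    unfolding surj_def
  proof (intro allI exI)
    fix \<psi> :: walk_space
    define f where "f = (\<lambda>(\<sigma>, n). case \<sigma> of
        Up \<Rightarrow> of_real t * cnj (phase_Up \<omega> n) * coord \<psi> (Up, n + 1)
          + of_real r * cnj (phase_Down \<omega> n) * coord \<psi> (Down, n + -1)
      | Down \<Rightarrow> - of_real r * cnj (phase_Up \<omega> n) * coord \<psi> (Up, n + 1)
          + of_real t * cnj (phase_Down \<omega> n) * coord \<psi> (Down, n + -1))"
    have u: "(\<lambda>n. (cmod (cnj (phase_Up \<omega> n) * coord \<psi> (Up, n + 1)))\<^sup>2) summable_on UNIV"
      using summable_coord_slice[of \<psi> Up 1] by (simp add: norm_mult phase_Up_def)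
    have d: "(\<lambda>n. (cmod (cnj (phase_Down \<omega> n) * coord \<psi> (Down, n + -1)))\<^sup>2) summable_on UNIV"
      using summable_coord_slice[of \<psi> Down "-1"] by (simp add: norm_mult phase_Down_def)
    have "(\<lambda>x. (cmod (f x))\<^sup>2) summable_on UNIV"
    proof (rule summable_on_spin)
      show "(\<lambda>n. (cmod (f (Up, n)))\<^sup>2) summable_on UNIV"
        using square_summable_add[OF square_summable_mult[OF u, of "of_real t"]
            square_summable_mult[OF d, of "of_real r"]] by (simp add: f_def mult.assoc)
      show "(\<lambda>n. (cmod (f (Down, n)))\<^sup>2) summable_on UNIV"
        using square_summable_add[OF square_summable_mult[OF u, of "- of_real r"]
            square_summable_mult[OF d, of "of_real t"]] by (simp add: f_def mult.assoc)
    qed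
    then have c: "coord (Abs_ell2 f) = f" by (simp add: Abs_ell2_inverse)
    have alg: "p * (t' * (t' * p' * x + r' * q' * y) - r' * (- r' * p' * x + t' * q' * y)) = x"
      "q * (r' * (t' * p' * x + r' * q' * y) + t' * (- r' * p' * x + t' * q' * y)) = y"
      if "p * p' = 1" "q * q' = 1" "r' * r' + t' * t' = 1" for p p' q q' r' t' x y :: complex
      using that by algebra+
    have "coord (?U (Abs_ell2 f)) (Up, n) = coord \<psi> (Up, n)" for n
      using alg(1)[OF ph(3)[of "n - 1"] ph(4)[of "n - 1"] rt]
      unfolding walk.rep_eq c by (simp add: f_def)
    moreover have "coord (?U (Abs_ell2 f)) (Down, n) = coord \<psi> (Down, n)" for n
      using alg(2)[OF ph(3)[of "n + 1"] ph(4)[of "n + 1"] rt]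
      unfolding walk.rep_eq c by (simp add: f_def)
    ultimately have "coord (?U (Abs_ell2 f)) x = coord \<psi> x" for x
      by (cases x; cases "fst x") simp_all
    then show "\<psi> = ?U (Abs_ell2 f)"
      by (simp add: fun_eq_iff flip: coord_inject)
  qed
  moreover have "bounded_linear ?U"
  proof (rule bounded_linear_intro[of _ 1])
    show "norm (?U \<psi>) \<le> norm \<psi> * 1" for \<psi>
      by (simp add: norm_ell2_def inner_ell2_def iso)
  qed (simp_all add: add scaleR_scaleC scale)
  ultimately show ?thesis
    by (simp add: unitary_def bounded_clinear_def iso scale)
qed

end

theory Submission
  imports Defs "HOL-Complex_Analysis.Complex_Analysis"
begin

text \<open>The proof is a Kunz-Souillard argument. Cut the walk off at the sites \<open>-L\<close> and \<open>L\<close>, with a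
  reflecting wall at \<open>L\<close> and an open end at \<open>-L\<close>. For \<open>z\<close> on the circle there is one scattering state
  \<open>\<Psi>\<^sub>z\<close> with incoming amplitude 1 at the open end. Scattering states are complete, so that
  \<open>\<langle>x, f(U) y\<rangle>\<close> is the mean of \<open>f(1/z) \<Psi>\<^sub>z(x) cnj (\<Psi>\<^sub>z(y))\<close> over the circle for every Laurent polynomial \<open>f\<close>
  of degree below the distance of \<open>x\<close> and \<open>y\<close> to the boundary. Hence the supremum over \<open>f\<close> is at most
  the mean of \<open>|\<Psi>\<^sub>z(x)| |\<Psi>\<^sub>z(y)|\<close>, in the limit of large \<open>L\<close>.

  All the energy is reflected, so \<open>\<Psi>\<^sub>z\<close> is governed by reflection coefficients of modulus 1, a Markov chain
  on the circle driven by a Moebius map and independent phases, and \<open>|\<Psi>\<^sub>z(x)| |\<Psi>\<^sub>z(y)|\<close> is a product of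
  powers of \<open>|M'|\<close>, where \<open>M\<close> is the Moebius map: exponent 0 between the wall and the first of
  the two sites, \<open>1/2\<close> between the sites and 1 beyond the second. The corresponding transfer operators are Markov,
  a convolution after an isometry of $L^2$, and mass preserving. As the isometry
  moves the constants, on which alone the convolution is not a strict contraction, two steps of the middle
  operator contract $L^2$, uniformly in \<open>z\<close>; this gives the exponential decay.\<close>

section \<open>The uniform measure on the circle\<close>

text \<open>The supremum over \<open>f\<close> stands inside the expectation, so a bound free of
  \<open>f\<close> has to be found before averaging. A box closed on both sides has eigenvalues that
  move with the phases; with one open end the spectral parameter \<open>z\<close> is uniform on the
  circle whatever the phases are, and Fubini reduces the claim to a bound for fixed
  \<open>z\<close>. No spectral theorem is used: the calculus arises by completing Laurent
  polynomials in \<open>U\<close>. These have finite range and cannot tell the walk in a large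
  enough box from the full one. No box is large enough for all degrees, hence Fatou's lemma at the
  end. The law of the phases enters in two ways. Its bounded density makes averaging send $L^1$ into
  bounded functions, which controls the two outer stretches of the chain. Its absolute continuity
  makes the difference of two independent phases charge all small angles, which gives the
  convolution a spectral gap off the constants. Total reflection at the wall keeps the reflection
  coefficients on the circle, so that the uniform measure there serves as reference for all three
  operators.\<close>

definition circle_measure :: "complex measure"
  where "circle_measure = distr (density lborel (\<lambda>\<theta>. ennreal (1 / (2*pi)) * indicator {0..<2*pi} \<theta>)) borel cis"

lemma measurable_cis [measurable]: "cis \<in> borel_measurable borel"
  by (intro borel_measurable_continuous_onI) (intro continuous_intros)

lemma sets_circle_measure [simp, measurable_cong]: "sets circle_measure = sets borel"
  by (simp add: circle_measure_def)

lemma space_circle_measure [simp]: "space circle_measure = UNIV"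
  by (simp add: circle_measure_def)

lemma nn_integral_circle_measure:
  assumes [measurable]: "f \<in> borel_measurable borel"
  shows "(\<integral>\<^sup>+z. f z \<partial>circle_measure) = ennreal (1 / (2*pi)) * (\<integral>\<^sup>+\<theta>\<in>{0..<2*pi}. f (cis \<theta>) \<partial>lborel)"
  unfolding circle_measure_def
  by (simp add: nn_integral_distr nn_integral_density mult_ac flip: nn_integral_cmult)

lemma prob_space_circle_measure: "prob_space circle_measure"
proof
  have "emeasure circle_measure (space circle_measure) = (\<integral>\<^sup>+z. 1 \<partial>circle_measure)" by simp
  also have "\<dots> = 1"
    by (subst nn_integral_circle_measure) (auto simp: ennreal_mult[symmetric])
  finally show "emeasure circle_measure (space circle_measure) = 1" .
qed

interpretation circle: prob_space circle_measure by (rule prob_space_circle_measure)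

lemma AE_circle_measure: "AE z in circle_measure. cmod z = 1"
  unfolding circle_measure_def by (subst AE_distr_iff) auto

text \<open>The part of the shifted window beyond \<open>p\<close> is moved back by one period and
  fills the gap at the left end.\<close>

lemma nn_integral_periodic_shift:
  fixes F :: "real \<Rightarrow> ennreal"
  assumes [measurable]: "F \<in> borel_measurable borel" and per: "\<And>\<theta>. F (\<theta> + p) = F \<theta>"
    and a: "0 \<le> a" "a \<le> p"
  shows "(\<integral>\<^sup>+\<theta>\<in>{0..<p}. F (\<theta> + a) \<partial>lborel) = (\<integral>\<^sup>+\<theta>\<in>{0..<p}. F \<theta> \<partial>lborel)"
proof -
  have shift: "(\<integral>\<^sup>+\<theta>. f (\<theta> + b) \<partial>lborel) = (\<integral>\<^sup>+\<theta>. f \<theta> \<partial>lborel)"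
    if [measurable]: "f \<in> borel_measurable borel" for f :: "real \<Rightarrow> ennreal" and b
    using nn_integral_real_affine[of f 1 b] by (simp add: add.commute)
  have "(\<integral>\<^sup>+\<theta>\<in>{0..<p}. F (\<theta> + a) \<partial>lborel) = (\<integral>\<^sup>+\<theta>. F (\<theta> + a) * indicator {a..<p+a} (\<theta> + a) \<partial>lborel)"
    by (intro nn_integral_cong) (auto split: split_indicator)
  also have "\<dots> = (\<integral>\<^sup>+\<theta>. F \<theta> * indicator {a..<p+a} \<theta> \<partial>lborel)"
    by (rule shift[of "\<lambda>\<theta>. F \<theta> * indicator {a..<p+a} \<theta>"]) measurable
  also have "\<dots> = (\<integral>\<^sup>+\<theta>. F \<theta> * indicator {a..<p} \<theta> + F \<theta> * indicator {p..<p+a} \<theta> \<partial>lborel)"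
    using a by (intro nn_integral_cong) (auto split: split_indicator)
  also have "\<dots> = (\<integral>\<^sup>+\<theta>. F \<theta> * indicator {a..<p} \<theta> \<partial>lborel) + (\<integral>\<^sup>+\<theta>. F \<theta> * indicator {p..<p+a} \<theta> \<partial>lborel)"
    by (rule nn_integral_add) measurable
  also have "(\<integral>\<^sup>+\<theta>. F \<theta> * indicator {p..<p+a} \<theta> \<partial>lborel) = (\<integral>\<^sup>+\<theta>. F (\<theta> + p) * indicator {p..<p+a} (\<theta> + p) \<partial>lborel)"
    by (rule shift[of "\<lambda>\<theta>. F \<theta> * indicator {p..<p+a} \<theta>" p, symmetric]) measurable
  also have "\<dots> = (\<integral>\<^sup>+\<theta>. F \<theta> * indicator {0..<a} \<theta> \<partial>lborel)"
    by (intro nn_integral_cong) (auto split: split_indicator simp: per)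
  also have "(\<integral>\<^sup>+\<theta>. F \<theta> * indicator {a..<p} \<theta> \<partial>lborel) + \<dots>
     = (\<integral>\<^sup>+\<theta>. F \<theta> * indicator {a..<p} \<theta> + F \<theta> * indicator {0..<a} \<theta> \<partial>lborel)"
    by (rule nn_integral_add[symmetric]) measurable
  also have "\<dots> = (\<integral>\<^sup>+\<theta>\<in>{0..<p}. F \<theta> \<partial>lborel)"
    using a by (intro nn_integral_cong) (auto split: split_indicator)
  finally show ?thesis .
qed

lemma distr_circle_measure_rotate:
  assumes "cmod c = 1"
  shows "distr circle_measure borel ((*) c) = circle_measure"
proof (rule measure_eqI)
  fix A assume "A \<in> sets (distr circle_measure borel ((*) c))"
  then have [measurable]: "A \<in> sets borel" by simp
  obtain a where a: "0 \<le> a" "a < 2*pi" "c = cis a"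
  proof
    show "0 \<le> Arg2pi c" "Arg2pi c < 2*pi" by (rule Arg2pi_ge_0 Arg2pi_lt_2pi)+
    show "c = cis (Arg2pi c)" using Arg2pi_eq[of c] assms by (simp add: cis_conv_exp)
  qed
  have "emeasure (distr circle_measure borel ((*) c)) A = (\<integral>\<^sup>+z. indicator A (c * z) \<partial>circle_measure)"
  proof -
    have "emeasure (distr circle_measure borel ((*) c)) A = (\<integral>\<^sup>+z. indicator A z \<partial>distr circle_measure borel ((*) c))"
      by simp
    also have "\<dots> = (\<integral>\<^sup>+z. indicator A (c * z) \<partial>circle_measure)"
      by (rule nn_integral_distr) simp_all
    finally show ?thesis .
  qed
  also have "\<dots> = ennreal (1 / (2*pi)) * (\<integral>\<^sup>+\<theta>\<in>{0..<2*pi}. indicator A (cis (\<theta> + a)) \<partial>lborel)"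
    by (subst nn_integral_circle_measure) (simp_all add: a(3) cis_mult add.commute)
  also have "(\<integral>\<^sup>+\<theta>\<in>{0..<2*pi}. indicator A (cis (\<theta> + a)) \<partial>lborel) = (\<integral>\<^sup>+\<theta>\<in>{0..<2*pi}. indicator A (cis \<theta>) \<partial>lborel)"
    using a by (intro nn_integral_periodic_shift) (simp_all add: cis_mult[symmetric])
  also have "ennreal (1 / (2*pi)) * \<dots> = (\<integral>\<^sup>+z. indicator A z \<partial>circle_measure)"
    by (subst nn_integral_circle_measure) simp_all
  also have "\<dots> = emeasure circle_measure A" by simp
  finally show "emeasure (distr circle_measure borel ((*) c)) A = emeasure circle_measure A" .
qed simp

lemma nn_integral_circle_rotate:
  assumes "cmod c = 1" and [measurable]: "f \<in> borel_measurable borel"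
  shows "(\<integral>\<^sup>+z. f (c * z) \<partial>circle_measure) = (\<integral>\<^sup>+z. f z \<partial>circle_measure)"
  by (subst (2) distr_circle_measure_rotate[OF assms(1), symmetric]) (simp add: nn_integral_distr)

lemma integral_circle_rotate:
  fixes f :: "complex \<Rightarrow> 'b :: {banach, second_countable_topology}"
  assumes "cmod c = 1" and [measurable]: "f \<in> borel_measurable borel"
  shows "(\<integral>z. f (c * z) \<partial>circle_measure) = (\<integral>z. f z \<partial>circle_measure)"
  by (subst (2) distr_circle_measure_rotate[OF assms(1), symmetric]) (simp add: integral_distr)

lemma integrable_circle_measure:
  fixes f :: "complex \<Rightarrow> 'b :: {banach, second_countable_topology}"
  assumes "f \<in> borel_measurable borel" and "\<And>z. cmod z = 1 \<Longrightarrow> norm (f z) \<le> B"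
  shows "integrable circle_measure f"
  using AE_circle_measure assms by (intro circle.integrable_const_bound[of _ B]) auto

lemma borel_measurable_power_int [measurable]:
  "(\<lambda>z :: complex. z powi n) \<in> borel_measurable borel"
  unfolding power_int_def by measurable

lemma integrable_circle_power_int: "integrable circle_measure (\<lambda>z. z powi n)"
  by (rule integrable_circle_measure[of _ 1]) (auto simp: norm_power_int)

lemma integral_circle_power_int: "(\<integral>z. z powi n \<partial>circle_measure) = of_bool (n = 0)"
proof (cases "n = 0")
  case False
  \<comment> \<open>Rotation by an angle with \<open>c powi n = -1\<close> reverses the sign of the
    integral without changing its value.\<close>
  define c where "c = cis (pi / of_int n)"
  have c: "c powi n = -1" using False by (simp add: c_def cis_power_int)
  have "(\<integral>z. z powi n \<partial>circle_measure) = (\<integral>z. (c * z) powi n \<partial>circle_measure)"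
    by (rule integral_circle_rotate[symmetric]) (simp_all add: c_def)
  also have "\<dots> = - (\<integral>z. z powi n \<partial>circle_measure)"
    by (simp add: power_int_mult_distrib c)
  finally show ?thesis using False by (simp add: eq_neg_iff_add_eq_0 flip: mult_2)
qed (simp add: circle.prob_space[simplified])

lemma integral_circle_measure:
  fixes f :: "complex \<Rightarrow> 'b :: {banach, second_countable_topology}"
  assumes [measurable]: "f \<in> borel_measurable borel"
  shows "(\<integral>z. f z \<partial>circle_measure) = (1 / (2*pi)) *\<^sub>R (LINT \<theta>:{0..<2*pi}|lborel. f (cis \<theta>))"
proof -
  have "(\<integral>z. f z \<partial>circle_measure)
    = (\<integral>\<theta>. f (cis \<theta>) \<partial>(density lborel (\<lambda>\<theta>. ennreal (1 / (2*pi) * indicator {0..<2*pi} \<theta>))))"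
    unfolding circle_measure_def
    by (simp add: integral_distr ennreal_mult'[symmetric] ennreal_indicator[symmetric] del: ennreal_indicator)
  also have "\<dots> = (\<integral>\<theta>. (1 / (2*pi) * indicator {0..<2*pi} \<theta>) *\<^sub>R f (cis \<theta>) \<partial>lborel)"
    by (subst integral_density) auto
  also have "\<dots> = (1 / (2*pi)) *\<^sub>R (LINT \<theta>:{0..<2*pi}|lborel. f (cis \<theta>))"
    unfolding set_lebesgue_integral_def
    by (subst integral_scaleR_right[symmetric]) (simp add: mult.commute)
  finally show ?thesis .
qed

text \<open>Cauchy's formula at the centre becomes a mean because du / u = i d\<theta> on the unit
  circle. It is used to normalise the scattering states.\<close>

lemma circle_mean_value:
  fixes f :: "complex \<Rightarrow> complex"
  assumes [measurable]: "f \<in> borel_measurable borel"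
    and cont: "continuous_on (cball 0 1) f" and hol: "f holomorphic_on ball 0 1"
  shows "(\<integral>z. f z \<partial>circle_measure) = f 0"
proof -
  have "((\<lambda>u. f u / (u - 0)) has_contour_integral 2 * of_real pi * \<i> * f 0) (circlepath 0 1)"
    using cont hol by (rule Cauchy_integral_circlepath) simp
  then have "((\<lambda>u. f u / u) has_contour_integral 2 * of_real pi * \<i> * f 0) (part_circlepath 0 1 0 (2*pi))"
    by (simp add: circlepath_def)
  then have "((\<lambda>\<theta>. f (cis \<theta>) / cis \<theta> * 1 * \<i> * cis \<theta>) has_integral 2 * of_real pi * \<i> * f 0) {0..2*pi}"
    by (subst (asm) has_contour_integral_part_circlepath_iff) (simp_all add: cis_conv_exp mult_ac)
  then have "((\<lambda>\<theta>. (-\<i>) * (f (cis \<theta>) / cis \<theta> * 1 * \<i> * cis \<theta>)) has_integral (-\<i>) * (2 * of_real pi * \<i> * f 0)) {0..2*pi}"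
    by (rule has_integral_mult_right)
  then have *: "((\<lambda>\<theta>. f (cis \<theta>)) has_integral 2 * of_real pi * f 0) {0..2*pi}"
    by (simp add: mult_ac)
  have "continuous_on {0..2*pi} (\<lambda>\<theta>. f (cis \<theta>))"
    by (rule continuous_on_compose2[OF cont]) (auto intro!: continuous_intros)
  then have "set_integrable lborel {0..2*pi} (\<lambda>\<theta>. f (cis \<theta>))"
    by (intro borel_integrable_atLeastAtMost')
  then have "(LINT \<theta>:{0..2*pi}|lborel. f (cis \<theta>)) = 2 * of_real pi * f 0"
    using set_borel_integral_eq_integral(2) integral_unique[OF *] by metis
  also have "(LINT \<theta>:{0..2*pi}|lborel. f (cis \<theta>)) = (LINT \<theta>:{0..<2*pi}|lborel. f (cis \<theta>))"
    unfolding set_lebesgue_integral_def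
  proof (rule integral_cong_AE)
    show "AE \<theta> in lborel. indicator {0..2*pi} \<theta> *\<^sub>R f (cis \<theta>) = indicator {0..<2*pi} \<theta> *\<^sub>R f (cis \<theta>)"
      using AE_lborel_singleton[of "2*pi"] by eventually_elim (auto split: split_indicator)
  qed measurable
  finally show ?thesis
    by (simp add: integral_circle_measure scaleR_conv_of_real)
qed

section \<open>The space of square-summable families\<close>

lemma cinner_add_right: "cinner \<phi> (\<psi> + \<psi>') = cinner \<phi> \<psi> + cinner \<phi> \<psi>'"
  by (subst (1 2 3) cinner_commute) (simp add: cinner_add_left)

lemma cinner_scaleC_right: "cinner \<phi> (scaleC c \<psi>) = c * cinner \<phi> \<psi>"
  by (subst (1 2) cinner_commute) (simp add: cinner_scaleC_left)

lemma cinner_zero_left [simp]: "cinner 0 \<psi> = 0"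
  by (simp add: cinner_def zero_ell2.rep_eq)

lemma cinner_zero_right [simp]: "cinner \<psi> 0 = 0"
  by (simp add: cinner_def zero_ell2.rep_eq)

lemma scaleC_minus1: "scaleC (-1) \<psi> = - \<psi>"
  by transfer simp

lemma cinner_minus_right: "cinner \<phi> (- \<psi>) = - cinner \<phi> \<psi>"
  using cinner_scaleC_right[of \<phi> "-1" \<psi>] by (simp add: scaleC_minus1)

lemma cinner_diff_right: "cinner \<phi> (\<psi> - \<psi>') = cinner \<phi> \<psi> - cinner \<phi> \<psi>'"
  using cinner_add_right[of \<phi> \<psi> "- \<psi>'"] by (simp add: cinner_minus_right)

lemma cinner_sum_left: "cinner (\<Sum>i\<in>I. f i) \<psi> = (\<Sum>i\<in>I. cinner (f i) \<psi>)"
  by (induction I rule: infinite_finite_induct) (simp_all add: cinner_add_left)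

lemma cinner_sum_right: "cinner \<psi> (\<Sum>i\<in>I. f i) = (\<Sum>i\<in>I. cinner \<psi> (f i))"
  by (induction I rule: infinite_finite_induct) (simp_all add: cinner_add_right)

lemma power2_norm_ell2: "(norm \<psi>)\<^sup>2 = (\<Sum>\<^sub>\<infinity>x. (cmod (coord \<psi> x))\<^sup>2)"
  by (simp add: norm_ell2_def inner_ell2_def cinner_self infsum_nonneg)

lemma cinner_self_norm: "cinner \<psi> \<psi> = of_real ((norm \<psi>)\<^sup>2)"
  by (simp add: cinner_self power2_norm_ell2)

lemma norm_scaleC [simp]: "norm (scaleC c \<psi>) = cmod c * norm \<psi>"
proof -
  have cc: "c * cnj c = (complex_of_real (cmod c))\<^sup>2"
    by (metis complex_norm_square of_real_power)
  have "complex_of_real ((norm (scaleC c \<psi>))\<^sup>2) = of_real ((cmod c * norm \<psi>)\<^sup>2)"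
    unfolding cinner_self_norm[symmetric] cinner_scaleC_left cinner_scaleC_right
    by (simp add: cinner_self_norm power_mult_distrib cc flip: mult.assoc)
  then show ?thesis
    by (metis norm_ge_zero of_real_eq_iff power2_eq_iff_nonneg zero_le_mult_iff)
qed

lemma norm_cinner_le: "cmod (cinner \<phi> \<psi>) \<le> norm \<phi> * norm \<psi>"
proof (cases "cinner \<phi> \<psi> = 0")
  case False
  define c where "c = cnj (cinner \<phi> \<psi>) / cmod (cinner \<phi> \<psi>)"
  have c: "cmod c = 1" using False by (simp add: c_def norm_divide)
  have "cinner \<phi> (scaleC c \<psi>) = of_real (cmod (cinner \<phi> \<psi>))"
    using False by (simp add: c_def cinner_scaleC_right complex_norm_square[symmetric] power2_eq_square
      flip: of_real_mult mult.commute)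
      (simp add: mult.commute complex_norm_square[symmetric] power2_eq_square)
  then have "cmod (cinner \<phi> \<psi>) = \<phi> \<bullet> scaleC c \<psi>" by (simp add: inner_ell2_def)
  also have "\<dots> \<le> norm \<phi> * norm (scaleC c \<psi>)" by (rule norm_cauchy_schwarz)
  finally show ?thesis by (simp add: c)
qed simp

lemma cinner_ket_left: "cinner (ket x) \<psi> = coord \<psi> x"
proof -
  have "cinner (ket x) \<psi> = (\<Sum>\<^sub>\<infinity>y\<in>{x}. coord \<psi> y)"
    unfolding cinner_def by (intro infsum_cong_neutral) (auto simp: ket.rep_eq)
  then show ?thesis by simp
qed

lemma norm_ket [simp]: "norm (ket x) = 1"
proof -
  have "complex_of_real ((norm (ket x))\<^sup>2) = 1"
    unfolding cinner_self_norm[symmetric] by (simp add: cinner_ket_left ket.rep_eq)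
  then show ?thesis
    by (metis abs_norm_cancel of_real_eq_1_iff power2_eq_1_iff abs_1 abs_neg_one)
qed

lemma norm_coord_le: "cmod (coord \<psi> x) \<le> norm \<psi>"
  using norm_cinner_le[of "ket x" \<psi>] by (simp add: cinner_ket_left)

lemma ell2_eqI: "(\<And>x. coord \<phi> x = coord \<psi> x) \<Longrightarrow> \<phi> = \<psi>"
  by (simp add: coord_inject[symmetric] fun_eq_iff)

text \<open>Completeness makes the limits in \<open>circle_map\<close> exist. The tail estimate
  holds for the coordinatewise limit on every finite set of indices, hence on all of them; adding
  back one \<open>X N\<close> shows that the limit is square summable.\<close>

instance ell2 :: (type) banach
proof
  fix X :: "nat \<Rightarrow> 'a ell2"
  assume X: "Cauchy X"
  have "Cauchy (\<lambda>n. coord (X n) x)" for x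
  proof (rule CauchyI)
    fix e :: real assume "e > 0"
    then obtain M where "\<And>m n. m \<ge> M \<Longrightarrow> n \<ge> M \<Longrightarrow> norm (X m - X n) < e"
      using CauchyD[OF X] by blast
    then show "\<exists>M. \<forall>m\<ge>M. \<forall>n\<ge>M. norm (coord (X m) x - coord (X n) x) < e"
      using norm_coord_le[of "X _ - X _" x] by (metis (no_types, lifting) le_less_trans minus_ell2.rep_eq)
  qed
  then have "\<exists>l. (\<lambda>n. coord (X n) x) \<longlonglongrightarrow> l" for x
    by (simp add: Cauchy_convergent_iff convergent_def)
  then obtain f where f: "\<And>x. (\<lambda>n. coord (X n) x) \<longlonglongrightarrow> f x" by metis
  have finite_bound: "(\<Sum>x\<in>F. (cmod (f x - coord (X n) x))\<^sup>2) \<le> e\<^sup>2"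
    if "finite F" "\<And>m. m \<ge> n \<Longrightarrow> norm (X m - X n) < e" for F n e
  proof (rule tendsto_upperbound)
    show "(\<lambda>m. \<Sum>x\<in>F. (cmod (coord (X m) x - coord (X n) x))\<^sup>2) \<longlonglongrightarrow> (\<Sum>x\<in>F. (cmod (f x - coord (X n) x))\<^sup>2)"
      by (intro tendsto_intros f)
    show "\<forall>\<^sub>F m in sequentially. (\<Sum>x\<in>F. (cmod (coord (X m) x - coord (X n) x))\<^sup>2) \<le> e\<^sup>2"
      using eventually_ge_at_top[of n]
    proof eventually_elim
      case (elim m)
      have "(\<Sum>x\<in>F. (cmod (coord (X m) x - coord (X n) x))\<^sup>2) \<le> (norm (X m - X n))\<^sup>2"
        unfolding power2_norm_ell2 using coord_square_summable[of "X m - X n"] that(1)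
        by (simp add: minus_ell2.rep_eq) (intro finite_sum_le_infsum, auto)
      also have "\<dots> \<le> e\<^sup>2" using that(2)[OF elim] by (intro power_mono) auto
      finally show ?case .
    qed
  qed simp
  have approx: "(\<lambda>x. (cmod (f x - coord (X n) x))\<^sup>2) summable_on UNIV"
      "(\<Sum>\<^sub>\<infinity>x. (cmod (f x - coord (X n) x))\<^sup>2) \<le> e\<^sup>2"
    if "\<And>m. m \<ge> n \<Longrightarrow> norm (X m - X n) < e" for n e
  proof -
    show s: "(\<lambda>x. (cmod (f x - coord (X n) x))\<^sup>2) summable_on UNIV"
      by (rule nonneg_bdd_above_summable_on) (auto intro!: bdd_aboveI2[of _ _ "e\<^sup>2"] finite_bound that)
    show "(\<Sum>\<^sub>\<infinity>x. (cmod (f x - coord (X n) x))\<^sup>2) \<le> e\<^sup>2"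
      by (rule infsum_le_finite_sums[OF s]) (auto intro!: finite_bound that)
  qed
  obtain N where N: "\<And>m. m \<ge> N \<Longrightarrow> norm (X m - X N) < 1"
    using CauchyD[OF X, of 1] by auto
  have "(\<lambda>x. (cmod ((f x - coord (X N) x) + coord (X N) x))\<^sup>2) summable_on UNIV"
    by (intro square_summable_add approx(1)[OF N] coord_square_summable)
  then have F: "coord (Abs_ell2 f) = f" by (simp add: Abs_ell2_inverse)
  have "X \<longlonglongrightarrow> Abs_ell2 f"
  proof (rule LIMSEQ_I)
    fix r :: real assume "0 < r"
    then obtain M where M: "\<And>m n. m \<ge> M \<Longrightarrow> n \<ge> M \<Longrightarrow> norm (X m - X n) < r/2"
      using CauchyD[OF X, of "r/2"] by auto
    show "\<exists>no. \<forall>n\<ge>no. norm (X n - Abs_ell2 f) < r"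
    proof (intro exI allI impI)
      fix n assume "n \<ge> M"
      then have "(norm (Abs_ell2 f - X n))\<^sup>2 \<le> (r/2)\<^sup>2"
        unfolding power2_norm_ell2 minus_ell2.rep_eq F by (intro approx(2) M) auto
      then have "norm (Abs_ell2 f - X n) \<le> r/2"
        by (rule power2_le_imp_le) (use \<open>0 < r\<close> in simp)
      then show "norm (X n - Abs_ell2 f) < r" using \<open>0 < r\<close> by (simp add: norm_minus_commute)
    qed
  qed
  then show "convergent X" by (auto simp: convergent_def)
qed

section \<open>Continuous functional calculus\<close>

definition upow :: "('a ell2 \<Rightarrow> 'a ell2) \<Rightarrow> int \<Rightarrow> 'a ell2 \<Rightarrow> 'a ell2"
  where "upow U n = (if 0 \<le> n then U ^^ nat n else (inv U) ^^ nat (- n))"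

text \<open>Laurent polynomials are unnormalised lists of coefficients and exponents: addition is
  concatenation, proofs go by list induction, and coefficients from a countable set give countably
  many lists.\<close>

definition laurent_eval :: "(complex \<times> int) list \<Rightarrow> complex \<Rightarrow> complex"
  where "laurent_eval xs z = (\<Sum>(c, n)\<leftarrow>xs. c * z powi n)"

definition laurent_op :: "('a ell2 \<Rightarrow> 'a ell2) \<Rightarrow> (complex \<times> int) list \<Rightarrow> 'a ell2 \<Rightarrow> 'a ell2"
  where "laurent_op U xs \<psi> = (\<Sum>(c, n)\<leftarrow>xs. scaleC c (upow U n \<psi>))"

definition laurent_mult :: "(complex \<times> int) list \<Rightarrow> (complex \<times> int) list \<Rightarrow> (complex \<times> int) list"
  where "laurent_mult xs ys = concat (map (\<lambda>(c, n). map (\<lambda>(d, m). (c * d, n + m)) ys) xs)"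

definition laurent_cnj :: "(complex \<times> int) list \<Rightarrow> (complex \<times> int) list"
  where "laurent_cnj xs = map (\<lambda>(c, n). (cnj c, - n)) xs"

lemma laurent_eval_simps [simp]:
  "laurent_eval [] z = 0" "laurent_eval ((c, n) # xs) z = c * z powi n + laurent_eval xs z"
  by (simp_all add: laurent_eval_def)

lemma laurent_op_simps [simp]:
  "laurent_op U [] \<psi> = 0" "laurent_op U ((c, n) # xs) \<psi> = scaleC c (upow U n \<psi>) + laurent_op U xs \<psi>"
  by (simp_all add: laurent_op_def)

lemma laurent_mult_simps [simp]:
  "laurent_mult [] ys = []"
  "laurent_mult ((c, n) # xs) ys = map (\<lambda>(d, m). (c * d, n + m)) ys @ laurent_mult xs ys"
  by (simp_all add: laurent_mult_def)

lemma laurent_cnj_simps [simp]: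
  "laurent_cnj [] = []" "laurent_cnj ((c, n) # xs) = (cnj c, - n) # laurent_cnj xs"
  by (simp_all add: laurent_cnj_def)

lemma laurent_eval_append [simp]: "laurent_eval (xs @ ys) z = laurent_eval xs z + laurent_eval ys z"
  by (simp add: laurent_eval_def)

lemma laurent_op_append [simp]: "laurent_op U (xs @ ys) \<psi> = laurent_op U xs \<psi> + laurent_op U ys \<psi>"
  by (simp add: laurent_op_def)

lemma laurent_eval_mult:
  assumes "z \<noteq> 0"
  shows "laurent_eval (laurent_mult xs ys) z = laurent_eval xs z * laurent_eval ys z"
proof -
  have "laurent_eval (map (\<lambda>(d, m). (c * d, n + m)) ys) z = c * z powi n * laurent_eval ys z" for c n
    using assms by (induction ys) (auto simp: power_int_add algebra_simps)
  then show ?thesis by (induction xs) (auto simp: algebra_simps)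
qed

lemma cnj_eq_inverse: "cmod z = 1 \<Longrightarrow> cnj z = inverse z"
  by (simp add: inverse_complex_def complex_div_cnj complex_eq_iff cmod_def)

lemma laurent_eval_cnj:
  assumes "cmod z = 1"
  shows "laurent_eval (laurent_cnj xs) z = cnj (laurent_eval xs z)"
proof -
  have "cnj z = inverse z" using assms by (rule cnj_eq_inverse)
  then have "z powi (- n) = cnj (z powi n)" for n
    by (simp add: power_int_minus power_int_def power_inverse)
  then show ?thesis by (induction xs) auto
qed

lemma laurent_eval_measurable [measurable]: "laurent_eval xs \<in> borel_measurable borel"
proof -
  have "(\<lambda>z. laurent_eval xs z) \<in> borel_measurable borel"
    unfolding laurent_eval_def by (induction xs) (auto simp: case_prod_beta)
  then show ?thesis by simp
qed

lemma continuous_on_laurent_eval: "continuous_on (sphere 0 1) (laurent_eval xs)"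
proof -
  have "continuous_on (sphere 0 1) (\<lambda>z. laurent_eval xs z)"
    by (induction xs) (auto intro!: continuous_intros)
  then show ?thesis by simp
qed

section \<open>Laurent polynomials of a unitary operator\<close>

context
  fixes U :: "'a ell2 \<Rightarrow> 'a ell2"
  assumes U: "unitary U"
begin

lemma unitary_cinner: "cinner (U \<phi>) (U \<psi>) = cinner \<phi> \<psi>"
  using U by (simp add: unitary_def)

lemma unitary_add: "U (\<phi> + \<psi>) = U \<phi> + U \<psi>"
  using U by (simp add: unitary_def bounded_clinear_def bounded_linear.linear linear_add)

lemma unitary_scaleC: "U (scaleC c \<psi>) = scaleC c (U \<psi>)"
  using U by (simp add: unitary_def bounded_clinear_def)

lemma unitary_norm: "norm (U \<psi>) = norm \<psi>"
  by (simp add: norm_ell2_def inner_ell2_def unitary_cinner)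

lemma bij_unitary: "bij U"
proof (rule bijI)
  show "inj U"
  proof (rule injI)
    fix x y assume "U x = U y"
    then have "U (x - y) = 0"
      by (metis add_diff_cancel_right' diff_add_cancel diff_self unitary_add)
    then show "x = y" using unitary_norm[of "x - y"] by simp
  qed
  show "surj U" using U by (simp add: unitary_def)
qed

lemma U_inv [simp]: "U (inv U \<psi>) = \<psi>" and inv_U [simp]: "inv U (U \<psi>) = \<psi>"
  using bij_unitary by (simp_all add: bij_is_surj bij_is_inj surj_f_inv_f)

lemma inv_unitary_cinner: "cinner (inv U \<phi>) (inv U \<psi>) = cinner \<phi> \<psi>"
  by (metis U_inv unitary_cinner)

lemma inv_unitary_add: "inv U (\<phi> + \<psi>) = inv U \<phi> + inv U \<psi>"
  by (metis U_inv inv_U unitary_add)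

lemma inv_unitary_scaleC: "inv U (scaleC c \<psi>) = scaleC c (inv U \<psi>)"
  by (metis U_inv inv_U unitary_scaleC)

lemma upow_cinner: "cinner (upow U n \<phi>) (upow U n \<psi>) = cinner \<phi> \<psi>"
proof -
  have "cinner ((U ^^ k) \<phi>) ((U ^^ k) \<psi>) = cinner \<phi> \<psi>" for k
    by (induction k) (simp_all add: unitary_cinner)
  moreover have "cinner ((inv U ^^ k) \<phi>) ((inv U ^^ k) \<psi>) = cinner \<phi> \<psi>" for k
    by (induction k) (simp_all add: inv_unitary_cinner)
  ultimately show ?thesis by (simp add: upow_def)
qed

lemma upow_linear: "upow U n (\<phi> + \<psi>) = upow U n \<phi> + upow U n \<psi>"
    "upow U n (scaleC c \<psi>) = scaleC c (upow U n \<psi>)"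
proof -
  have "(U ^^ k) (\<phi> + \<psi>) = (U ^^ k) \<phi> + (U ^^ k) \<psi>" "(U ^^ k) (scaleC c \<psi>) = scaleC c ((U ^^ k) \<psi>)"
    "(inv U ^^ k) (\<phi> + \<psi>) = (inv U ^^ k) \<phi> + (inv U ^^ k) \<psi>" "(inv U ^^ k) (scaleC c \<psi>) = scaleC c ((inv U ^^ k) \<psi>)" for k
    by (induction k) (simp_all add: unitary_add inv_unitary_add unitary_scaleC inv_unitary_scaleC)
  then show "upow U n (\<phi> + \<psi>) = upow U n \<phi> + upow U n \<psi>"
    "upow U n (scaleC c \<psi>) = scaleC c (upow U n \<psi>)" by (simp_all add: upow_def)
qed

lemma upow_succ: "upow U (n + 1) \<psi> = U (upow U n \<psi>)"
proof (cases "0 \<le> n")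
  case True
  then show ?thesis by (simp add: upow_def nat_add_distrib)
next
  case False
  then have "nat (- n) = Suc (nat (- (n + 1)))" by simp
  then show ?thesis using False by (cases "n = -1") (simp_all add: upow_def)
qed

lemma upow_add: "upow U (n + m) \<psi> = upow U n (upow U m \<psi>)"
proof (induction n rule: int_induct[where k = 0])
  case base
  show ?case by (simp add: upow_def)
next
  case (step1 i)
  then show ?case using upow_succ[of "i + m" \<psi>] upow_succ[of i "upow U m \<psi>"]
    by (simp add: add_ac)
next
  case (step2 i)
  then show ?case
    using upow_succ[of "i - 1 + m" \<psi>] upow_succ[of "i - 1" "upow U m \<psi>"]
    by (metis (no_types, lifting) add.assoc add.commute diff_add_cancel inv_U)
qed

lemma upow_0 [simp]: "upow U 0 \<psi> = \<psi>" and upow_1: "upow U 1 \<psi> = U \<psi>"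
  by (simp_all add: upow_def)

lemma upow_adj: "cinner (upow U n \<phi>) \<psi> = cinner \<phi> (upow U (- n) \<psi>)"
  using upow_cinner[of "- n" "upow U n \<phi>" \<psi>] by (simp flip: upow_add)

lemma upow_zero [simp]: "upow U n 0 = 0"
  using upow_linear(2)[of n 0 0] norm_scaleC[of 0] by (metis mult_zero_left norm_eq_zero norm_zero)

lemma laurent_op_linear: "laurent_op U xs (\<phi> + \<psi>) = laurent_op U xs \<phi> + laurent_op U xs \<psi>"
    "laurent_op U xs (scaleC c \<psi>) = scaleC c (laurent_op U xs \<psi>)"
proof -
  have d: "scaleC a (x + y) = scaleC a x + scaleC a y" for a and x y :: "'a ell2"
    by transfer (simp add: algebra_simps)
  have z: "scaleC a 0 = 0" for a by transfer simp
  have m: "scaleC a (scaleC b x) = scaleC b (scaleC a x)" for a b and x :: "'a ell2"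
    by transfer (simp add: algebra_simps)
  show "laurent_op U xs (\<phi> + \<psi>) = laurent_op U xs \<phi> + laurent_op U xs \<psi>"
    by (induction xs) (auto simp: upow_linear d)
  show "laurent_op U xs (scaleC c \<psi>) = scaleC c (laurent_op U xs \<psi>)"
    by (induction xs) (auto simp: upow_linear d z m)
qed

lemma laurent_op_mult: "laurent_op U (laurent_mult xs ys) \<psi> = laurent_op U xs (laurent_op U ys \<psi>)"
proof -
  have d: "scaleC a (x + y) = scaleC a x + scaleC a y" for a and x y :: "'a ell2"
    by transfer (simp add: algebra_simps)
  have z: "scaleC a 0 = 0" for a by transfer simp
  have m: "scaleC (a * b) x = scaleC a (scaleC b x)" for a b and x :: "'a ell2"
    by transfer (simp add: algebra_simps)
  have "laurent_op U (map (\<lambda>(d, m). (c * d, n + m)) ys) \<psi> = scaleC c (upow U n (laurent_op U ys \<psi>))" for c n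
    by (induction ys) (auto simp: upow_linear upow_add d z m)
  then show ?thesis by (induction xs) auto
qed

lemma laurent_op_cnj: "cinner (laurent_op U xs \<phi>) \<psi> = cinner \<phi> (laurent_op U (laurent_cnj xs) \<psi>)"
  by (induction xs) (auto simp: cinner_add_left cinner_add_right cinner_scaleC_left cinner_scaleC_right upow_adj)

text \<open>Fejer summation of the spectral measure of \<open>\<psi>\<close>.\<close>

lemma integral_fejer:
  fixes g :: "int \<Rightarrow> complex"
  defines "Q \<equiv> \<lambda>N z. \<Sum>a<N. \<Sum>b<N. z powi (int a - int b) * g (int b - int a)"
  shows "(\<lambda>N. (\<integral>z. laurent_eval xs z * Q N z \<partial>circle_measure) / of_nat N) \<longlonglongrightarrow> (\<Sum>(c, n)\<leftarrow>xs. c * g n)"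
proof (induction xs)
  case (Cons x xs)
  obtain c n where x: "x = (c, n)" by force
  have Q[measurable]: "Q N \<in> borel_measurable borel" for N unfolding Q_def by measurable
  have [simp]: "integrable circle_measure (\<lambda>z. laurent_eval ys z * Q N z)" for N ys
  proof -
    have "integrable circle_measure (\<lambda>z. \<Sum>a<N. \<Sum>b<N. (laurent_eval ys z * z powi (int a - int b)) * g (int b - int a))"
    proof (intro Bochner_Integration.integrable_sum integrable_mult_left)
      fix k show "integrable circle_measure (\<lambda>z. laurent_eval ys z * z powi k)"
      proof -
        have "compact (laurent_eval ys ` sphere 0 1)"
          by (intro compact_continuous_image continuous_on_laurent_eval) simp
        then obtain B where "\<And>z. cmod z = 1 \<Longrightarrow> cmod (laurent_eval ys z) \<le> B"
          using compact_imp_bounded bounded_iff by (metis imageI mem_sphere_0)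
        then show ?thesis
          by (intro integrable_circle_measure[of _ B]) (auto simp: norm_mult norm_power_int)
      qed
    qed
    then show ?thesis by (simp add: Q_def sum_distrib_left mult_ac)
  qed
  \<comment> \<open>Orthogonality of the powers keeps only the pairs with b = a + n; this diagonal
    meets the N by N square in \<open>cnt N\<close> points, which is N up to an error of at most
    \<bar>n\<bar>.\<close>
  define cnt where "cnt N = card {a \<in> {..<N}. 0 \<le> int a + n \<and> int a + n < int N}" for N
  have I: "(\<integral>z. (c * z powi n) * Q N z \<partial>circle_measure) = c * g n * of_nat (cnt N)" for N
  proof -
    have "(\<integral>z. (c * z powi n) * Q N z \<partial>circle_measure)
      = (\<integral>z. (\<Sum>a<N. \<Sum>b<N. c * g (int b - int a) * z powi (n + int a - int b)) \<partial>circle_measure)"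
    proof (rule integral_cong_AE)
      show "AE z in circle_measure. (c * z powi n) * Q N z = (\<Sum>a<N. \<Sum>b<N. c * g (int b - int a) * z powi (n + int a - int b))"
        using AE_circle_measure
      proof eventually_elim
        case (elim z)
        then have "z \<noteq> 0" by auto
        then have "z powi (n + int a - int b) = z powi n * z powi (int a - int b)" for a b
          by (metis add_diff_eq power_int_add)
        then show ?case by (simp add: Q_def sum_distrib_left mult_ac)
      qed
    qed measurable
    also have "\<dots> = (\<Sum>a<N. \<Sum>b<N. c * g (int b - int a) * of_bool (n + int a - int b = 0))"
      by (subst Bochner_Integration.integral_sum | intro Bochner_Integration.integrable_sum integrable_mult_right integrable_circle_power_int)+
        (simp add: integral_circle_power_int)
    also have "\<dots> = (\<Sum>a<N. c * g n * of_bool (0 \<le> int a + n \<and> int a + n < int N))"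
    proof (rule sum.cong[OF refl])
      fix a
      have "(\<Sum>b<N. c * g (int b - int a) * of_bool (n + int a - int b = 0))
        = (\<Sum>b<N. if b = nat (int a + n) then c * g n * of_bool (0 \<le> int a + n) else 0)"
        by (intro sum.cong refl) auto
      also have "\<dots> = c * g n * of_bool (0 \<le> int a + n \<and> int a + n < int N)" by auto
      finally show "(\<Sum>b<N. c * g (int b - int a) * of_bool (n + int a - int b = 0)) = \<dots>" .
    qed
    also have "\<dots> = c * g n * of_nat (cnt N)"
      unfolding cnt_def sum_distrib_left[symmetric] by (simp add: of_bool_def sum.If_cases Int_def conj_commute)
    finally show ?thesis .
  qed
  have cnt: "cnt N \<le> N" "N \<le> cnt N + nat \<bar>n\<bar>" for N
  proof -
    show "cnt N \<le> N" unfolding cnt_def by (rule order_trans[OF card_mono[of "{..<N}"]]) auto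
    have "{..<N} \<subseteq> {a \<in> {..<N}. 0 \<le> int a + n \<and> int a + n < int N} \<union> (if 0 \<le> n then {N - nat n..<N} else {..<nat (- n)})"
      by auto
    then have "card {..<N} \<le> card ({a \<in> {..<N}. 0 \<le> int a + n \<and> int a + n < int N} \<union> (if 0 \<le> n then {N - nat n..<N} else {..<nat (- n)}))"
      by (intro card_mono) auto
    also have "\<dots> \<le> cnt N + card (if 0 \<le> n then {N - nat n..<N} else {..<nat (- n)})"
      unfolding cnt_def by (rule card_Un_le)
    also have "\<dots> \<le> cnt N + nat \<bar>n\<bar>" by auto
    finally show "N \<le> cnt N + nat \<bar>n\<bar>" by simp
  qed
  have "(\<lambda>N. real (cnt N) / real N) \<longlonglongrightarrow> 1"
  proof (rule tendsto_sandwich)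
    show "(\<lambda>N. 1 - real (nat \<bar>n\<bar>) / real N) \<longlonglongrightarrow> 1"
      using tendsto_diff[OF tendsto_const lim_const_over_n[of "real (nat \<bar>n\<bar>)"], of 1] by simp
    show "\<forall>\<^sub>F N in sequentially. 1 - real (nat \<bar>n\<bar>) / real N \<le> real (cnt N) / real N"
      using eventually_gt_at_top[of 0]
    proof eventually_elim
      case (elim N)
      have "real N \<le> real (cnt N) + real (nat \<bar>n\<bar>)" using cnt(2)[of N] by linarith
      then have "(real N - real (nat \<bar>n\<bar>)) / real N \<le> real (cnt N) / real N"
        by (intro divide_right_mono) auto
      then show ?case using elim by (simp add: diff_divide_distrib)
    qed
    show "\<forall>\<^sub>F N in sequentially. real (cnt N) / real N \<le> 1"
      using cnt(1) by (intro always_eventually) (auto simp: divide_le_eq_1)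
  qed simp
  from tendsto_mult[OF tendsto_const tendsto_of_real[OF this], of "c * g n"]
  have "(\<lambda>N. c * g n * of_nat (cnt N) / of_nat N) \<longlonglongrightarrow> c * g n" by simp
  from tendsto_add[OF this Cons.IH]
  have "(\<lambda>N. (\<integral>z. (c * z powi n) * Q N z \<partial>circle_measure) / of_nat N + (\<integral>z. laurent_eval xs z * Q N z \<partial>circle_measure) / of_nat N)
      \<longlonglongrightarrow> c * g n + (\<Sum>(c, n)\<leftarrow>xs. c * g n)"
    unfolding I .
  moreover have "(\<integral>z. laurent_eval (x # xs) z * Q N z \<partial>circle_measure)
     = (\<integral>z. (c * z powi n) * Q N z \<partial>circle_measure) + (\<integral>z. laurent_eval xs z * Q N z \<partial>circle_measure)" for N
    unfolding x laurent_eval_simps distrib_right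
    by (rule Bochner_Integration.integral_add) (use \<open>integrable circle_measure (\<lambda>z. laurent_eval [(c,n)] z * Q N z)\<close> in simp_all)
  ultimately show ?case by (simp add: x add_divide_distrib)
qed simp

text \<open>A substitute for the spectral measure: the kernel \<open>Q N z\<close> is the squared
  norm of a finite sum of vectors, so its integral against the polynomial has nonnegative real part,
  and after division by N it tends to the quadratic form.\<close>

lemma laurent_op_nonneg:
  assumes nonneg: "\<And>z. cmod z = 1 \<Longrightarrow> 0 \<le> Re (laurent_eval xs z)"
  shows "0 \<le> Re (cinner \<psi> (laurent_op U xs \<psi>))"
proof -
  define g where "g n = cinner \<psi> (upow U n \<psi>)" for n
  define Q where "Q = (\<lambda>N z. \<Sum>a<N. \<Sum>b<N. z powi (int a - int b) * g (int b - int a))"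
  have Q: "Q N z = of_real ((norm (\<Sum>a<N. scaleC (z powi (- int a)) (upow U (int a) \<psi>)))\<^sup>2)"
    if "cmod z = 1" for N z
  proof -
    have z: "cnj (z powi (- int a)) * z powi (- int b) = z powi (int a - int b)" for a b
    proof -
      have "cnj z = inverse z" using that by (rule cnj_eq_inverse)
      then have "cnj (z powi (- int a)) = z powi int a"
        by (simp add: power_int_minus power_inverse)
      moreover have "z \<noteq> 0" using that by auto
      ultimately show ?thesis using power_int_add[of z "int a" "- int b"] by simp
    qed
    have g: "g (int b - int a) = cinner (upow U (int a) \<psi>) (upow U (int b) \<psi>)" for a b
      unfolding g_def upow_adj by (simp flip: upow_add)
    show ?thesis
      unfolding cinner_self_norm[symmetric] cinner_sum_left cinner_sum_right
        cinner_scaleC_left cinner_scaleC_right Q_def g z[symmetric]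
      by (simp add: sum_distrib_left mult_ac) (rule sum.swap)
  qed
  have "0 \<le> Re (\<Sum>(c, n)\<leftarrow>xs. c * g n)"
  proof (rule tendsto_lowerbound)
    show "(\<lambda>N. Re ((\<integral>z. laurent_eval xs z * Q N z \<partial>circle_measure) / of_nat N)) \<longlonglongrightarrow> Re (\<Sum>(c, n)\<leftarrow>xs. c * g n)"
      unfolding Q_def by (intro tendsto_Re integral_fejer)
    have "0 \<le> Re (\<integral>z. laurent_eval xs z * Q N z \<partial>circle_measure)" for N
    proof (cases "integrable circle_measure (\<lambda>z. laurent_eval xs z * Q N z)")
      case True
      have "Re (\<integral>z. laurent_eval xs z * Q N z \<partial>circle_measure) = (\<integral>z. Re (laurent_eval xs z * Q N z) \<partial>circle_measure)"
        by (rule integral_Re[OF True, symmetric])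
      also have "\<dots> \<ge> 0"
        by (rule integral_nonneg_AE) (use AE_circle_measure in \<open>eventually_elim, auto simp: Q nonneg\<close>)
      finally show ?thesis .
    qed (simp add: not_integrable_integral_eq)
    then show "\<forall>\<^sub>F N in sequentially. 0 \<le> Re ((\<integral>z. laurent_eval xs z * Q N z \<partial>circle_measure) / of_nat N)"
      by (intro always_eventually) simp
  qed simp
  also have "(\<Sum>(c, n)\<leftarrow>xs. c * g n) = cinner \<psi> (laurent_op U xs \<psi>)"
    by (induction xs) (auto simp: g_def cinner_add_right cinner_scaleC_right)
  finally show ?thesis .
qed

text \<open>Positivity is applied to the Laurent polynomial e^2 - |f|^2, whose quadratic form at
  \<psi> is the difference of the squares of the two sides.\<close>

lemma norm_laurent_op_le:
  assumes e: "\<And>z. cmod z = 1 \<Longrightarrow> cmod (laurent_eval xs z) \<le> e"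
  shows "norm (laurent_op U xs \<psi>) \<le> e * norm \<psi>"
proof -
  have e0: "0 \<le> e" using e[of 1] by (metis norm_ge_zero norm_one order_trans)
  define ys where "ys = (of_real (e\<^sup>2), 0) # laurent_mult [(-1, 0)] (laurent_mult (laurent_cnj xs) xs)"
  have "0 \<le> Re (cinner \<psi> (laurent_op U ys \<psi>))"
  proof (rule laurent_op_nonneg)
    fix z :: complex assume z: "cmod z = 1"
    then have z0: "z \<noteq> 0" by auto
    have "laurent_eval ys z = of_real (e\<^sup>2) - cnj (laurent_eval xs z) * laurent_eval xs z"
      by (simp add: ys_def laurent_eval_mult[OF z0] laurent_eval_cnj[OF z] del: laurent_mult_simps)
    also have "\<dots> = of_real (e\<^sup>2 - (cmod (laurent_eval xs z))\<^sup>2)"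
      unfolding of_real_diff complex_norm_square by (simp add: mult.commute)
    finally show "0 \<le> Re (laurent_eval ys z)" using e[OF z] by (simp add: power_mono)
  qed
  also have "cinner \<psi> (laurent_op U ys \<psi>) = of_real (e\<^sup>2) * cinner \<psi> \<psi> - cinner (laurent_op U xs \<psi>) (laurent_op U xs \<psi>)"
    unfolding ys_def laurent_op_simps laurent_op_mult laurent_op_cnj[symmetric]
    by (simp add: cinner_add_right cinner_scaleC_right laurent_op_cnj laurent_op_mult)
  also have "\<dots> = of_real ((e * norm \<psi>)\<^sup>2 - (norm (laurent_op U xs \<psi>))\<^sup>2)"
    by (simp add: cinner_self_norm power_mult_distrib)
  finally have "(norm (laurent_op U xs \<psi>))\<^sup>2 \<le> (e * norm \<psi>)\<^sup>2" by simp
  then show ?thesis by (rule power2_le_imp_le) (simp add: e0)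
qed

end

section \<open>Density of Laurent polynomials in the continuous functions\<close>

lemma laurent_eval_real_polynomial:
  assumes "real_polynomial_function h"
  shows "\<exists>xs. \<forall>z. cmod z = 1 \<longrightarrow> complex_of_real (h z) = laurent_eval xs z"
  using assms
proof (induction h)
  case (linear h)
  then interpret bounded_linear h .
  \<comment> \<open>On the circle the real and imaginary parts of z are (z + 1/z) / 2 and (z - 1/z)
    / (2i); the coefficients come from \<open>h z = Re z * h 1 + Im z * h \<i>\<close>.\<close>
  let ?xs = "[(of_real (h 1) / 2 - \<i> * of_real (h \<i>) / 2, 1), (of_real (h 1) / 2 + \<i> * of_real (h \<i>) / 2, -1)]"
  have "complex_of_real (h z) = laurent_eval ?xs z" if "cmod z = 1" for z
  proof -
    have "z = Re z *\<^sub>R 1 + Im z *\<^sub>R \<i>" by (simp add: complex_eq_iff)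
    then have "h z = Re z * h 1 + Im z * h \<i>" by (metis add scaleR real_scaleR_def)
    moreover have z: "z powi (-1) = cnj z"
      using that by (simp add: power_int_minus cnj_eq_inverse)
    moreover have "z powi 1 = z" by simp
    ultimately show ?thesis
      unfolding laurent_eval_simps z by (simp add: complex_eq_iff field_simps)
  qed
  then show ?case by blast
next
  case (const c)
  have "complex_of_real c = laurent_eval [(of_real c, 0)] z" for z by simp
  then show ?case by blast
next
  case (add f g)
  then obtain xs ys where "\<forall>z. cmod z = 1 \<longrightarrow> complex_of_real (f z) = laurent_eval xs z"
    "\<forall>z. cmod z = 1 \<longrightarrow> complex_of_real (g z) = laurent_eval ys z" by blast
  then show ?case by (intro exI[of _ "xs @ ys"]) simp
next
  case (mult f g)
  then obtain xs ys where *: "\<forall>z. cmod z = 1 \<longrightarrow> complex_of_real (f z) = laurent_eval xs z"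
    "\<forall>z. cmod z = 1 \<longrightarrow> complex_of_real (g z) = laurent_eval ys z" by blast
  have "complex_of_real (f z * g z) = laurent_eval (laurent_mult xs ys) z" if "cmod z = 1" for z
    using * that by (subst laurent_eval_mult) auto
  then show ?case by blast
qed

lemma laurent_dense:
  assumes "continuous_on (sphere 0 1) f" "0 < e"
  obtains xs where "\<And>z. cmod z = 1 \<Longrightarrow> cmod (f z - laurent_eval xs z) < e"
proof -
  obtain g where g: "polynomial_function g" "\<And>z. z \<in> sphere 0 1 \<Longrightarrow> norm (f z - g z) < e"
    using Stone_Weierstrass_polynomial_function[OF _ assms] by auto
  have "real_polynomial_function (Re \<circ> g)" "real_polynomial_function (Im \<circ> g)"
    using g(1) bounded_linear_Re bounded_linear_Im unfolding polynomial_function_def by blast+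
  then obtain xs ys where xs: "\<forall>z. cmod z = 1 \<longrightarrow> complex_of_real ((Re \<circ> g) z) = laurent_eval xs z"
    and ys: "\<forall>z. cmod z = 1 \<longrightarrow> complex_of_real ((Im \<circ> g) z) = laurent_eval ys z"
    by (metis laurent_eval_real_polynomial)
  have "cmod (f z - laurent_eval (xs @ laurent_mult [(\<i>, 0)] ys) z) < e" if z: "cmod z = 1" for z
  proof -
    have "z \<noteq> 0" using z by auto
    then have "laurent_eval (xs @ laurent_mult [(\<i>, 0)] ys) z = of_real (Re (g z)) + \<i> * of_real (Im (g z))"
      using xs ys z by (simp add: laurent_eval_mult del: laurent_mult_simps)
    also have "\<dots> = g z" by (simp add: complex_eq_iff)
    finally show ?thesis using g(2)[of z] z by simp
  qed
  then show ?thesis using that by blast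
qed

text \<open>Rounding the coefficients must not push the sup norm above 1. Therefore \<open>f\<close>
  is first shrunk by the factor 1 - d/2; polynomial approximation and rounding then cost d/4 each,
  which uses up exactly this margin.\<close>

lemma countable_laurent_dense:
  obtains X where "countable X" "\<And>xs z. xs \<in> X \<Longrightarrow> cmod z = 1 \<Longrightarrow> cmod (laurent_eval xs z) \<le> 1"
    "\<And>f e. continuous_on (sphere 0 1) f \<Longrightarrow> (\<And>z. cmod z = 1 \<Longrightarrow> cmod (f z) \<le> 1) \<Longrightarrow> 0 < e \<Longrightarrow>
      \<exists>xs\<in>X. \<forall>z. cmod z = 1 \<longrightarrow> cmod (f z - laurent_eval xs z) < e"
proof -
  obtain D :: "complex set" where D: "countable D" "\<And>Y. open Y \<Longrightarrow> Y \<noteq> {} \<Longrightarrow> \<exists>d\<in>D. d \<in> Y"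
    using countable_dense_exists[where 'a = complex] by metis
  define L where "L = lists (D \<times> (UNIV :: int set))"
  define X where "X = {xs \<in> L. \<forall>z. cmod z = 1 \<longrightarrow> cmod (laurent_eval xs z) \<le> 1}"
  have round: "\<exists>ys\<in>L. \<forall>z. cmod z = 1 \<longrightarrow> cmod (laurent_eval xs z - laurent_eval ys z) < e" if "0 < e" for xs e
    using that
  proof (induction xs arbitrary: e)
    case Nil
    then show ?case by (intro bexI[of _ "[]"]) (auto simp: L_def)
  next
    case (Cons x xs)
    obtain c n where x: "x = (c, n)" by force
    from Cons obtain ys where ys: "ys \<in> L" "\<And>z. cmod z = 1 \<Longrightarrow> cmod (laurent_eval xs z - laurent_eval ys z) < e/2"
      using half_gt_zero by blast
    obtain d where d: "d \<in> D" "d \<in> ball c (e/2)" using D(2)[of "ball c (e/2)"] Cons.prems by auto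
    show ?case
    proof (intro bexI[of _ "(d, n) # ys"] allI impI)
      show "(d, n) # ys \<in> L" using d ys by (simp add: L_def)
      fix z :: complex assume z: "cmod z = 1"
      have "cmod (laurent_eval (x # xs) z - laurent_eval ((d, n) # ys) z)
        = cmod ((c - d) * z powi n + (laurent_eval xs z - laurent_eval ys z))"
        by (simp add: x algebra_simps)
      also have "\<dots> \<le> cmod (c - d) + cmod (laurent_eval xs z - laurent_eval ys z)"
        by (rule order_trans[OF norm_triangle_ineq]) (simp add: norm_mult norm_power_int z)
      also have "\<dots> < e" using ys(2)[OF z] d(2) by (simp add: dist_norm)
      finally show "cmod (laurent_eval (x # xs) z - laurent_eval ((d, n) # ys) z) < e" .
    qed
  qed
  show ?thesis
  proof
    show "countable X"
      unfolding X_def L_def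
      by (rule countable_subset[of _ "lists (D \<times> (UNIV :: int set))"]) (auto intro!: countable_lists D(1))
    show "cmod (laurent_eval xs z) \<le> 1" if "xs \<in> X" "cmod z = 1" for xs z
      using that by (simp add: X_def)
    fix f :: "complex \<Rightarrow> complex" and e :: real
    assume f: "continuous_on (sphere 0 1) f" "\<And>z. cmod z = 1 \<Longrightarrow> cmod (f z) \<le> 1" and "0 < e"
    define d where "d = min e 1"
    have d: "0 < d" "d \<le> 1" "d \<le> e" using \<open>0 < e\<close> by (auto simp: d_def)
    have "continuous_on (sphere 0 1) (\<lambda>z. of_real (1 - d/2) * f z)" by (intro continuous_intros f)
    then obtain xs where xs: "\<And>z. cmod z = 1 \<Longrightarrow> cmod (of_real (1 - d/2) * f z - laurent_eval xs z) < d/4"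
      using d by (elim laurent_dense[of _ "d/4"]) auto
    obtain ys where ys: "ys \<in> L" "\<And>z. cmod z = 1 \<Longrightarrow> cmod (laurent_eval xs z - laurent_eval ys z) < d/4"
      using round[of "d/4" xs] d by auto
    have close: "cmod (of_real (1 - d/2) * f z - laurent_eval ys z) < d/2" if "cmod z = 1" for z
      using norm_triangle_lt[OF add_strict_mono[OF xs ys(2), OF that that]] by simp
    have "cmod (laurent_eval ys z) \<le> 1" if z: "cmod z = 1" for z
    proof -
      have "cmod (laurent_eval ys z) \<le> cmod (of_real (1 - d/2) * f z) + cmod (of_real (1 - d/2) * f z - laurent_eval ys z)"
        by (metis norm_minus_commute norm_triangle_sub)
      also have "cmod (of_real (1 - d/2) * f z) \<le> 1 - d/2"
        unfolding norm_mult norm_of_real using mult_left_mono[OF f(2)[OF z], of "1 - d/2"] d by simp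
      finally show ?thesis using close[OF z] by simp
    qed
    then have "ys \<in> X" using ys by (simp add: X_def)
    moreover have "cmod (f z - laurent_eval ys z) < e" if z: "cmod z = 1" for z
    proof -
      have "f z - laurent_eval ys z = of_real (d/2) * f z + (of_real (1 - d/2) * f z - laurent_eval ys z)"
        by (simp add: algebra_simps)
      also have "cmod \<dots> \<le> cmod (of_real (d/2) * f z) + cmod (of_real (1 - d/2) * f z - laurent_eval ys z)"
        by (rule norm_triangle_ineq)
      also have "cmod (of_real (d/2) * f z) \<le> d/2"
        unfolding norm_mult norm_of_real using mult_left_mono[OF f(2)[OF z], of "d/2"] d by simp
      finally show ?thesis using close[OF z] d by simp
    qed
    ultimately show "\<exists>xs\<in>X. \<forall>z. cmod z = 1 \<longrightarrow> cmod (f z - laurent_eval xs z) < e" by blast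
  qed
qed

lemma tendsto_cinner_left:
  assumes "X \<longlonglongrightarrow> \<phi>"
  shows "(\<lambda>n. cinner (X n) \<psi>) \<longlonglongrightarrow> cinner \<phi> \<psi>"
proof (rule LIM_zero_cancel, rule Lim_null_comparison)
  show "\<forall>\<^sub>F n in sequentially. norm (cinner (X n) \<psi> - cinner \<phi> \<psi>) \<le> norm (X n - \<phi>) * norm \<psi>"
  proof (intro always_eventually allI)
    fix n
    show "norm (cinner (X n) \<psi> - cinner \<phi> \<psi>) \<le> norm (X n - \<phi>) * norm \<psi>"
      using norm_cinner_le[of "X n - \<phi>" \<psi>] cinner_add_left[of "X n - \<phi>" \<phi> \<psi>] by simp
  qed
  show "(\<lambda>n. norm (X n - \<phi>) * norm \<psi>) \<longlonglongrightarrow> 0"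
    using tendsto_mult_left_zero[OF tendsto_norm_zero[OF LIM_zero[OF assms]]] by simp
qed

lemma tendsto_cinner_right:
  assumes "X \<longlonglongrightarrow> \<phi>"
  shows "(\<lambda>n. cinner \<psi> (X n)) \<longlonglongrightarrow> cinner \<psi> \<phi>"
  using tendsto_cnj[OF tendsto_cinner_left[OF assms, of \<psi>]] by (simp flip: cinner_commute)

lemma circle_continuousD: "f \<in> circle_continuous \<Longrightarrow> continuous_on (sphere 0 1) f"
  by (simp add: circle_continuous_def)

lemma circle_continuous_bound:
  assumes "f \<in> circle_continuous"
  obtains M where "0 \<le> M" "\<And>z. cmod z = 1 \<Longrightarrow> cmod (f z) \<le> M"
proof -
  have "compact (f ` sphere 0 1)"
    using assms by (intro compact_continuous_image circle_continuousD) auto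
  then obtain B where "\<And>z. cmod z = 1 \<Longrightarrow> cmod (f z) \<le> B"
    using compact_imp_bounded bounded_iff by (metis imageI mem_sphere_0)
  then show ?thesis by (intro that[of "max 0 B"]) (auto intro: le_max_iff_disj[THEN iffD2])
qed

lemma circle_continuous_intros:
  "f \<in> circle_continuous \<Longrightarrow> g \<in> circle_continuous \<Longrightarrow> (\<lambda>z. f z + g z) \<in> circle_continuous"
  "f \<in> circle_continuous \<Longrightarrow> g \<in> circle_continuous \<Longrightarrow> (\<lambda>z. f z - g z) \<in> circle_continuous"
  "f \<in> circle_continuous \<Longrightarrow> g \<in> circle_continuous \<Longrightarrow> (\<lambda>z. f z * g z) \<in> circle_continuous"
  "f \<in> circle_continuous \<Longrightarrow> (\<lambda>z. cnj (f z)) \<in> circle_continuous"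
  "(\<lambda>z. c) \<in> circle_continuous" "(\<lambda>z. z) \<in> circle_continuous" "(\<lambda>z. z powi n) \<in> circle_continuous"
  "laurent_eval xs \<in> circle_continuous"
  using continuous_on_laurent_eval by (auto simp: circle_continuous_def intro!: continuous_intros)

text \<open>One sequence of approximants with an explicit rate is fixed for each function;
  \<open>circle_map_tendsto\<close> shows that any other uniformly convergent choice leads to the
  same limit.\<close>

definition laurent_approx :: "(complex \<Rightarrow> complex) \<Rightarrow> nat \<Rightarrow> (complex \<times> int) list"
  where "laurent_approx f n = (SOME xs. \<forall>z. cmod z = 1 \<longrightarrow> cmod (f z - laurent_eval xs z) < inverse (real (Suc n)))"

lemma laurent_approx:
  assumes "f \<in> circle_continuous" "cmod z = 1"
  shows "cmod (f z - laurent_eval (laurent_approx f n) z) \<le> inverse (real (Suc n))"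
proof -
  have "\<exists>xs. \<forall>z. cmod z = 1 \<longrightarrow> cmod (f z - laurent_eval xs z) < inverse (real (Suc n))"
    by (rule laurent_dense[OF circle_continuousD[OF assms(1)], of "inverse (real (Suc n))"]) auto
  from someI_ex[OF this] assms(2) show ?thesis unfolding laurent_approx_def by (simp add: less_imp_le)
qed

definition circle_map :: "('a ell2 \<Rightarrow> 'a ell2) \<Rightarrow> (complex \<Rightarrow> complex) \<Rightarrow> 'a ell2 \<Rightarrow> 'a ell2"
  where "circle_map U f \<psi> = lim (\<lambda>n. laurent_op U (laurent_approx f n) \<psi>)"

section \<open>Existence of the functional calculus\<close>

context
  fixes U :: "'a ell2 \<Rightarrow> 'a ell2"
  assumes U: "unitary U"
begin

lemma laurent_op_diff_le:
  assumes "\<And>z. cmod z = 1 \<Longrightarrow> cmod (laurent_eval xs z - laurent_eval ys z) \<le> e"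
  shows "norm (laurent_op U xs \<psi> - laurent_op U ys \<psi>) \<le> e * norm \<psi>"
proof -
  have "norm (laurent_op U (xs @ laurent_mult [(-1, 0)] ys) \<psi>) \<le> e * norm \<psi>"
  proof (rule norm_laurent_op_le[OF U])
    fix z :: complex assume z: "cmod z = 1"
    then have "z \<noteq> 0" by auto
    then show "cmod (laurent_eval (xs @ laurent_mult [(-1, 0)] ys) z) \<le> e"
      using assms[OF z] by (simp add: laurent_eval_mult del: laurent_mult_simps)
  qed
  then show ?thesis
    by (simp add: laurent_op_mult[OF U] upow_0[OF U] scaleC_minus1 del: laurent_mult_simps)
qed

lemma laurent_op_tendsto:
  assumes "f \<in> circle_continuous"
  shows "(\<lambda>n. laurent_op U (laurent_approx f n) \<psi>) \<longlonglongrightarrow> circle_map U f \<psi>"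
proof -
  let ?X = "\<lambda>n. laurent_op U (laurent_approx f n) \<psi>"
  have near: "norm (?X m - ?X n) \<le> (inverse (real (Suc m)) + inverse (real (Suc n))) * norm \<psi>" for m n
  proof (rule laurent_op_diff_le)
    fix z :: complex assume z: "cmod z = 1"
    show "cmod (laurent_eval (laurent_approx f m) z - laurent_eval (laurent_approx f n) z)
        \<le> inverse (real (Suc m)) + inverse (real (Suc n))"
      using norm_triangle_ineq4[of "f z - laurent_eval (laurent_approx f n) z" "f z - laurent_eval (laurent_approx f m) z"]
        laurent_approx[OF assms z, of m] laurent_approx[OF assms z, of n] by simp
  qed
  have "Cauchy ?X"
  proof (rule CauchyI)
    fix e :: real assume "0 < e"
    define d where "d = e / (2 * (norm \<psi> + 1))"
    have d: "0 < d" using \<open>0 < e\<close> by (simp add: d_def add_nonneg_pos)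
    then obtain N where N: "inverse (real (Suc N)) < d" using reals_Archimedean by blast
    have "norm (?X m - ?X n) < e" if "m \<ge> N" "n \<ge> N" for m n
    proof -
      have "inverse (real (Suc m)) + inverse (real (Suc n)) \<le> inverse (real (Suc N)) + inverse (real (Suc N))"
        using that by (intro add_mono le_imp_inverse_le) auto
      also have "\<dots> \<le> 2 * d" using N by simp
      finally have "norm (?X m - ?X n) \<le> 2 * d * norm \<psi>"
        by (meson near mult_right_mono norm_ge_zero order_trans)
      also have "\<dots> < 2 * d * (norm \<psi> + 1)" using d by simp
      also have "\<dots> = e" using norm_ge_zero[of \<psi>] unfolding d_def by (simp add: field_simps add_nonneg_eq_0_iff)
      finally show ?thesis .
    qed
    then show "\<exists>M. \<forall>m\<ge>M. \<forall>n\<ge>M. norm (?X m - ?X n) < e" by blast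
  qed
  then show ?thesis unfolding circle_map_def
    by (simp add: Cauchy_convergent_iff convergent_LIMSEQ_iff)
qed

lemma circle_map_approx:
  assumes f: "f \<in> circle_continuous" and e: "\<And>z. cmod z = 1 \<Longrightarrow> cmod (f z - laurent_eval xs z) \<le> e"
  shows "norm (circle_map U f \<psi> - laurent_op U xs \<psi>) \<le> e * norm \<psi>"
proof (rule LIMSEQ_le)
  show "(\<lambda>n. norm (laurent_op U (laurent_approx f n) \<psi> - laurent_op U xs \<psi>)) \<longlonglongrightarrow> norm (circle_map U f \<psi> - laurent_op U xs \<psi>)"
    by (intro tendsto_intros laurent_op_tendsto f)
  show "(\<lambda>n. (inverse (real (Suc n)) + e) * norm \<psi>) \<longlonglongrightarrow> e * norm \<psi>"
    by (rule tendsto_eq_intros LIMSEQ_inverse_real_of_nat | simp)+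
  have "norm (laurent_op U (laurent_approx f n) \<psi> - laurent_op U xs \<psi>) \<le> (inverse (real (Suc n)) + e) * norm \<psi>" for n
  proof (rule laurent_op_diff_le)
    fix z :: complex assume z: "cmod z = 1"
    show "cmod (laurent_eval (laurent_approx f n) z - laurent_eval xs z) \<le> inverse (real (Suc n)) + e"
      using norm_triangle_ineq4[of "f z - laurent_eval xs z" "f z - laurent_eval (laurent_approx f n) z"]
        laurent_approx[OF f z, of n] e[OF z] by simp
  qed
  then show "\<exists>N. \<forall>n\<ge>N. norm (laurent_op U (laurent_approx f n) \<psi> - laurent_op U xs \<psi>) \<le> (inverse (real (Suc n)) + e) * norm \<psi>"
    by blast
qed

lemma circle_map_tendsto:
  assumes f: "f \<in> circle_continuous"
    and e: "\<And>n z. cmod z = 1 \<Longrightarrow> cmod (f z - laurent_eval (xs n) z) \<le> e n" "e \<longlonglongrightarrow> 0"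
  shows "(\<lambda>n. laurent_op U (xs n) \<psi>) \<longlonglongrightarrow> circle_map U f \<psi>"
proof (rule LIM_zero_cancel, rule Lim_null_comparison)
  show "\<forall>\<^sub>F n in sequentially. norm (laurent_op U (xs n) \<psi> - circle_map U f \<psi>) \<le> e n * norm \<psi>"
    using circle_map_approx[OF f e(1)] by (intro always_eventually) (simp add: norm_minus_commute)
  show "(\<lambda>n. e n * norm \<psi>) \<longlonglongrightarrow> 0" using tendsto_mult_left_zero[OF e(2)] by simp
qed

lemma circle_map_laurent: "circle_map U (laurent_eval xs) \<psi> = laurent_op U xs \<psi>"
  using circle_map_approx[of "laurent_eval xs" xs 0 \<psi>] by (simp add: circle_continuous_intros)

lemma circle_map_norm_le:
  assumes "f \<in> circle_continuous" "\<And>z. cmod z = 1 \<Longrightarrow> cmod (f z) \<le> M"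
  shows "norm (circle_map U f \<psi>) \<le> M * norm \<psi>"
  using circle_map_approx[of f "[]" M \<psi>] assms by simp

lemma circle_map_add_vec:
  assumes f: "f \<in> circle_continuous"
  shows "circle_map U f (\<phi> + \<psi>) = circle_map U f \<phi> + circle_map U f \<psi>"
  using laurent_op_tendsto[OF f, of "\<phi> + \<psi>"] tendsto_add[OF laurent_op_tendsto[OF f, of \<phi>] laurent_op_tendsto[OF f, of \<psi>]]
  unfolding laurent_op_linear[OF U] by (rule LIMSEQ_unique)

lemma tendsto_scaleC:
  assumes "X \<longlonglongrightarrow> (\<psi> :: 'a ell2)"
  shows "(\<lambda>n. scaleC c (X n)) \<longlonglongrightarrow> scaleC c \<psi>"
proof (rule LIM_zero_cancel, rule Lim_null_comparison)
  have "scaleC c (X n) - scaleC c \<psi> = scaleC c (X n - \<psi>)" for n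
    by (transfer) (simp add: algebra_simps)
  then show "\<forall>\<^sub>F n in sequentially. norm (scaleC c (X n) - scaleC c \<psi>) \<le> cmod c * norm (X n - \<psi>)"
    by (intro always_eventually) simp
  show "(\<lambda>n. cmod c * norm (X n - \<psi>)) \<longlonglongrightarrow> 0"
    using tendsto_mult_right_zero[OF tendsto_norm_zero[OF LIM_zero[OF assms]]] by simp
qed

lemma circle_map_scaleC:
  assumes f: "f \<in> circle_continuous"
  shows "circle_map U f (scaleC c \<psi>) = scaleC c (circle_map U f \<psi>)"
  using laurent_op_tendsto[OF f, of "scaleC c \<psi>"] tendsto_scaleC[OF laurent_op_tendsto[OF f, of \<psi>], of c]
  unfolding laurent_op_linear[OF U] by (rule LIMSEQ_unique)

lemma bounded_clinear_circle_map:
  assumes f: "f \<in> circle_continuous"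
  shows "bounded_clinear (circle_map U f)"
proof -
  obtain M where M: "\<And>z. cmod z = 1 \<Longrightarrow> cmod (f z) \<le> M" using circle_continuous_bound[OF f] by metis
  have "bounded_linear (circle_map U f)"
    by (rule bounded_linear_intro[of _ M])
      (use circle_map_norm_le[OF f M] in \<open>simp_all add: circle_map_add_vec[OF f] scaleR_scaleC circle_map_scaleC[OF f] mult.commute\<close>)
  then show ?thesis by (simp add: bounded_clinear_def circle_map_scaleC[OF f])
qed

lemma circle_map_cong:
  assumes f: "f \<in> circle_continuous" and g: "g \<in> circle_continuous" and eq: "\<And>z. cmod z = 1 \<Longrightarrow> f z = g z"
  shows "circle_map U f = circle_map U g"
proof
  fix \<psi>
  show "circle_map U f \<psi> = circle_map U g \<psi>"
    by (rule LIMSEQ_unique[OF laurent_op_tendsto[OF f]], rule circle_map_tendsto[OF g _ LIMSEQ_inverse_real_of_nat])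
      (use laurent_approx[OF f] eq in simp)
qed

lemma circle_map_add:
  assumes f: "f \<in> circle_continuous" and g: "g \<in> circle_continuous"
  shows "circle_map U (\<lambda>z. f z + g z) \<psi> = circle_map U f \<psi> + circle_map U g \<psi>"
proof (rule LIMSEQ_unique)
  show "(\<lambda>n. laurent_op U (laurent_approx f n) \<psi> + laurent_op U (laurent_approx g n) \<psi>) \<longlonglongrightarrow> circle_map U f \<psi> + circle_map U g \<psi>"
    by (intro tendsto_add laurent_op_tendsto f g)
  have "(\<lambda>n. laurent_op U (laurent_approx f n @ laurent_approx g n) \<psi>) \<longlonglongrightarrow> circle_map U (\<lambda>z. f z + g z) \<psi>"
  proof (rule circle_map_tendsto)
    show "(\<lambda>n. 2 * inverse (real (Suc n))) \<longlonglongrightarrow> 0"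
      using tendsto_mult_right_zero[OF LIMSEQ_inverse_real_of_nat] .
    fix n and z :: complex assume z: "cmod z = 1"
    show "cmod (f z + g z - laurent_eval (laurent_approx f n @ laurent_approx g n) z) \<le> 2 * inverse (real (Suc n))"
      using norm_triangle_ineq[of "f z - laurent_eval (laurent_approx f n) z" "g z - laurent_eval (laurent_approx g n) z"]
        laurent_approx[OF f z, of n] laurent_approx[OF g z, of n] by (simp add: algebra_simps)
  qed (intro circle_continuous_intros f g)
  then show "(\<lambda>n. laurent_op U (laurent_approx f n) \<psi> + laurent_op U (laurent_approx g n) \<psi>) \<longlonglongrightarrow> circle_map U (\<lambda>z. f z + g z) \<psi>"
    by simp
qed

lemma circle_map_mult:
  assumes f: "f \<in> circle_continuous" and g: "g \<in> circle_continuous"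
  shows "circle_map U (\<lambda>z. f z * g z) \<psi> = circle_map U f (circle_map U g \<psi>)"
proof (rule LIMSEQ_unique)
  let ?F = "\<lambda>n. laurent_approx f n" and ?G = "\<lambda>n. laurent_approx g n"
  obtain M where M: "0 \<le> M" "\<And>z. cmod z = 1 \<Longrightarrow> cmod (f z) \<le> M" using circle_continuous_bound[OF f] by metis
  obtain M' where M': "0 \<le> M'" "\<And>z. cmod z = 1 \<Longrightarrow> cmod (g z) \<le> M'" using circle_continuous_bound[OF g] by metis
  have F: "cmod (laurent_eval (?F n) z) \<le> M + 1" and G: "cmod (laurent_eval (?G n) z) \<le> M' + 1" if z: "cmod z = 1" for n z
  proof -
    have i: "inverse (real (Suc n)) \<le> 1" by (simp add: inverse_eq_divide)
    show "cmod (laurent_eval (?F n) z) \<le> M + 1"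
      using norm_triangle_ineq4[of "f z" "f z - laurent_eval (?F n) z"] laurent_approx[OF f z, of n] M(2)[OF z] i by simp
    show "cmod (laurent_eval (?G n) z) \<le> M' + 1"
      using norm_triangle_ineq4[of "g z" "g z - laurent_eval (?G n) z"] laurent_approx[OF g z, of n] M'(2)[OF z] i by simp
  qed
  have "(\<lambda>n. laurent_op U (laurent_mult (?F n) (?G n)) \<psi>) \<longlonglongrightarrow> circle_map U (\<lambda>z. f z * g z) \<psi>"
  proof (rule circle_map_tendsto)
    show "(\<lambda>n. (M + M' + 1) * inverse (real (Suc n))) \<longlonglongrightarrow> 0"
      using tendsto_mult_right_zero[OF LIMSEQ_inverse_real_of_nat] .
    fix n and z :: complex assume z: "cmod z = 1"
    then have "z \<noteq> 0" by auto
    have "cmod (f z * g z - laurent_eval (laurent_mult (?F n) (?G n)) z)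
      = cmod (f z * (g z - laurent_eval (?G n) z) + (f z - laurent_eval (?F n) z) * laurent_eval (?G n) z)"
      by (simp add: laurent_eval_mult[OF \<open>z \<noteq> 0\<close>] algebra_simps)
    also have "\<dots> \<le> M * inverse (real (Suc n)) + inverse (real (Suc n)) * (M' + 1)"
      by (rule norm_triangle_le, unfold norm_mult, intro add_mono mult_mono)
        (use laurent_approx[OF f z, of n] laurent_approx[OF g z, of n] M M' G z in auto)
    finally show "cmod (f z * g z - laurent_eval (laurent_mult (?F n) (?G n)) z) \<le> (M + M' + 1) * inverse (real (Suc n))"
      by (simp add: algebra_simps)
  qed (intro circle_continuous_intros f g)
  then show "(\<lambda>n. laurent_op U (?F n) (laurent_op U (?G n) \<psi>)) \<longlonglongrightarrow> circle_map U (\<lambda>z. f z * g z) \<psi>"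
    by (simp add: laurent_op_mult[OF U])
  \<comment> \<open>Operator and argument vary together. The operators are bounded by M + 1
    uniformly in n, so replacing the moving argument by its limit costs nothing in the
    limit.\<close>
  have "(\<lambda>n. laurent_op U (?F n) (laurent_op U (?G n) \<psi> - circle_map U g \<psi>)) \<longlonglongrightarrow> 0"
  proof (rule Lim_null_comparison)
    show "\<forall>\<^sub>F n in sequentially. norm (laurent_op U (?F n) (laurent_op U (?G n) \<psi> - circle_map U g \<psi>))
        \<le> (M + 1) * norm (laurent_op U (?G n) \<psi> - circle_map U g \<psi>)"
      by (intro always_eventually allI norm_laurent_op_le[OF U] F)
    show "(\<lambda>n. (M + 1) * norm (laurent_op U (?G n) \<psi> - circle_map U g \<psi>)) \<longlonglongrightarrow> 0"
      by (rule tendsto_mult_right_zero[OF tendsto_norm_zero[OF LIM_zero[OF laurent_op_tendsto[OF g]]]])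
  qed
  from tendsto_add[OF this laurent_op_tendsto[OF f, of "circle_map U g \<psi>"]]
  show "(\<lambda>n. laurent_op U (?F n) (laurent_op U (?G n) \<psi>)) \<longlonglongrightarrow> circle_map U f (circle_map U g \<psi>)"
    by (simp flip: laurent_op_linear[OF U])
qed

lemma circle_map_cnj:
  assumes f: "f \<in> circle_continuous"
  shows "cinner (circle_map U f \<phi>) \<psi> = cinner \<phi> (circle_map U (\<lambda>z. cnj (f z)) \<psi>)"
proof (rule LIMSEQ_unique)
  show "(\<lambda>n. cinner (laurent_op U (laurent_approx f n) \<phi>) \<psi>) \<longlonglongrightarrow> cinner (circle_map U f \<phi>) \<psi>"
    by (intro tendsto_cinner_left laurent_op_tendsto f)
  have "(\<lambda>n. laurent_op U (laurent_cnj (laurent_approx f n)) \<psi>) \<longlonglongrightarrow> circle_map U (\<lambda>z. cnj (f z)) \<psi>"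
  proof (rule circle_map_tendsto[OF _ _ LIMSEQ_inverse_real_of_nat])
    fix n and z :: complex assume z: "cmod z = 1"
    show "cmod (cnj (f z) - laurent_eval (laurent_cnj (laurent_approx f n)) z) \<le> inverse (real (Suc n))"
      using laurent_approx[OF f z, of n]
      unfolding laurent_eval_cnj[OF z] complex_cnj_diff[symmetric] complex_mod_cnj .
  qed (intro circle_continuous_intros f)
  from tendsto_cinner_right[OF this, of \<phi>]
  show "(\<lambda>n. cinner (laurent_op U (laurent_approx f n) \<phi>) \<psi>) \<longlonglongrightarrow> cinner \<phi> (circle_map U (\<lambda>z. cnj (f z)) \<psi>)"
    by (simp add: laurent_op_cnj[OF U])
qed

lemma circle_calculus_circle_map: "circle_calculus U (circle_map U)"
  unfolding circle_calculus_def
proof (intro conjI ballI allI impI)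
  have "circle_map U (\<lambda>z. 1) = circle_map U (laurent_eval [(1, 0)])"
    by (rule circle_map_cong) (auto intro: circle_continuous_intros)
  also have "\<dots> = id"
  proof
    fix \<psi> :: "'a ell2"
    have "scaleC 1 \<psi> = \<psi>" by transfer simp
    then show "circle_map U (laurent_eval [(1, 0)]) \<psi> = id \<psi>" by (simp add: circle_map_laurent upow_0[OF U])
  qed
  finally show "circle_map U (\<lambda>z. 1) = id" .
  have "circle_map U (\<lambda>z. z) = circle_map U (laurent_eval [(1, 1)])"
    by (rule circle_map_cong) (auto intro: circle_continuous_intros)
  also have "\<dots> = U"
  proof
    fix \<psi> :: "'a ell2"
    have "scaleC 1 \<phi> = \<phi>" for \<phi> :: "'a ell2" by transfer simp
    then show "circle_map U (laurent_eval [(1, 1)]) \<psi> = U \<psi>" by (simp add: circle_map_laurent upow_1[OF U])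
  qed
  finally show "circle_map U (\<lambda>z. z) = U" .
next
  fix c f assume f: "f \<in> circle_continuous"
  show "circle_map U (\<lambda>z. c * f z) = (\<lambda>\<psi>. scaleC c (circle_map U f \<psi>))"
  proof
    fix \<psi>
    have "circle_map U (\<lambda>z. c) = circle_map U (laurent_eval [(c, 0)])"
      by (rule circle_map_cong) (auto intro: circle_continuous_intros)
    then have "circle_map U (\<lambda>z. c) \<phi> = scaleC c \<phi>" for \<phi> by (simp add: circle_map_laurent upow_0[OF U])
    then show "circle_map U (\<lambda>z. c * f z) \<psi> = scaleC c (circle_map U f \<psi>)"
      using f by (subst circle_map_mult) (simp_all add: circle_continuous_intros)
  qed
next
  fix f g assume "f \<in> circle_continuous" "g \<in> circle_continuous" "\<forall>z\<in>sphere 0 1. f z = g z"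
  then show "circle_map U f = circle_map U g" by (intro circle_map_cong) auto
qed (auto intro!: bounded_clinear_circle_map circle_map_cnj simp: circle_map_add circle_map_mult fun_eq_iff)

section \<open>Uniqueness of the functional calculus\<close>

context
  fixes \<Phi> :: "(complex \<Rightarrow> complex) \<Rightarrow> 'a ell2 \<Rightarrow> 'a ell2"
  assumes \<Phi>: "circle_calculus U \<Phi>"
begin

lemma circle_calculus_cong:
  assumes "f \<in> circle_continuous" "g \<in> circle_continuous" "\<And>z. cmod z = 1 \<Longrightarrow> f z = g z"
  shows "\<Phi> f = \<Phi> g"
proof -
  have "\<forall>z\<in>sphere 0 1. f z = g z" using assms(3) by simp
  then show ?thesis using \<Phi> assms(1,2) unfolding circle_calculus_def by blast
qed

lemma circle_calculus_one: "\<Phi> (\<lambda>z. 1) \<psi> = \<psi>"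
  and circle_calculus_ident: "\<Phi> (\<lambda>z. z) \<psi> = U \<psi>"
  using \<Phi> by (simp_all add: circle_calculus_def)

lemma circle_calculus_add:
  assumes "f \<in> circle_continuous" "g \<in> circle_continuous"
  shows "\<Phi> (\<lambda>z. f z + g z) \<psi> = \<Phi> f \<psi> + \<Phi> g \<psi>"
proof -
  have "\<Phi> (\<lambda>z. f z + g z) = (\<lambda>\<psi>. \<Phi> f \<psi> + \<Phi> g \<psi>)"
    using \<Phi> assms unfolding circle_calculus_def by blast
  then show ?thesis by simp
qed

lemma circle_calculus_mult:
  assumes "f \<in> circle_continuous" "g \<in> circle_continuous"
  shows "\<Phi> (\<lambda>z. f z * g z) \<psi> = \<Phi> f (\<Phi> g \<psi>)"
proof -
  have "\<Phi> (\<lambda>z. f z * g z) = \<Phi> f \<circ> \<Phi> g"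
    using \<Phi> assms unfolding circle_calculus_def by blast
  then show ?thesis by simp
qed

lemma circle_calculus_scale:
  assumes "f \<in> circle_continuous"
  shows "\<Phi> (\<lambda>z. c * f z) \<psi> = scaleC c (\<Phi> f \<psi>)"
proof -
  have "\<Phi> (\<lambda>z. c * f z) = (\<lambda>\<psi>. scaleC c (\<Phi> f \<psi>))"
    using \<Phi> assms unfolding circle_calculus_def by blast
  then show ?thesis by simp
qed

lemma circle_calculus_cnj:
  assumes "f \<in> circle_continuous"
  shows "cinner \<phi> (\<Phi> (\<lambda>z. cnj (f z)) \<psi>) = cinner (\<Phi> f \<phi>) \<psi>"
  using \<Phi> assms unfolding circle_calculus_def by metis

text \<open>By the factorisation $M^2 - |f|^2 = h^2$ with continuous real \<open>h\<close>.\<close>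

lemma circle_calculus_norm_le:
  assumes f: "f \<in> circle_continuous"
    and M: "\<And>z. cmod z = 1 \<Longrightarrow> cmod (f z) \<le> M"
  shows "norm (\<Phi> f \<psi>) \<le> M * norm \<psi>"
proof -
  have M0: "0 \<le> M" using M[of 1] by (metis norm_ge_zero norm_one order_trans)
  define h where "h z = complex_of_real (sqrt (M\<^sup>2 - (cmod (f z))\<^sup>2))" for z
  have h: "h \<in> circle_continuous"
    using f by (auto simp: circle_continuous_def h_def intro!: continuous_intros)
  note ci = circle_continuous_intros
  have ff: "(\<lambda>z. cnj (f z) * f z) \<in> circle_continuous" and hh: "(\<lambda>z. cnj (h z) * h z) \<in> circle_continuous"
    by (intro ci f h)+
  have "\<Phi> (\<lambda>z. of_real (M\<^sup>2) * 1) = \<Phi> (\<lambda>z. cnj (h z) * h z + cnj (f z) * f z)"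
  proof (rule circle_calculus_cong)
    fix z :: complex assume z: "cmod z = 1"
    have "cnj (h z) * h z = of_real (M\<^sup>2 - (cmod (f z))\<^sup>2)"
      using M[OF z] M0 by (simp add: h_def power_mono flip: of_real_mult)
    then show "of_real (M\<^sup>2) * 1 = cnj (h z) * h z + cnj (f z) * f z"
      unfolding of_real_diff complex_norm_square by (simp add: mult.commute)
  qed (intro ci f h)+
  then have "scaleC (of_real (M\<^sup>2)) \<psi> = \<Phi> (\<lambda>z. cnj (h z) * h z + cnj (f z) * f z) \<psi>"
    using circle_calculus_scale[OF ci(5)[of 1], of "of_real (M\<^sup>2)" \<psi>] by (simp add: circle_calculus_one)
  also have "\<dots> = \<Phi> (\<lambda>z. cnj (h z)) (\<Phi> h \<psi>) + \<Phi> (\<lambda>z. cnj (f z)) (\<Phi> f \<psi>)"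
    unfolding circle_calculus_add[OF hh ff] by (simp add: circle_calculus_mult ci f h)
  finally have "cinner \<psi> (scaleC (of_real (M\<^sup>2)) \<psi>) = cinner (\<Phi> h \<psi>) (\<Phi> h \<psi>) + cinner (\<Phi> f \<psi>) (\<Phi> f \<psi>)"
    by (simp only: cinner_add_right circle_calculus_cnj[OF f] circle_calculus_cnj[OF h])
  then have "complex_of_real (M\<^sup>2 * (norm \<psi>)\<^sup>2) = of_real ((norm (\<Phi> h \<psi>))\<^sup>2 + (norm (\<Phi> f \<psi>))\<^sup>2)"
    by (simp add: cinner_scaleC_right cinner_self_norm)
  then have "M\<^sup>2 * (norm \<psi>)\<^sup>2 = (norm (\<Phi> h \<psi>))\<^sup>2 + (norm (\<Phi> f \<psi>))\<^sup>2" by (simp only: of_real_eq_iff)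
  then have "(norm (\<Phi> f \<psi>))\<^sup>2 \<le> (M * norm \<psi>)\<^sup>2" by (simp add: power_mult_distrib)
  then show ?thesis by (rule power2_le_imp_le) (simp add: M0)
qed

text \<open>Multiplicativity forces the values: z * (1/z) = 1 makes the image of 1/z a right inverse
  of the bijection \<open>U\<close>, and all powers follow.\<close>

lemma circle_calculus_laurent: "\<Phi> (laurent_eval xs) = laurent_op U xs"
proof -
  note ci = circle_continuous_intros
  have inv: "\<Phi> (\<lambda>z. z powi (-1)) \<psi> = inv U \<psi>" for \<psi>
  proof -
    have "\<Phi> (\<lambda>z. z * z powi (-1)) = \<Phi> (\<lambda>z. 1)"
    proof (rule circle_calculus_cong)
      fix z :: complex assume "cmod z = 1"
      then have "z \<noteq> 0" by auto
      then show "z * z powi (-1) = 1" by (simp add: power_int_minus)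
    qed (intro ci)+
    then have "U (\<Phi> (\<lambda>z. z powi (-1)) \<psi>) = \<psi>"
      using circle_calculus_mult[OF ci(6) ci(7)[of "-1"], of \<psi>]
      by (simp only: circle_calculus_one circle_calculus_ident)
    then show "\<Phi> (\<lambda>z. z powi (-1)) \<psi> = inv U \<psi>" by (metis inv_U[OF U])
  qed
  have pow: "\<Phi> (\<lambda>z. z powi int k) \<psi> = (U ^^ k) \<psi>" for k \<psi>
  proof (induction k)
    case (Suc k)
    have "\<Phi> (\<lambda>z. z powi int (Suc k)) = \<Phi> (\<lambda>z. z * z powi int k)"
    proof (rule circle_calculus_cong)
      show "z powi int (Suc k) = z * z powi int k" for z :: complex by (simp del: of_nat_Suc)
    qed (intro ci)+
    then show ?case
      by (simp only: circle_calculus_mult[OF ci(6) ci(7)] circle_calculus_ident Suc.IH) simp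
  qed (simp add: circle_calculus_one)
  have pow2: "\<Phi> (\<lambda>z. z powi (- int k)) \<psi> = (inv U ^^ k) \<psi>" for k \<psi>
  proof (induction k)
    case (Suc k)
    have "\<Phi> (\<lambda>z. z powi (- int (Suc k))) = \<Phi> (\<lambda>z. z powi (-1) * z powi (- int k))"
    proof (rule circle_calculus_cong)
      show "z powi (- int (Suc k)) = z powi (-1) * z powi (- int k)" for z :: complex
        by (simp add: power_int_minus del: of_nat_Suc)
    qed (intro ci)+
    then show ?case
      by (simp only: circle_calculus_mult[OF ci(7) ci(7)] inv Suc.IH) simp
  qed (simp add: circle_calculus_one)
  have pow': "\<Phi> (\<lambda>z. z powi n) \<psi> = upow U n \<psi>" for n \<psi>
    using pow[of "nat n"] pow2[of "nat (- n)"] by (cases "0 \<le> n") (simp_all add: upow_def)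
  show ?thesis
  proof
    fix \<psi>
    show "\<Phi> (laurent_eval xs) \<psi> = laurent_op U xs \<psi>"
    proof (induction xs)
      case Nil
      have "\<Phi> (laurent_eval []) \<psi> = \<Phi> (\<lambda>z. 0 * 1) \<psi>"
        by (rule fun_cong, rule circle_calculus_cong) (auto intro: ci)
      also have "\<dots> = scaleC 0 (\<Phi> (\<lambda>z. 1) \<psi>)" by (rule circle_calculus_scale) (rule ci)
      also have "\<dots> = 0" by transfer simp
      finally show ?case unfolding laurent_op_simps .
    next
      case (Cons x xs)
      obtain a n where x: "x = (a, n)" by force
      have "\<Phi> (laurent_eval (x # xs)) \<psi> = \<Phi> (\<lambda>z. a * z powi n + laurent_eval xs z) \<psi>"
        by (rule fun_cong, rule circle_calculus_cong) (auto simp: x intro!: ci)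
      also have "\<dots> = \<Phi> (\<lambda>z. a * z powi n) \<psi> + \<Phi> (laurent_eval xs) \<psi>"
        by (rule circle_calculus_add) (intro ci)+
      also have "\<Phi> (\<lambda>z. a * z powi n) \<psi> = scaleC a (\<Phi> (\<lambda>z. z powi n) \<psi>)"
        by (rule circle_calculus_scale) (rule ci)
      finally show ?case by (simp add: x pow' Cons.IH)
    qed
  qed
qed

lemma circle_calculus_approx:
  assumes f: "f \<in> circle_continuous"
    and e: "\<And>z. cmod z = 1 \<Longrightarrow> cmod (f z - laurent_eval xs z) \<le> e"
  shows "norm (\<Phi> f \<psi> - laurent_op U xs \<psi>) \<le> e * norm \<psi>"
proof -
  have d: "(\<lambda>z. f z - laurent_eval xs z) \<in> circle_continuous" by (intro circle_continuous_intros f)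
  have "\<Phi> f \<psi> = \<Phi> (\<lambda>z. (f z - laurent_eval xs z) + laurent_eval xs z) \<psi>" by simp
  also have "\<dots> = \<Phi> (\<lambda>z. f z - laurent_eval xs z) \<psi> + \<Phi> (laurent_eval xs) \<psi>"
    by (rule circle_calculus_add[OF d]) (rule circle_continuous_intros)
  finally have "\<Phi> f \<psi> - laurent_op U xs \<psi> = \<Phi> (\<lambda>z. f z - laurent_eval xs z) \<psi>"
    by (simp add: circle_calculus_laurent)
  then show ?thesis using circle_calculus_norm_le[OF d e] by simp
qed

end

text \<open>The definite description denotes because a calculus exists and because contractivity
  makes every calculus the limit of the same Laurent operators.\<close>

lemma circle_fun_eq_circle_map:
  assumes f: "f \<in> circle_continuous"
  shows "circle_fun f U = circle_map U f"
  unfolding circle_fun_def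
proof (rule the_equality)
  show "\<exists>\<Phi>. circle_calculus U \<Phi> \<and> circle_map U f = \<Phi> f" using circle_calculus_circle_map by blast
  fix A assume "\<exists>\<Phi>. circle_calculus U \<Phi> \<and> A = \<Phi> f"
  then obtain \<Phi> where \<Phi>: "circle_calculus U \<Phi>" and A: "A = \<Phi> f" by blast
  show "A = circle_map U f"
  proof
    fix \<psi>
    have "(\<lambda>n. laurent_op U (laurent_approx f n) \<psi>) \<longlonglongrightarrow> \<Phi> f \<psi>"
    proof (rule LIM_zero_cancel, rule Lim_null_comparison)
      show "\<forall>\<^sub>F n in sequentially. norm (laurent_op U (laurent_approx f n) \<psi> - \<Phi> f \<psi>) \<le> inverse (real (Suc n)) * norm \<psi>"
        using circle_calculus_approx[OF \<Phi> f laurent_approx[OF f]] by (intro always_eventually) (simp add: norm_minus_commute)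
      show "(\<lambda>n. inverse (real (Suc n)) * norm \<psi>) \<longlonglongrightarrow> 0"
        using tendsto_mult_left_zero[OF LIMSEQ_inverse_real_of_nat] .
    qed
    then show "A \<psi> = circle_map U f \<psi>" unfolding A by (rule LIMSEQ_unique[OF _ laurent_op_tendsto[OF f]])
  qed
qed

end

text \<open>\<open>X\<close> is chosen before \<open>U\<close>, so that one countable family serves
  all realisations of the walk. This gives measurability of the supremum in \<omega> and reduces its
  estimate to Laurent polynomials.\<close>

lemma sup_matrix_element_countable:
  obtains X where "countable X" "\<And>xs z. xs \<in> X \<Longrightarrow> cmod z = 1 \<Longrightarrow> cmod (laurent_eval xs z) \<le> 1"
    "\<And>(U :: 'a ell2 \<Rightarrow> 'a ell2) \<phi> \<psi>. unitary U \<Longrightarrow>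
      sup_matrix_element U \<phi> \<psi> = (SUP xs\<in>X. ennreal (cmod (cinner \<phi> (laurent_op U xs \<psi>))))"
proof -
  obtain X where X: "countable X" "\<And>xs z. xs \<in> X \<Longrightarrow> cmod z = 1 \<Longrightarrow> cmod (laurent_eval xs z) \<le> 1"
    "\<And>f e. continuous_on (sphere 0 1) f \<Longrightarrow> (\<And>z. cmod z = 1 \<Longrightarrow> cmod (f z) \<le> 1) \<Longrightarrow> 0 < e \<Longrightarrow>
      \<exists>xs\<in>X. \<forall>z. cmod z = 1 \<longrightarrow> cmod (f z - laurent_eval xs z) < e"
    by (rule countable_laurent_dense) blast
  show ?thesis
  proof (rule that[OF X(1,2)])
    fix U :: "'a ell2 \<Rightarrow> 'a ell2" and \<phi> \<psi>
    assume U: "unitary U"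
    show "sup_matrix_element U \<phi> \<psi> = (SUP xs\<in>X. ennreal (cmod (cinner \<phi> (laurent_op U xs \<psi>))))"
      unfolding sup_matrix_element_def
    proof (rule antisym; rule SUP_least)
      fix f assume "f \<in> {f \<in> circle_continuous. \<forall>z\<in>sphere 0 1. cmod (f z) \<le> 1}"
      then have f: "f \<in> circle_continuous" "\<And>z. cmod z = 1 \<Longrightarrow> cmod (f z) \<le> 1" by auto
      show "ennreal (cmod (cinner \<phi> (circle_fun f U \<psi>))) \<le> (SUP xs\<in>X. ennreal (cmod (cinner \<phi> (laurent_op U xs \<psi>))))"
      proof (rule ennreal_le_epsilon)
        fix e :: real assume "0 < e"
        define d where "d = e / (norm \<phi> * norm \<psi> + 1)"
        have d: "0 < d" "d * (norm \<phi> * norm \<psi>) \<le> e"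
        proof -
          have pos: "0 < norm \<phi> * norm \<psi> + 1" by (simp add: add_nonneg_pos)
          then show "0 < d" using \<open>0 < e\<close> by (simp add: d_def)
          show "d * (norm \<phi> * norm \<psi>) \<le> e"
            using pos \<open>0 < e\<close> by (simp add: d_def pos_divide_le_eq)
        qed
        obtain xs where xs: "xs \<in> X" "\<And>z. cmod z = 1 \<Longrightarrow> cmod (f z - laurent_eval xs z) < d"
          using X(3)[OF circle_continuousD[OF f(1)] f(2) d(1)] by blast
        have "cmod (cinner \<phi> (circle_map U f \<psi>) - cinner \<phi> (laurent_op U xs \<psi>))
            \<le> norm \<phi> * norm (circle_map U f \<psi> - laurent_op U xs \<psi>)"
          unfolding cinner_diff_right[symmetric] by (rule norm_cinner_le)
        also have "\<dots> \<le> norm \<phi> * (d * norm \<psi>)"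
          by (intro mult_left_mono circle_map_approx[OF U f(1)] less_imp_le[OF xs(2)]) auto
        also have "\<dots> \<le> e" using d by (simp add: mult_ac)
        finally have "cmod (cinner \<phi> (circle_map U f \<psi>)) \<le> cmod (cinner \<phi> (laurent_op U xs \<psi>)) + e"
          using norm_triangle_ineq2 order_trans by (smt (verit))
        then have "ennreal (cmod (cinner \<phi> (circle_fun f U \<psi>))) \<le> ennreal (cmod (cinner \<phi> (laurent_op U xs \<psi>))) + ennreal e"
          using \<open>0 < e\<close> by (simp add: circle_fun_eq_circle_map[OF U f(1)] flip: ennreal_plus)
        also have "\<dots> \<le> (SUP xs\<in>X. ennreal (cmod (cinner \<phi> (laurent_op U xs \<psi>)))) + ennreal e"
          by (intro add_right_mono SUP_upper xs)
        finally show "ennreal (cmod (cinner \<phi> (circle_fun f U \<psi>))) \<le> \<dots>" .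
      qed
    next
      fix xs assume xs: "xs \<in> X"
      have "circle_fun (laurent_eval xs) U \<psi> = laurent_op U xs \<psi>"
        by (simp add: circle_fun_eq_circle_map[OF U] circle_continuous_intros circle_map_laurent[OF U])
      then show "ennreal (cmod (cinner \<phi> (laurent_op U xs \<psi>)))
          \<le> (SUP f\<in>{f \<in> circle_continuous. \<forall>z\<in>sphere 0 1. cmod (f z) \<le> 1}. ennreal (cmod (cinner \<phi> (circle_fun f U \<psi>))))"
        using X(2)[OF xs] by (intro SUP_upper2[of "laurent_eval xs"]) (auto intro: circle_continuous_intros)
    qed
  qed
qed

section \<open>Scattering states of a finite chain\<close>

lemma borel_measurable_cnj [measurable]: "cnj \<in> borel_measurable borel"
  by (intro borel_measurable_continuous_onI continuous_intros)

lemma nn_integral_circle_polynomial: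
  "(\<integral>\<^sup>+z. ennreal ((cmod (\<Sum>k<n. c k * z ^ k))\<^sup>2) \<partial>circle_measure) = ennreal (\<Sum>k<n. (cmod (c k))\<^sup>2)"
proof -
  have meas[measurable]: "(\<lambda>z :: complex. \<Sum>k<n. c k * z ^ k) \<in> borel_measurable borel" by measurable
  have bd: "(cmod (\<Sum>k<n. c k * z ^ k))\<^sup>2 \<le> (\<Sum>k<n. cmod (c k))\<^sup>2" if "cmod z = 1" for z
    by (intro power_mono order_trans[OF norm_sum] sum_mono) (auto simp: norm_mult norm_power that)
  have int: "integrable circle_measure (\<lambda>z. (cmod (\<Sum>k<n. c k * z ^ k))\<^sup>2)"
    by (rule integrable_circle_measure[of _ "(\<Sum>k<n. cmod (c k))\<^sup>2"]) (use bd in auto)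
  have "complex_of_real (\<integral>z. (cmod (\<Sum>k<n. c k * z ^ k))\<^sup>2 \<partial>circle_measure)
    = (\<integral>z. complex_of_real ((cmod (\<Sum>k<n. c k * z ^ k))\<^sup>2) \<partial>circle_measure)"
    by (rule integral_complex_of_real[symmetric])
  also have "\<dots> = (\<integral>z. (\<Sum>k<n. \<Sum>l<n. c k * cnj (c l) * z powi (int k - int l)) \<partial>circle_measure)"
  proof (rule integral_cong_AE)
    show "AE z in circle_measure. complex_of_real ((cmod (\<Sum>k<n. c k * z ^ k))\<^sup>2)
       = (\<Sum>k<n. \<Sum>l<n. c k * cnj (c l) * z powi (int k - int l))"
      using AE_circle_measure
    proof eventually_elim
      case (elim z)
      have "z \<noteq> 0" using elim by auto
      have "cnj z = inverse z" using elim by (rule cnj_eq_inverse)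
      then have "z ^ k * cnj z ^ l = z powi (int k - int l)" for k l
        using power_int_add[of z "int k" "- int l"] \<open>z \<noteq> 0\<close> by (simp add: power_int_minus power_inverse)
      then show ?case
        unfolding complex_norm_square cnj_sum sum_product
        by (intro sum.cong refl) (metis (no_types, lifting) complex_cnj_mult complex_cnj_power mult.assoc mult.left_commute)
    qed
  qed measurable
  also have "\<dots> = (\<Sum>k<n. \<Sum>l<n. c k * cnj (c l) * of_bool (int k - int l = 0))"
    by (subst Bochner_Integration.integral_sum | intro Bochner_Integration.integrable_sum integrable_mult_right integrable_circle_power_int)+
      (simp add: integral_circle_power_int)
  also have "\<dots> = (\<Sum>k<n. \<Sum>l<n. if k = l then c k * cnj (c l) else 0)"
    by (intro sum.cong) auto
  also have "\<dots> = (\<Sum>k<n. of_real ((cmod (c k))\<^sup>2))"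
    by (intro sum.cong refl) (simp only: complex_norm_square, simp)
  finally have "(\<integral>z. (cmod (\<Sum>k<n. c k * z ^ k))\<^sup>2 \<partial>circle_measure) = (\<Sum>k<n. (cmod (c k))\<^sup>2)"
    by (simp only: of_real_eq_iff flip: of_real_sum)
  then show ?thesis
    by (subst nn_integral_eq_integral[OF int]) auto
qed

text \<open>Fatou's lemma, applied once to the partial sums of a power series and once to circles
  whose radius tends to 1.\<close>

lemma nn_integral_norm_limit_le:
  fixes F :: "complex \<Rightarrow> complex"
  assumes [measurable]: "\<And>n. G n \<in> borel_measurable borel"
    and lim: "\<And>z. cmod z = 1 \<Longrightarrow> (\<lambda>n. G n z) \<longlonglongrightarrow> F z"
    and bd: "\<And>n. (\<integral>\<^sup>+z. ennreal ((cmod (G n z))\<^sup>2) \<partial>circle_measure) \<le> C"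
  shows "(\<integral>\<^sup>+z. ennreal ((cmod (F z))\<^sup>2) \<partial>circle_measure) \<le> C"
proof -
  have "(\<integral>\<^sup>+z. ennreal ((cmod (F z))\<^sup>2) \<partial>circle_measure) = (\<integral>\<^sup>+z. liminf (\<lambda>n. ennreal ((cmod (G n z))\<^sup>2)) \<partial>circle_measure)"
  proof (rule nn_integral_cong_AE)
    show "AE z in circle_measure. ennreal ((cmod (F z))\<^sup>2) = liminf (\<lambda>n. ennreal ((cmod (G n z))\<^sup>2))"
      using AE_circle_measure
    proof eventually_elim
      case (elim z)
      have "(\<lambda>n. ennreal ((cmod (G n z))\<^sup>2)) \<longlonglongrightarrow> ennreal ((cmod (F z))\<^sup>2)"
        by (intro tendsto_intros lim elim)
      from lim_imp_Liminf[OF _ this] show ?case by simp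
    qed
  qed
  also have "\<dots> \<le> liminf (\<lambda>n. \<integral>\<^sup>+z. ennreal ((cmod (G n z))\<^sup>2) \<partial>circle_measure)"
    by (rule nn_integral_liminf) measurable
  also have "\<dots> \<le> limsup (\<lambda>n. C)"
    by (rule order_trans[OF Liminf_le_Limsup[OF sequentially_bot] Limsup_mono]) (simp add: bd)
  also have "\<dots> = C" by (simp add: Limsup_const)
  finally show ?thesis .
qed

text \<open>The automorphism of the disc that puts one scatterer of reflection amplitude
  \<open>r\<close> in front of a load with reflection coefficient \<open>y\<close>.\<close>

definition mob :: "real \<Rightarrow> complex \<Rightarrow> complex"
  where "mob r y = (of_real r + y) / (1 + of_real r * y)"

lemma mob_norm_identity:
  "(cmod (1 + of_real r * y))\<^sup>2 - (cmod (of_real r + y))\<^sup>2 = (1 - r\<^sup>2) * (1 - (cmod y)\<^sup>2)"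
  unfolding cmod_power2 by (simp add: algebra_simps power2_eq_square)

lemma measurable_mob [measurable]: "mob r \<in> borel_measurable borel"
  unfolding mob_def[abs_def] by measurable

context
  fixes r :: real
  assumes r: "0 < r" "r < 1"
begin

lemma one_plus_ry_bound:
  assumes "cmod y \<le> 1"
  shows "1 - r \<le> cmod (1 + of_real r * y)"
proof -
  have "1 \<le> cmod (1 + of_real r * y) + cmod (of_real r * y)"
    by (metis add_diff_cancel_right' norm_one norm_triangle_ineq4)
  also have "cmod (of_real r * y) \<le> r" using r mult_left_mono[OF assms, of r] by (simp add: norm_mult)
  finally show ?thesis by simp
qed

lemma one_plus_ry_nonzero:
  assumes "cmod y \<le> 1"
  shows "1 + of_real r * y \<noteq> 0"
  using one_plus_ry_bound[OF assms] r by auto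

lemma norm_mob_le:
  assumes "cmod y \<le> 1"
  shows "cmod (mob r y) \<le> 1"
proof -
  have "0 \<le> (1 - r\<^sup>2) * (1 - (cmod y)\<^sup>2)"
    using r assms by (intro mult_nonneg_nonneg) (auto simp: power_le_one)
  then have "(cmod (of_real r + y))\<^sup>2 \<le> (cmod (1 + of_real r * y))\<^sup>2"
    using mob_norm_identity[of r y] by linarith
  then have "cmod (of_real r + y) \<le> cmod (1 + of_real r * y)" by (rule power2_le_imp_le) simp
  then show ?thesis using one_plus_ry_nonzero[OF assms] by (simp add: mob_def norm_divide divide_le_eq_1)
qed

lemma norm_mob:
  assumes "cmod y = 1"
  shows "cmod (mob r y) = 1"
proof -
  have "(cmod (of_real r + y))\<^sup>2 = (cmod (1 + of_real r * y))\<^sup>2"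
    using mob_norm_identity[of r y] assms by simp
  then have "cmod (of_real r + y) = cmod (1 + of_real r * y)" by simp
  then show ?thesis using one_plus_ry_nonzero[of y] assms by (simp add: mob_def norm_divide)
qed

end

text \<open>Sites are numbered by their distance \<open>d\<close> to a reflecting wall, and the chain is open at
  distance \<open>D\<close>; \<open>refl\<close> is the reflection coefficient of the part between \<open>d\<close> and the wall.
  \<open>wave z (Inl d)\<close> and \<open>wave z (Inr d)\<close> are the spin-up amplitude at distance \<open>d\<close> and the spin-down
  amplitude at distance \<open>d + 1\<close> of the solution with incoming amplitude 1 at distance \<open>D\<close>.\<close>

primrec refl :: "real \<Rightarrow> (nat \<Rightarrow> complex) \<Rightarrow> (nat \<Rightarrow> complex) \<Rightarrow> complex \<Rightarrow> nat \<Rightarrow> complex"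
  where
    "refl r p q z 0 = 1"
  | "refl r p q z (Suc d) = mob r (z\<^sup>2 * (p d * q d) * refl r p q z d)"

text \<open>The load as seen from the next site outwards: travelling there and back contributes one
  factor \<open>z\<close> and one phase in each direction.\<close>

definition refl_arg :: "real \<Rightarrow> (nat \<Rightarrow> complex) \<Rightarrow> (nat \<Rightarrow> complex) \<Rightarrow> complex \<Rightarrow> nat \<Rightarrow> complex"
  where "refl_arg r p q z d = z\<^sup>2 * (p d * q d) * refl r p q z d"

definition wave :: "real \<Rightarrow> real \<Rightarrow> (nat \<Rightarrow> complex) \<Rightarrow> (nat \<Rightarrow> complex) \<Rightarrow> nat \<Rightarrow> complex \<Rightarrow> nat + nat \<Rightarrow> complex"
  where "wave r t p q D z x =
    (let up = \<lambda>d. \<Prod>e\<in>{d..<D}. z * p e * of_real t / (1 + of_real r * refl_arg r p q z e)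
     in case x of Inl d \<Rightarrow> up d | Inr d \<Rightarrow> z * q d * refl r p q z d * up d)"

section \<open>Finite chains with one reflecting and one open end\<close>

locale chain =
  fixes r t :: real and p q :: "nat \<Rightarrow> complex" and D :: nat
  assumes r: "0 < r" "r < 1" and t: "0 < t" and rt: "r\<^sup>2 + t\<^sup>2 = 1"
    and p: "\<And>d. cmod (p d) = 1" and q: "\<And>d. cmod (q d) = 1"
begin

abbreviation "S \<equiv> refl r p q"
abbreviation "m \<equiv> refl_arg r p q"
abbreviation "\<psi> \<equiv> wave r t p q D"

lemma S_Suc: "S z (Suc d) = mob r (m z d)"
  by (simp add: refl_arg_def)

lemma norm_S_le: "cmod z \<le> 1 \<Longrightarrow> cmod (S z d) \<le> 1"
proof (induction d)
  case (Suc d)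
  have "cmod (z\<^sup>2 * (p d * q d) * S z d) \<le> 1"
    using Suc by (simp add: norm_mult p q norm_power mult_le_one power_le_one)
  then show ?case by (simp add: norm_mob_le[OF r])
qed simp

lemma norm_m_le: "cmod z \<le> 1 \<Longrightarrow> cmod (m z d) \<le> 1"
  using norm_S_le[of z d] by (simp add: refl_arg_def norm_mult p q norm_power mult_le_one power_le_one)

lemma norm_S: "cmod z = 1 \<Longrightarrow> cmod (S z d) = 1"
  by (induction d) (simp_all add: norm_mob[OF r] norm_mult p q norm_power)

lemma norm_m: "cmod z = 1 \<Longrightarrow> cmod (m z d) = 1"
  by (simp add: refl_arg_def norm_mult p q norm_power norm_S)

lemma m_nonzero: "cmod z \<le> 1 \<Longrightarrow> 1 + of_real r * m z d \<noteq> 0"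
  by (rule one_plus_ry_nonzero[OF r norm_m_le])

lemma wave_Inl: "\<psi> z (Inl d) = (\<Prod>e\<in>{d..<D}. z * p e * of_real t / (1 + of_real r * m z e))"
  by (simp add: wave_def)

lemma wave_Inl_D: "\<psi> z (Inl D) = 1"
  by (simp add: wave_Inl)

lemma wave_Inl_step: "d < D \<Longrightarrow> \<psi> z (Inl d) = z * p d * of_real t / (1 + of_real r * m z d) * \<psi> z (Inl (Suc d))"
  by (simp add: wave_Inl prod.atLeast_Suc_lessThan)

lemma wave_Inr: "\<psi> z (Inr d) = z * q d * S z d * \<psi> z (Inl d)"
  by (simp add: wave_def)

text \<open>Together with \<open>wave_down\<close> and \<open>wave_down_0\<close> this is the
  eigenvalue equation of the cut-off walk for the eigenvalue 1/z, continued into the disc.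
  Eliminating the spin-down amplitude by means of the reflection coefficient produces the
  denominators in \<open>wave\<close>.\<close>

lemma wave_up:
  assumes "cmod z \<le> 1" "d < D"
  shows "\<psi> z (Inl d) = z * (p d * (of_real t * \<psi> z (Inl (Suc d)) - of_real r * \<psi> z (Inr d)))"
proof -
  have nz: "1 + of_real r * m z d \<noteq> 0" by (rule m_nonzero[OF assms(1)])
  have "\<psi> z (Inl d) * (1 + of_real r * m z d) = z * p d * of_real t * \<psi> z (Inl (Suc d))"
    using nz by (simp add: wave_Inl_step[OF assms(2)])
  moreover have "z * (p d * \<psi> z (Inr d)) = m z d * \<psi> z (Inl d)"
    by (simp add: wave_Inr refl_arg_def power2_eq_square)
  moreover have "z * (p d * (of_real t * \<psi> z (Inl (Suc d)) - of_real r * \<psi> z (Inr d)))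
    = z * p d * of_real t * \<psi> z (Inl (Suc d)) - of_real r * (z * (p d * \<psi> z (Inr d)))"
    by (simp add: algebra_simps)
  ultimately have "z * (p d * (of_real t * \<psi> z (Inl (Suc d)) - of_real r * \<psi> z (Inr d)))
    = \<psi> z (Inl d) * (1 + of_real r * m z d) - of_real r * (m z d * \<psi> z (Inl d))"
    by (simp only:)
  then show ?thesis by (simp add: algebra_simps)
qed

lemma wave_down:
  assumes "cmod z \<le> 1" "d < D"
  shows "\<psi> z (Inr (Suc d)) = z * (q (Suc d) * (of_real r * \<psi> z (Inl (Suc d)) + of_real t * \<psi> z (Inr d)))"
proof -
  have nz: "1 + of_real r * m z d \<noteq> 0" by (rule m_nonzero[OF assms(1)])
  have rt': "complex_of_real r * of_real r + of_real t * of_real t = 1"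
    using rt by (simp add: power2_eq_square flip: of_real_mult of_real_add)
  have "\<psi> z (Inr d) = of_real t * m z d / (1 + of_real r * m z d) * \<psi> z (Inl (Suc d))"
    by (simp add: wave_Inr wave_Inl_step[OF assms(2)] refl_arg_def power2_eq_square)
  then have "of_real r * \<psi> z (Inl (Suc d)) + of_real t * \<psi> z (Inr d)
    = (of_real r + of_real t * of_real t * m z d / (1 + of_real r * m z d)) * \<psi> z (Inl (Suc d))"
    by (simp add: algebra_simps)
  \<comment> \<open>Direct reflection plus all paths that pass the scatterer, bounce between it and
    the load, and return, summed as a geometric series; \<open>r\<^sup>2 + t\<^sup>2 = 1\<close>
    combines both terms into one Moebius map.\<close>
  also have "of_real r + of_real t * of_real t * m z d / (1 + of_real r * m z d) = mob r (m z d)"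
  proof -
    have "of_real r * (1 + of_real r * m z d) + of_real t * of_real t * m z d
      = of_real r + (of_real r * of_real r + of_real t * of_real t) * m z d"
      by (simp add: algebra_simps)
    then show ?thesis unfolding rt' mob_def using nz by (simp add: divide_simps)
  qed
  finally have eq: "of_real r * \<psi> z (Inl (Suc d)) + of_real t * \<psi> z (Inr d) = S z (Suc d) * \<psi> z (Inl (Suc d))"
    by (simp only: S_Suc)
  show ?thesis unfolding eq by (simp only: wave_Inr mult_ac)
qed

lemma wave_down_0: "\<psi> z (Inr 0) = z * (q 0 * \<psi> z (Inl 0))"
  by (simp add: wave_Inr)

lemma measurable_S [measurable]: "(\<lambda>z. S z d) \<in> borel_measurable borel"
  by (induction d) simp_all

lemma measurable_m [measurable]: "(\<lambda>z. m z d) \<in> borel_measurable borel"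
  unfolding refl_arg_def by measurable

lemma measurable_wave [measurable]: "(\<lambda>z. \<psi> z x) \<in> borel_measurable borel"
  by (cases x) (simp_all add: wave_Inl wave_Inr)

lemma continuous_S: "continuous_on (cball 0 1) (\<lambda>z. S z d)"
proof (induction d)
  case (Suc d)
  have "1 + of_real r * (z\<^sup>2 * (p d * q d) * S z d) \<noteq> 0" if "z \<in> cball 0 1" for z
    using m_nonzero[of z d] that by (simp add: refl_arg_def)
  then show ?case using Suc unfolding refl.simps mob_def by (intro continuous_intros) auto
qed simp

lemma continuous_m: "continuous_on (cball 0 1) (\<lambda>z. m z d)"
  unfolding refl_arg_def by (intro continuous_intros continuous_S)

lemma holomorphic_S: "(\<lambda>z. S z d) holomorphic_on ball 0 1"
proof (induction d)
  case (Suc d)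
  have "1 + of_real r * (z\<^sup>2 * (p d * q d) * S z d) \<noteq> 0" if "z \<in> ball 0 1" for z
    using m_nonzero[of z d] that by (simp add: refl_arg_def)
  then show ?case using Suc unfolding refl.simps mob_def by (intro holomorphic_intros) auto
qed simp

lemma continuous_wave: "continuous_on (cball 0 1) (\<lambda>z. \<psi> z x)"
proof -
  have "continuous_on (cball 0 1) (\<lambda>z. \<psi> z (Inl d))" for d
    unfolding wave_Inl using m_nonzero by (intro continuous_intros continuous_m) auto
  then show ?thesis by (cases x) (auto simp: wave_Inr intro!: continuous_intros continuous_S)
qed

lemma norm_wave_le:
  assumes "cmod z \<le> 1"
  shows "cmod (\<psi> z x) \<le> (1 / (1 - r)) ^ D"
proof -
  have "t\<^sup>2 \<le> 1\<^sup>2" using rt zero_le_power2[of r] unfolding one_power2 by linarith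
  then have t1: "t \<le> 1" by (rule power2_le_imp_le) simp
  have up: "cmod (\<psi> z (Inl d)) \<le> (1 / (1 - r)) ^ D" for d
  proof -
    have "cmod (\<psi> z (Inl d)) = (\<Prod>e\<in>{d..<D}. cmod (z * p e * of_real t / (1 + of_real r * m z e)))"
      by (simp add: wave_Inl prod_norm)
    also have "\<dots> \<le> (\<Prod>e\<in>{d..<D}. 1 / (1 - r))"
    proof (rule prod_mono, intro conjI)
      fix e
      have "cmod z * t \<le> 1 * 1" using assms t t1 by (intro mult_mono) auto
      then show "cmod (z * p e * of_real t / (1 + of_real r * m z e)) \<le> 1 / (1 - r)"
        using one_plus_ry_bound[OF r norm_m_le[OF assms], of e] r t
        unfolding norm_divide norm_mult p by (intro frac_le) auto
    qed auto
    also have "\<dots> = (1 / (1 - r)) ^ (D - d)" by simp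
    also have "\<dots> \<le> (1 / (1 - r)) ^ D" using r by (intro power_increasing) auto
    finally show ?thesis .
  qed
  show ?thesis
  proof (cases x)
    case (Inr d)
    have "cmod (\<psi> z (Inr d)) = (cmod z * cmod (S z d)) * cmod (\<psi> z (Inl d))"
      by (simp add: wave_Inr norm_mult q)
    also have "\<dots> \<le> 1 * cmod (\<psi> z (Inl d))"
      using assms norm_S_le[OF assms] by (intro mult_right_mono mult_le_one) auto
    finally show ?thesis using up[of d] Inr by simp
  qed (use up in auto)
qed

text \<open>As \<open>Inr d\<close> sits at distance \<open>d + 1\<close>, the indices
  \<open>d < D\<close> cover spin down at distances 1 to \<open>D\<close>. Spin down at distance 0
  would have to come through the wall.\<close>

definition box :: "(nat + nat) set"
  where "box = {..D} <+> {..<D}"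

lemma finite_box: "finite box"
  by (simp add: box_def)

lemma sum_box: "(\<Sum>x\<in>box. f x) = (\<Sum>d\<le>D. f (Inl d)) + (\<Sum>d<D. f (Inr d))"
  unfolding box_def by (subst sum.Plus) (auto simp: o_def)

text \<open>The transpose of the evolution inside the box.\<close>

definition step :: "(nat + nat \<Rightarrow> complex) \<Rightarrow> nat + nat \<Rightarrow> complex"
  where "step v x =
    (let w = \<lambda>d. if d < D then q d * v (Inr d) else 0 in
     case x of
       Inl 0 \<Rightarrow> w 0
     | Inl (Suc d) \<Rightarrow> of_real t * (p d * v (Inl d)) + of_real r * w (Suc d)
     | Inr d \<Rightarrow> - of_real r * (p d * v (Inl d)) + of_real t * w (Suc d))"

text \<open>The eigenvalue equation moved to the other factor of the pairing. Each application gains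
  a factor \<open>z\<close>, except at the entry \<open>Inl D\<close>, where the wave is prescribed
  to be 1.\<close>

lemma pairing_step:
  assumes "cmod z \<le> 1"
  shows "(\<Sum>x\<in>box. v x * \<psi> z x) = v (Inl D) + z * (\<Sum>x\<in>box. step v x * \<psi> z x)"
proof -
  define w where "w d = (if d < D then q d * v (Inr d) else 0)" for d
  have dn: "(\<Sum>d<D. v (Inr d) * \<psi> z (Inr d)) = z * (w 0 * \<psi> z (Inl 0)
     + (\<Sum>d<D. w (Suc d) * (of_real r * \<psi> z (Inl (Suc d)) + of_real t * \<psi> z (Inr d))))"
  proof (cases D)
    case (Suc D')
    have first: "(\<Sum>d<D. f d) = f 0 + (\<Sum>d<D'. f (Suc d))" for f :: "nat \<Rightarrow> complex"
      by (simp only: Suc sum.lessThan_Suc_shift)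
    have last: "(\<Sum>d<D. f d) = (\<Sum>d<D'. f d) + f D'" for f :: "nat \<Rightarrow> complex"
      by (simp add: Suc)
    have w: "w 0 = q 0 * v (Inr 0)" "w (Suc D') = 0" by (simp_all add: w_def Suc)
    have "(\<Sum>d<D. v (Inr d) * \<psi> z (Inr d)) = v (Inr 0) * \<psi> z (Inr 0) + (\<Sum>d<D'. v (Inr (Suc d)) * \<psi> z (Inr (Suc d)))"
      by (rule first)
    also have "(\<Sum>d<D'. v (Inr (Suc d)) * \<psi> z (Inr (Suc d)))
      = (\<Sum>d<D'. z * (w (Suc d) * (of_real r * \<psi> z (Inl (Suc d)) + of_real t * \<psi> z (Inr d))))"
    proof (rule sum.cong[OF refl])
      fix d assume "d \<in> {..<D'}"
      then have d: "d < D" "Suc d < D" using Suc by auto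
      then have wd: "w (Suc d) = q (Suc d) * v (Inr (Suc d))" by (simp add: w_def)
      show "v (Inr (Suc d)) * \<psi> z (Inr (Suc d)) = z * (w (Suc d) * (of_real r * \<psi> z (Inl (Suc d)) + of_real t * \<psi> z (Inr d)))"
        unfolding wave_down[OF assms d(1)] wd by (simp only: mult_ac)
    qed
    also have "\<dots> = (\<Sum>d<D. z * (w (Suc d) * (of_real r * \<psi> z (Inl (Suc d)) + of_real t * \<psi> z (Inr d))))"
      unfolding last by (simp add: w)
    finally show ?thesis unfolding wave_down_0 w(1) by (simp add: distrib_left sum_distrib_left mult_ac)
  qed (simp add: w_def)
  have up: "(\<Sum>d\<le>D. v (Inl d) * \<psi> z (Inl d))
    = v (Inl D) + z * (\<Sum>d<D. p d * v (Inl d) * (of_real t * \<psi> z (Inl (Suc d)) - of_real r * \<psi> z (Inr d)))"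
  proof -
    have "(\<Sum>d\<le>D. v (Inl d) * \<psi> z (Inl d)) = (\<Sum>d<D. v (Inl d) * \<psi> z (Inl d)) + v (Inl D)"
      by (simp add: lessThan_Suc_atMost[symmetric] wave_Inl_D)
    also have "(\<Sum>d<D. v (Inl d) * \<psi> z (Inl d))
      = (\<Sum>d<D. z * (p d * v (Inl d) * (of_real t * \<psi> z (Inl (Suc d)) - of_real r * \<psi> z (Inr d))))"
    proof (rule sum.cong[OF refl])
      fix d assume "d \<in> {..<D}"
      then have d: "d < D" by simp
      show "v (Inl d) * \<psi> z (Inl d) = z * (p d * v (Inl d) * (of_real t * \<psi> z (Inl (Suc d)) - of_real r * \<psi> z (Inr d)))"
        by (subst wave_up[OF assms d]) (simp only: mult_ac)
    qed
    finally show ?thesis by (simp add: sum_distrib_left)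
  qed
  have "(\<Sum>x\<in>box. step v x * \<psi> z x)
    = w 0 * \<psi> z (Inl 0) + (\<Sum>d<D. (of_real t * (p d * v (Inl d)) + of_real r * w (Suc d)) * \<psi> z (Inl (Suc d)))
      + (\<Sum>d<D. (- of_real r * (p d * v (Inl d)) + of_real t * w (Suc d)) * \<psi> z (Inr d))"
    unfolding sum_box lessThan_Suc_atMost[symmetric] sum.lessThan_Suc_shift
    by (simp add: step_def w_def Let_def del: sum.lessThan_Suc)
  also have "\<dots> = w 0 * \<psi> z (Inl 0)
     + (\<Sum>d<D. w (Suc d) * (of_real r * \<psi> z (Inl (Suc d)) + of_real t * \<psi> z (Inr d)))
     + (\<Sum>d<D. p d * v (Inl d) * (of_real t * \<psi> z (Inl (Suc d)) - of_real r * \<psi> z (Inr d)))"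
    by (simp add: distrib_left distrib_right right_diff_distrib left_diff_distrib sum.distrib sum_subtractf sum_negf mult_ac)
  finally show ?thesis unfolding sum_box up dn by (simp add: algebra_simps)
qed

text \<open>Up to phases a step is the rotation with entries r and t at each site, hence isometric;
  only the component at the open end leaves the box.\<close>

lemma norm_step: "(\<Sum>x\<in>box. (cmod (v x))\<^sup>2) = (cmod (v (Inl D)))\<^sup>2 + (\<Sum>x\<in>box. (cmod (step v x))\<^sup>2)"
proof -
  define w where "w d = (if d < D then q d * v (Inr d) else 0)" for d
  have rot: "(cmod (of_real t * a + of_real r * b))\<^sup>2 + (cmod (- of_real r * a + of_real t * b))\<^sup>2 = (cmod a)\<^sup>2 + (cmod b)\<^sup>2" for a b
  proof -
    have "(cmod (of_real t * a + of_real r * b))\<^sup>2 + (cmod (- of_real r * a + of_real t * b))\<^sup>2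
      = (r\<^sup>2 + t\<^sup>2) * ((cmod a)\<^sup>2 + (cmod b)\<^sup>2)"
      unfolding cmod_power2 by (simp add: algebra_simps power2_eq_square)
    then show ?thesis by (simp add: rt)
  qed
  have "(\<Sum>x\<in>box. (cmod (step v x))\<^sup>2) = (cmod (w 0))\<^sup>2
      + ((\<Sum>d<D. (cmod (of_real t * (p d * v (Inl d)) + of_real r * w (Suc d)))\<^sup>2)
      + (\<Sum>d<D. (cmod (- of_real r * (p d * v (Inl d)) + of_real t * w (Suc d)))\<^sup>2))"
    unfolding sum_box lessThan_Suc_atMost[symmetric] sum.lessThan_Suc_shift
    by (simp add: step_def w_def Let_def del: sum.lessThan_Suc)
  also have "\<dots> = (cmod (w 0))\<^sup>2 + (\<Sum>d<D. (cmod (v (Inl d)))\<^sup>2) + (\<Sum>d<D. (cmod (w (Suc d)))\<^sup>2)"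
    unfolding sum.distrib[symmetric] rot by (simp add: norm_mult p sum.distrib)
  also have "\<dots> = (\<Sum>d<D. (cmod (v (Inl d)))\<^sup>2) + (\<Sum>d<Suc D. (cmod (w d))\<^sup>2)"
    unfolding sum.lessThan_Suc_shift by simp
  also have "(\<Sum>d<Suc D. (cmod (w d))\<^sup>2) = (\<Sum>d<D. (cmod (v (Inr d)))\<^sup>2)"
    by (simp add: w_def norm_mult q)
  finally show ?thesis unfolding sum_box by (simp add: lessThan_Suc_atMost[symmetric])
qed

lemma pairing_iterate:
  assumes "cmod z \<le> 1"
  shows "(\<Sum>x\<in>box. v x * \<psi> z x) = (\<Sum>k<M. (step ^^ k) v (Inl D) * z ^ k) + z ^ M * (\<Sum>x\<in>box. (step ^^ M) v x * \<psi> z x)"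
proof (induction M)
  case (Suc M)
  show ?case unfolding Suc.IH pairing_step[OF assms, of "(step ^^ M) v"] by (simp add: algebra_simps)
qed simp

lemma norm_iterate:
  "(\<Sum>x\<in>box. (cmod (v x))\<^sup>2) = (\<Sum>k<M. (cmod ((step ^^ k) v (Inl D)))\<^sup>2) + (\<Sum>x\<in>box. (cmod ((step ^^ M) v x))\<^sup>2)"
proof (induction M)
  case (Suc M)
  show ?case unfolding Suc.IH norm_step[of "(step ^^ M) v"] by simp
qed simp

text \<open>The pairing is a power series whose coefficients are the amplitudes emitted at the open
  end, and by \<open>norm_iterate\<close> their squares sum to at most the norm of \<open>v\<close>.
  The remainder carries \<open>z ^ M\<close>, so the expansion is established on circles of radius
  below 1, and the radius is sent to 1 afterwards.\<close>

lemma wave_bessel: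
  "(\<integral>\<^sup>+z. ennreal ((cmod (\<Sum>x\<in>box. v x * \<psi> z x))\<^sup>2) \<partial>circle_measure) \<le> ennreal (\<Sum>x\<in>box. (cmod (v x))\<^sup>2)"
proof -
  define F where "F z = (\<Sum>x\<in>box. v x * \<psi> z x)" for z
  define C where "C = (\<Sum>x\<in>box. (cmod (v x))\<^sup>2)"
  define y where "y k = (step ^^ k) v (Inl D)" for k
  have [measurable]: "F \<in> borel_measurable borel" unfolding F_def by measurable
  have contF: "continuous_on (cball 0 1) F"
    unfolding F_def by (intro continuous_intros continuous_wave)
  have inside: "(\<integral>\<^sup>+z. ennreal ((cmod (F (of_real \<rho> * z)))\<^sup>2) \<partial>circle_measure) \<le> ennreal C"
    if \<rho>: "0 \<le> \<rho>" "\<rho> < 1" for \<rho>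
  proof (rule nn_integral_norm_limit_le)
    show "(\<lambda>z. \<Sum>k<M. (of_real (\<rho> ^ k) * y k) * z ^ k) \<in> borel_measurable borel" for M by measurable
    show "(\<integral>\<^sup>+z. ennreal ((cmod (\<Sum>k<M. (of_real (\<rho> ^ k) * y k) * z ^ k))\<^sup>2) \<partial>circle_measure) \<le> ennreal C" for M
      unfolding nn_integral_circle_polynomial
    proof (rule ennreal_leI)
      have "(\<Sum>k<M. (cmod (of_real (\<rho> ^ k) * y k))\<^sup>2) \<le> (\<Sum>k<M. (cmod (y k))\<^sup>2)"
        using \<rho> by (intro sum_mono power_mono) (auto simp: norm_mult norm_power power_le_one intro!: mult_left_le_one_le)
      also have "\<dots> \<le> C" unfolding C_def norm_iterate[of v M] y_def by (simp add: sum_nonneg)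
      finally show "(\<Sum>k<M. (cmod (of_real (\<rho> ^ k) * y k))\<^sup>2) \<le> C" .
    qed
    fix z :: complex assume z: "cmod z = 1"
    let ?w = "of_real \<rho> * z"
    have w: "cmod ?w \<le> 1" "cmod ?w = \<rho>" using \<rho> z by (simp_all add: norm_mult)
    define K where "K = (\<Sum>x\<in>box. sqrt C * (1 / (1 - r)) ^ D)"
    have rest: "cmod (\<Sum>x\<in>box. (step ^^ M) v x * \<psi> ?w x) \<le> K" for M
    proof -
      have "(cmod ((step ^^ M) v x))\<^sup>2 \<le> C" if "x \<in> box" for x
      proof -
        have "(cmod ((step ^^ M) v x))\<^sup>2 \<le> (\<Sum>x\<in>box. (cmod ((step ^^ M) v x))\<^sup>2)"
          using that finite_box by (intro member_le_sum) auto
        also have "\<dots> \<le> C" unfolding C_def norm_iterate[of v M] by (simp add: sum_nonneg)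
        finally show ?thesis .
      qed
      then have "cmod ((step ^^ M) v x) \<le> sqrt C" if "x \<in> box" for x
        using that by (simp add: real_le_rsqrt)
      then show ?thesis unfolding K_def
        by (intro order_trans[OF norm_sum] sum_mono) (auto simp: norm_mult C_def sum_nonneg intro!: mult_mono norm_wave_le w(1))
    qed
    have "(\<lambda>M. (\<Sum>k<M. y k * ?w ^ k)) \<longlonglongrightarrow> F ?w"
    proof (rule LIM_zero_cancel, rule Lim_null_comparison)
      show "\<forall>\<^sub>F M in sequentially. norm ((\<Sum>k<M. y k * ?w ^ k) - F ?w) \<le> \<rho> ^ M * K"
      proof (intro always_eventually allI)
        fix M
        have "norm ((\<Sum>k<M. y k * ?w ^ k) - F ?w) = \<rho> ^ M * cmod (\<Sum>x\<in>box. (step ^^ M) v x * \<psi> ?w x)"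
          unfolding F_def pairing_iterate[OF w(1), of v M] y_def using \<rho>
          by (simp add: norm_mult norm_power z)
        also have "\<dots> \<le> \<rho> ^ M * K" using rest \<rho> by (intro mult_left_mono) auto
        finally show "norm ((\<Sum>k<M. y k * ?w ^ k) - F ?w) \<le> \<rho> ^ M * K" .
      qed
      show "(\<lambda>M. \<rho> ^ M * K) \<longlonglongrightarrow> 0"
        using tendsto_mult_left_zero[OF LIMSEQ_realpow_zero[OF \<rho>]] .
    qed
    moreover have "(\<Sum>k<M. (of_real (\<rho> ^ k) * y k) * z ^ k) = (\<Sum>k<M. y k * ?w ^ k)" for M
      by (intro sum.cong) (simp_all add: power_mult_distrib)
    ultimately show "(\<lambda>M. \<Sum>k<M. (of_real (\<rho> ^ k) * y k) * z ^ k) \<longlonglongrightarrow> F ?w" by simp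
  qed
  have "(\<integral>\<^sup>+z. ennreal ((cmod (F z))\<^sup>2) \<partial>circle_measure) \<le> ennreal C"
  proof (rule nn_integral_norm_limit_le)
    define \<rho> where "\<rho> n = 1 - inverse (real (Suc n))" for n
    have \<rho>: "0 \<le> \<rho> n" "\<rho> n < 1" for n by (auto simp: \<rho>_def inverse_eq_divide)
    show "(\<lambda>z. F (of_real (\<rho> n) * z)) \<in> borel_measurable borel" for n by measurable
    show "(\<integral>\<^sup>+z. ennreal ((cmod (F (of_real (\<rho> n) * z)))\<^sup>2) \<partial>circle_measure) \<le> ennreal C" for n
      by (rule inside[OF \<rho>])
    fix z :: complex assume z: "cmod z = 1"
    have "\<rho> \<longlonglongrightarrow> 1 - 0" unfolding \<rho>_def by (intro tendsto_intros LIMSEQ_inverse_real_of_nat)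
    then have "(\<lambda>n. of_real (\<rho> n) * z) \<longlonglongrightarrow> of_real 1 * z" by (intro tendsto_intros) simp
    then show "(\<lambda>n. F (of_real (\<rho> n) * z)) \<longlonglongrightarrow> F z"
      using \<rho> z by (intro continuous_on_tendsto_compose[OF contF]) (auto simp: norm_mult less_imp_le)
  qed
  then show ?thesis by (simp add: F_def C_def)
qed

text \<open>Matching the reflection coefficient \<open>R\<close> of the part beyond \<open>d\<close> with the one of the part
  next to the wall.\<close>

lemma wave_matching:
  assumes "d \<le> D"
  shows "\<exists>R T. R \<in> borel_measurable borel \<and> continuous_on (cball 0 1) R \<and> R holomorphic_on ball 0 1 \<and>
    R 0 = 0 \<and> (\<forall>z. cmod z \<le> 1 \<longrightarrow> cmod (R z) < 1) \<and>
    (\<forall>z. cmod z = 1 \<longrightarrow> (cmod (T z))\<^sup>2 = 1 - (cmod (R z))\<^sup>2) \<and>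
    (\<forall>z. cmod z \<le> 1 \<longrightarrow> \<psi> z (Inl d) * (1 - R z * S z d) = T z)"
  using assms
proof (induction d rule: inc_induct)
  case base
  show ?case by (intro exI[of _ "\<lambda>_. 0"] exI[of _ "\<lambda>_. 1"]) (auto simp: wave_Inl_D)
next
  case (step d)
  then obtain R T where IH: "R \<in> borel_measurable borel" "continuous_on (cball 0 1) R" "R holomorphic_on ball 0 1"
    "R 0 = 0" "\<And>z. cmod z \<le> 1 \<Longrightarrow> cmod (R z) < 1" "\<And>z. cmod z = 1 \<Longrightarrow> (cmod (T z))\<^sup>2 = 1 - (cmod (R z))\<^sup>2"
    "\<And>z. cmod z \<le> 1 \<Longrightarrow> \<psi> z (Inl (Suc d)) * (1 - R z * S z (Suc d)) = T z" by blast
  note [measurable] = IH(1)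
  \<comment> \<open>The recursion of \<open>refl\<close> run from the open end. A spin-down wave is
    reflected into spin up with amplitude -r, whence the changed sign; the factor
    \<open>z\<^sup>2\<close> provides \<open>R' 0 = 0\<close>.\<close>
  define R' where "R' z = z\<^sup>2 * (p d * q d) * ((R z - of_real r) / (1 - of_real r * R z))" for z
  define T' where "T' z = z * p d * of_real t * T z / (1 - of_real r * R z)" for z
  have nz: "1 - of_real r * R z \<noteq> 0" if "cmod z \<le> 1" for z
    using one_plus_ry_nonzero[OF r, of "- R z"] IH(5)[OF that] by simp
  have id: "(cmod (1 - of_real r * R z))\<^sup>2 - (cmod (R z - of_real r))\<^sup>2 = t\<^sup>2 * (1 - (cmod (R z))\<^sup>2)" for z
  proof -
    have "cmod (R z - of_real r) = cmod (of_real r + - R z)" by (simp add: norm_minus_commute)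
    moreover have "1 - r\<^sup>2 = t\<^sup>2" using rt by simp
    ultimately show ?thesis using mob_norm_identity[of r "- R z"] by simp
  qed
  have lt: "cmod (R z - of_real r) < cmod (1 - of_real r * R z)" if "cmod z \<le> 1" for z
  proof (rule power2_less_imp_less)
    have "0 < t\<^sup>2 * (1 - (cmod (R z))\<^sup>2)"
      using IH(5)[OF that] t by (intro mult_pos_pos) (auto simp: power_less_one_iff)
    then show "(cmod (R z - of_real r))\<^sup>2 < (cmod (1 - of_real r * R z))\<^sup>2" using id[of z] by linarith
  qed simp
  show ?case
  proof (rule exI[of _ R'], rule exI[of _ T'], intro conjI allI impI)
    show "R' \<in> borel_measurable borel" unfolding R'_def by measurable
    show "continuous_on (cball 0 1) R'" unfolding R'_def using nz by (intro continuous_intros IH(2)) auto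
    show "R' holomorphic_on ball 0 1" unfolding R'_def using nz by (intro holomorphic_intros IH(3)) auto
    show "R' 0 = 0" by (simp add: R'_def)
  next
    fix z :: complex assume z: "cmod z \<le> 1"
    have "cmod (R' z) = (cmod z)\<^sup>2 * (cmod (R z - of_real r) / cmod (1 - of_real r * R z))"
      by (simp add: R'_def norm_mult norm_divide norm_power p q)
    also have "\<dots> \<le> 1 * (cmod (R z - of_real r) / cmod (1 - of_real r * R z))"
      using z by (intro mult_right_mono) (auto simp: power_le_one)
    also have "\<dots> < 1" using lt[OF z] by (auto simp: divide_less_eq_1)
    finally show "cmod (R' z) < 1" .
  next
    fix z :: complex assume z: "cmod z = 1"
    have "(cmod (T' z))\<^sup>2 = t\<^sup>2 * (1 - (cmod (R z))\<^sup>2) / (cmod (1 - of_real r * R z))\<^sup>2"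
      using t by (simp add: T'_def norm_mult norm_divide p z power_mult_distrib power_divide IH(6)[OF z])
    also have "\<dots> = 1 - (cmod (R z - of_real r))\<^sup>2 / (cmod (1 - of_real r * R z))\<^sup>2"
      using nz[of z] z unfolding id[symmetric] diff_divide_distrib by simp
    also have "(cmod (R z - of_real r))\<^sup>2 / (cmod (1 - of_real r * R z))\<^sup>2 = (cmod (R' z))\<^sup>2"
      unfolding R'_def norm_mult norm_divide norm_power p q z by (simp add: power_divide)
    finally show "(cmod (T' z))\<^sup>2 = 1 - (cmod (R' z))\<^sup>2" .
  next
    fix z :: complex assume z: "cmod z \<le> 1"
    have 1: "1 + of_real r * m z d \<noteq> 0" by (rule m_nonzero[OF z])
    have 2: "1 - of_real r * R z \<noteq> 0" by (rule nz[OF z])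
    have a: "\<psi> z (Inl d) * (1 + of_real r * m z d) = z * p d * of_real t * \<psi> z (Inl (Suc d))"
      using 1 step by (simp add: wave_Inl_step)
    have b: "(1 - R z * S z (Suc d)) * (1 + of_real r * m z d) = (1 + of_real r * m z d) - R z * (of_real r + m z d)"
      unfolding S_Suc mob_def using 1 by (simp add: left_diff_distrib)
    have "R' z * S z d * (1 - of_real r * R z) = m z d * (R z - of_real r)"
      using 2 by (simp add: R'_def refl_arg_def)
    then have "(1 - R' z * S z d) * (1 - of_real r * R z) = (1 - of_real r * R z) - m z d * (R z - of_real r)"
      by (simp only: left_diff_distrib[of 1] mult_1_left)
    then have "\<psi> z (Inl d) * (1 - R' z * S z d) * (1 - of_real r * R z)
      = \<psi> z (Inl d) * ((1 - of_real r * R z) - m z d * (R z - of_real r))"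
      by (simp only: mult.assoc)
    also have "\<dots> = \<psi> z (Inl d) * ((1 + of_real r * m z d) - R z * (of_real r + m z d))"
      by (simp add: algebra_simps)
    also have "\<dots> = z * p d * of_real t * (\<psi> z (Inl (Suc d)) * (1 - R z * S z (Suc d)))"
      unfolding b[symmetric] using a by (simp add: mult_ac)
    also have "\<dots> = T' z * (1 - of_real r * R z)" unfolding IH(7)[OF z] using 2 by (simp add: T'_def)
    finally show "\<psi> z (Inl d) * (1 - R' z * S z d) = T' z" using 2 by simp
  qed
qed

text \<open>On the circle |S| = 1, so that the squared amplitude (1 - |R|^2) / |1 - R S|^2 is a
  Poisson kernel, the real part of (1 + R S) / (1 - R S). This function is holomorphic in the disc
  and equals 1 at the centre.\<close>

lemma wave_normalised_up:
  assumes "d \<le> D"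
  shows "(\<integral>z. (cmod (\<psi> z (Inl d)))\<^sup>2 \<partial>circle_measure) = 1"
proof -
  obtain R T where R[measurable]: "R \<in> borel_measurable borel" and
    IH: "continuous_on (cball 0 1) R" "R holomorphic_on ball 0 1"
    "R 0 = 0" "\<And>z. cmod z \<le> 1 \<Longrightarrow> cmod (R z) < 1" "\<And>z. cmod z = 1 \<Longrightarrow> (cmod (T z))\<^sup>2 = 1 - (cmod (R z))\<^sup>2"
    "\<And>z. cmod z \<le> 1 \<Longrightarrow> \<psi> z (Inl d) * (1 - R z * S z d) = T z"
    using wave_matching[OF assms] by metis
  define f where "f z = (1 + R z * S z d) / (1 - R z * S z d)" for z
  have w: "cmod (R z * S z d) < 1" if "cmod z \<le> 1" for z
  proof -
    have "cmod (R z * S z d) \<le> cmod (R z) * 1"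
      unfolding norm_mult using norm_S_le[OF that] by (intro mult_left_mono) auto
    then show ?thesis using IH(4)[OF that] by simp
  qed
  then have nz: "1 - R z * S z d \<noteq> 0" if "cmod z \<le> 1" for z using that by force
  have [measurable]: "f \<in> borel_measurable borel" unfolding f_def by measurable
  have cont: "continuous_on (cball 0 1) f"
    unfolding f_def using nz by (intro continuous_intros IH continuous_S) auto
  have "(\<integral>z. f z \<partial>circle_measure) = f 0"
    using cont
  proof (rule circle_mean_value[rotated])
    show "f holomorphic_on ball 0 1"
      unfolding f_def using nz by (intro holomorphic_intros IH holomorphic_S) auto
  qed simp
  also have "f 0 = 1" by (simp add: f_def IH(3))
  finally have I: "(\<integral>z. f z \<partial>circle_measure) = 1" .
  have "(\<integral>z. (cmod (\<psi> z (Inl d)))\<^sup>2 \<partial>circle_measure) = (\<integral>z. Re (f z) \<partial>circle_measure)"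
  proof (rule integral_cong_AE)
    show "AE z in circle_measure. (cmod (\<psi> z (Inl d)))\<^sup>2 = Re (f z)"
      using AE_circle_measure
    proof eventually_elim
      case (elim z)
      let ?w = "R z * S z d"
      have n: "1 - ?w \<noteq> 0" using nz elim by simp
      have "\<psi> z (Inl d) = T z / (1 - ?w)" using IH(6)[of z] elim n by (simp add: field_simps)
      then have "(cmod (\<psi> z (Inl d)))\<^sup>2 = (1 - (cmod ?w)\<^sup>2) / (cmod (1 - ?w))\<^sup>2"
        using IH(5)[OF elim] by (simp add: norm_divide power_divide norm_mult norm_S[OF elim])
      also have "\<dots> = Re (f z)"
        unfolding f_def Re_divide cmod_power2 by (simp add: power2_eq_square algebra_simps)
      finally show ?case .
    qed
  qed measurable
  also have "\<dots> = Re (\<integral>z. f z \<partial>circle_measure)"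
  proof (rule integral_Re)
    have "compact (f ` cball 0 1)" by (intro compact_continuous_image cont) simp
    then obtain B where "\<And>z. cmod z \<le> 1 \<Longrightarrow> cmod (f z) \<le> B"
      using compact_imp_bounded bounded_iff by (metis imageI mem_cball_0)
    then show "integrable circle_measure f" by (intro integrable_circle_measure[of _ B]) auto
  qed
  finally show ?thesis using I by simp
qed

lemma wave_normalised:
  assumes "x \<in> box"
  shows "(\<integral>z. (cmod (\<psi> z x))\<^sup>2 \<partial>circle_measure) = 1"
proof (cases x)
  case (Inl d)
  then show ?thesis using wave_normalised_up[of d] assms by (auto simp: box_def)
next
  case (Inr d)
  have "(\<integral>z. (cmod (\<psi> z (Inr d)))\<^sup>2 \<partial>circle_measure) = (\<integral>z. (cmod (\<psi> z (Inl d)))\<^sup>2 \<partial>circle_measure)"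
    by (rule integral_cong_AE)
      (use AE_circle_measure in \<open>auto elim!: eventually_mono simp: wave_Inr norm_mult norm_S q\<close>)
  then show ?thesis using wave_normalised_up[of d] assms Inr by (auto simp: box_def)
qed

text \<open>For |c| = 1 the vector with entry 1 at \<open>x\<close> and \<open>c\<close> at
  \<open>y\<close> has squared norm 2, and the two normalised amplitudes alone already reach
  Bessel's bound. Hence the cross term times any unit \<open>cnj c\<close> has real part at most 0,
  and four choices of \<open>c\<close> make it vanish. Orthonormality in \<open>z\<close> of the
  amplitudes is completeness of the scattering states.\<close>

lemma wave_orthonormal:
  assumes x: "x \<in> box" and y: "y \<in> box"
  shows "(\<integral>z. \<psi> z x * cnj (\<psi> z y) \<partial>circle_measure) = of_bool (x = y)"
proof (cases "x = y")
  case True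
  have "(\<integral>z. \<psi> z x * cnj (\<psi> z x) \<partial>circle_measure) = (\<integral>z. complex_of_real ((cmod (\<psi> z x))\<^sup>2) \<partial>circle_measure)"
    by (simp only: complex_norm_square)
  also have "\<dots> = 1" by (simp only: integral_complex_of_real wave_normalised[OF x] of_real_1)
  finally show ?thesis using True by simp
next
  case False
  let ?I = "\<integral>z. \<psi> z x * cnj (\<psi> z y) \<partial>circle_measure"
  have int: "integrable circle_measure (\<lambda>z. \<psi> z x * cnj (\<psi> z y))" for x y
  proof (rule integrable_circle_measure[of _ "(1 / (1 - r)) ^ D * (1 / (1 - r)) ^ D"])
    show "(\<lambda>z. \<psi> z x * cnj (\<psi> z y)) \<in> borel_measurable borel" by measurable
  qed (use r in \<open>auto simp: norm_mult intro!: mult_mono norm_wave_le\<close>)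
  have int2: "integrable circle_measure (\<lambda>z. (cmod (\<psi> z x))\<^sup>2)" for x
    by (rule integrable_circle_measure[of _ "((1 / (1 - r)) ^ D)\<^sup>2"])
      (auto intro!: power_mono norm_wave_le)
  have key: "Re (cnj c * ?I) \<le> 0" if c: "cmod c = 1" for c
  proof -
    define v where "v u = (if u = x then 1 else if u = y then c else 0)" for u
    have v: "(\<Sum>u\<in>box. v u * \<psi> z u) = \<psi> z x + c * \<psi> z y" for z
    proof -
      have "(\<Sum>u\<in>box. v u * \<psi> z u) = (\<Sum>u\<in>{x, y}. v u * \<psi> z u)"
        using x y finite_box by (intro sum.mono_neutral_right) (auto simp: v_def)
      then show ?thesis using False by (simp add: v_def)
    qed
    have vn: "(\<Sum>u\<in>box. (cmod (v u))\<^sup>2) = 2"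
    proof -
      have "(\<Sum>u\<in>box. (cmod (v u))\<^sup>2) = (\<Sum>u\<in>{x, y}. (cmod (v u))\<^sup>2)"
        using x y finite_box by (intro sum.mono_neutral_right) (auto simp: v_def)
      then show ?thesis using False c by (simp add: v_def)
    qed
    have sq: "(cmod (\<psi> z x + c * \<psi> z y))\<^sup>2 = (cmod (\<psi> z x))\<^sup>2 + (cmod (\<psi> z y))\<^sup>2 + 2 * Re (cnj c * (\<psi> z x * cnj (\<psi> z y)))" for z
    proof -
      have "(cmod (a + b))\<^sup>2 = (cmod a)\<^sup>2 + (cmod b)\<^sup>2 + 2 * Re (a * cnj b)" for a b
        unfolding cmod_power2 by (simp add: power2_eq_square algebra_simps)
      from this[of "\<psi> z x" "c * \<psi> z y"] c show ?thesis by (simp add: norm_mult mult_ac)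
    qed
    have rint: "integrable circle_measure (\<lambda>z. 2 * Re (cnj c * (\<psi> z x * cnj (\<psi> z y))))"
      by (intro integrable_mult_right integrable_Re int)
    have "(\<integral>z. (cmod (\<psi> z x + c * \<psi> z y))\<^sup>2 \<partial>circle_measure)
      = 1 + 1 + 2 * (\<integral>z. Re (cnj c * (\<psi> z x * cnj (\<psi> z y))) \<partial>circle_measure)"
      unfolding sq using int2 rint wave_normalised[OF x] wave_normalised[OF y]
      by (subst Bochner_Integration.integral_add | simp del: times_complex.simps)+
    also have "(\<integral>z. Re (cnj c * (\<psi> z x * cnj (\<psi> z y))) \<partial>circle_measure) = Re (\<integral>z. cnj c * (\<psi> z x * cnj (\<psi> z y)) \<partial>circle_measure)"
      by (intro integral_Re integrable_mult_right int)
    also have "(\<integral>z. cnj c * (\<psi> z x * cnj (\<psi> z y)) \<partial>circle_measure) = cnj c * ?I"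
      by (rule integral_mult_right_zero)
    finally have eq: "(\<integral>z. (cmod (\<psi> z x + c * \<psi> z y))\<^sup>2 \<partial>circle_measure) = 2 + 2 * Re (cnj c * ?I)" by simp
    have "integrable circle_measure (\<lambda>z. (cmod (\<psi> z x + c * \<psi> z y))\<^sup>2)"
      unfolding sq by (intro Bochner_Integration.integrable_add int2 rint)
    then have "ennreal (\<integral>z. (cmod (\<psi> z x + c * \<psi> z y))\<^sup>2 \<partial>circle_measure) \<le> ennreal 2"
      using wave_bessel[of v] unfolding v vn by (subst nn_integral_eq_integral[symmetric]) auto
    then have "(\<integral>z. (cmod (\<psi> z x + c * \<psi> z y))\<^sup>2 \<partial>circle_measure) \<le> 2"
      by (subst (asm) ennreal_le_iff) auto
    then show ?thesis unfolding eq by simp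
  qed
  have "?I = 0"
    using key[of 1] key[of "-1"] key[of \<i>] key[of "-\<i>"] by (simp add: complex_eq_iff)
  then show ?thesis using False by simp
qed

end

text \<open>The walk restricted to the sites from \<open>-L\<close> to \<open>L\<close>, with a reflecting wall at \<open>L\<close>.\<close>

definition box_index :: "int \<Rightarrow> spin \<times> int \<Rightarrow> nat + nat"
  where "box_index L x = (case fst x of Up \<Rightarrow> Inl (nat (L - snd x)) | Down \<Rightarrow> Inr (nat (L - snd x - 1)))"

definition box_wave :: "real \<Rightarrow> real \<Rightarrow> (int \<Rightarrow> torus) \<Rightarrow> int \<Rightarrow> complex \<Rightarrow> spin \<times> int \<Rightarrow> complex"
  where "box_wave r t \<omega> L z x = wave r t (\<lambda>e. phase_Up \<omega> (L - int e - 1)) (\<lambda>e. phase_Down \<omega> (L - int e))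
    (nat (2 * L)) z (box_index L x)"

lemma coord_walk_Up: "coord (walk r t \<omega> \<psi>) (Up, n)
    = phase_Up \<omega> (n - 1) * (of_real t * coord \<psi> (Up, n - 1) - of_real r * coord \<psi> (Down, n - 1))"
  and coord_walk_Down: "coord (walk r t \<omega> \<psi>) (Down, n)
    = phase_Down \<omega> (n + 1) * (of_real r * coord \<psi> (Up, n + 1) + of_real t * coord \<psi> (Down, n + 1))"
  by (simp_all add: walk.rep_eq)

lemma norm_phase [simp]: "cmod (phase_Up \<omega> n) = 1" "cmod (phase_Down \<omega> n) = 1"
  by (simp_all add: phase_Up_def phase_Down_def)

context
  fixes r t :: real and \<omega> :: "int \<Rightarrow> torus" and L :: int
  assumes r: "0 < r" "r < 1" and t: "0 < t" and rt: "r\<^sup>2 + t\<^sup>2 = 1"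
begin

interpretation chain r t "\<lambda>e. phase_Up \<omega> (L - int e - 1)" "\<lambda>e. phase_Down \<omega> (L - int e)" "nat (2 * L)"
  by unfold_locales (use r t rt in auto)

abbreviation "\<Psi> \<equiv> box_wave r t \<omega> L"

lemma box_wave_Up:
  assumes "cmod z \<le> 1" "\<bar>n\<bar> < L"
  shows "\<Psi> z (Up, n) = z * (phase_Up \<omega> (n - 1) * (of_real t * \<Psi> z (Up, n - 1) - of_real r * \<Psi> z (Down, n - 1)))"
proof -
  define d where "d = nat (L - n)"
  have d: "d < nat (2 * L)" using assms by (simp add: d_def)
  have "L - int d - 1 = n - 1" using assms by (simp add: d_def)
  moreover have "nat (L - (n - 1)) = Suc d" "nat (L - (n - 1) - 1) = d" using assms by (auto simp: d_def)
  ultimately show ?thesis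
    using wave_up[OF assms(1) d] by (simp add: box_wave_def box_index_def flip: d_def)
qed

lemma box_wave_Down:
  assumes "cmod z \<le> 1" "\<bar>n\<bar> < L - 1"
  shows "\<Psi> z (Down, n) = z * (phase_Down \<omega> (n + 1) * (of_real r * \<Psi> z (Up, n + 1) + of_real t * \<Psi> z (Down, n + 1)))"
proof -
  define d where "d = nat (L - n - 2)"
  have d: "d < nat (2 * L)" using assms by (auto simp: d_def)
  have "L - int (Suc d) = n + 1" using assms by (simp add: d_def)
  moreover have "nat (L - n - 1) = Suc d" "nat (L - (n + 1)) = Suc d" "nat (L - (n + 1) - 1) = d" using assms by (auto simp: d_def)
  ultimately show ?thesis
    using wave_down[OF assms(1) d] by (simp only: box_wave_def box_index_def fst_conv snd_conv spin.case)
qed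

lemma box_index_in_box: "\<bar>snd x\<bar> < L \<Longrightarrow> box_index L x \<in> box"
  by (cases "fst x") (auto simp: box_index_def box_def)

lemma box_index_eq_iff: "\<bar>snd x\<bar> < L \<Longrightarrow> \<bar>snd y\<bar> < L \<Longrightarrow> box_index L x = box_index L y \<longleftrightarrow> x = y"
  by (cases x; cases y; cases "fst x"; cases "fst y") (auto simp: box_index_def)

lemma measurable_box_wave [measurable]: "(\<lambda>z. \<Psi> z x) \<in> borel_measurable borel"
  unfolding box_wave_def by measurable

lemma box_wave_bound: "cmod z = 1 \<Longrightarrow> cmod (\<Psi> z x) \<le> (1 / (1 - r)) ^ nat (2 * L)"
  unfolding box_wave_def by (rule norm_wave_le) simp

lemma integrable_box_wave: "integrable circle_measure (\<lambda>z. z powi n * \<Psi> z x * cnj (\<Psi> z y))"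
proof (rule integrable_circle_measure)
  show "(\<lambda>z. z powi n * \<Psi> z x * cnj (\<Psi> z y)) \<in> borel_measurable borel" by measurable
  show "norm (z powi n * \<Psi> z x * cnj (\<Psi> z y)) \<le> (1 / (1 - r)) ^ nat (2 * L) * (1 / (1 - r)) ^ nat (2 * L)"
    if "cmod z = 1" for z
    using r by (simp add: norm_mult norm_power_int that) (intro mult_mono box_wave_bound that, auto)
qed

text \<open>The walk moves by one site per unit of time, and only the equation in \<open>x\<close>
  is iterated while \<open>y\<close> stays fixed. All sites reached from \<open>x\<close> lie
  strictly inside the box, where the eigenvalue equation of the cut-off walk is that of the full
  walk.\<close>

lemma walk_power_coord:
  assumes "\<bar>snd x\<bar> + int \<nu> < L - 1" "\<bar>snd y\<bar> < L - 1"
  shows "coord ((walk r t \<omega> ^^ \<nu>) (ket y)) x = (\<integral>z. z powi (- int \<nu>) * \<Psi> z x * cnj (\<Psi> z y) \<partial>circle_measure)"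
  using assms(1)
proof (induction \<nu> arbitrary: x)
  case 0
  have "(\<integral>z. \<Psi> z x * cnj (\<Psi> z y) \<partial>circle_measure) = of_bool (box_index L x = box_index L y)"
    unfolding box_wave_def using 0 assms by (intro wave_orthonormal box_index_in_box) auto
  then show ?case using 0 assms box_index_eq_iff[of x y] by (simp add: ket.rep_eq)
next
  case (Suc \<nu>)
  let ?I = "\<lambda>x. \<integral>z. z powi (- int \<nu>) * \<Psi> z x * cnj (\<Psi> z y) \<partial>circle_measure"
  have comb: "(\<integral>z. z powi (- int (Suc \<nu>)) * \<Psi> z x * cnj (\<Psi> z y) \<partial>circle_measure) = c * (a * ?I x1 + b * ?I x2)"
    if "\<And>z. cmod z = 1 \<Longrightarrow> \<Psi> z x = z * (c * (a * \<Psi> z x1 + b * \<Psi> z x2))" for a b c x1 x2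
  proof -
    have "(\<integral>z. z powi (- int (Suc \<nu>)) * \<Psi> z x * cnj (\<Psi> z y) \<partial>circle_measure)
      = (\<integral>z. c * (a * (z powi (- int \<nu>) * \<Psi> z x1 * cnj (\<Psi> z y)) + b * (z powi (- int \<nu>) * \<Psi> z x2 * cnj (\<Psi> z y))) \<partial>circle_measure)"
    proof (rule integral_cong_AE)
      show "AE z in circle_measure. z powi (- int (Suc \<nu>)) * \<Psi> z x * cnj (\<Psi> z y)
        = c * (a * (z powi (- int \<nu>) * \<Psi> z x1 * cnj (\<Psi> z y)) + b * (z powi (- int \<nu>) * \<Psi> z x2 * cnj (\<Psi> z y)))"
        using AE_circle_measure
      proof eventually_elim
        case (elim z)
        then have "z \<noteq> 0" by auto
        have "- int \<nu> = - int (Suc \<nu>) + 1" by simp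
        then have e: "z powi (- int \<nu>) = z powi (- int (Suc \<nu>)) * z"
          using power_int_add[of z "- int (Suc \<nu>)" 1] \<open>z \<noteq> 0\<close> by (metis power_int_1_right)
        show ?case unfolding that[OF elim] e by (simp add: algebra_simps)
      qed
    qed measurable
    also have "\<dots> = c * (a * ?I x1 + b * ?I x2)"
      by (simp only: integral_mult_right_zero Bochner_Integration.integral_add[OF integrable_mult_right[OF integrable_box_wave] integrable_mult_right[OF integrable_box_wave]])
    finally show ?thesis .
  qed
  obtain \<sigma> n where x: "x = (\<sigma>, n)" by force
  show ?case
  proof (cases \<sigma>)
    case Up
    have "coord ((walk r t \<omega> ^^ Suc \<nu>) (ket y)) x
      = phase_Up \<omega> (n - 1) * (of_real t * ?I (Up, n - 1) + (- of_real r) * ?I (Down, n - 1))"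
      using Suc.prems by (simp add: x Up coord_walk_Up Suc.IH)
    also have "\<dots> = (\<integral>z. z powi (- int (Suc \<nu>)) * \<Psi> z x * cnj (\<Psi> z y) \<partial>circle_measure)"
    proof (rule comb[symmetric])
      fix z :: complex assume "cmod z = 1"
      then show "\<Psi> z x = z * (phase_Up \<omega> (n - 1) * (of_real t * \<Psi> z (Up, n - 1) + (- of_real r) * \<Psi> z (Down, n - 1)))"
        using box_wave_Up[of z n] Suc.prems by (simp add: x Up)
    qed
    finally show ?thesis .
  next
    case Down
    have "coord ((walk r t \<omega> ^^ Suc \<nu>) (ket y)) x
      = phase_Down \<omega> (n + 1) * (of_real r * ?I (Up, n + 1) + of_real t * ?I (Down, n + 1))"
      using Suc.prems by (simp add: x Down coord_walk_Down Suc.IH)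
    also have "\<dots> = (\<integral>z. z powi (- int (Suc \<nu>)) * \<Psi> z x * cnj (\<Psi> z y) \<partial>circle_measure)"
    proof (rule comb[symmetric])
      fix z :: complex assume "cmod z = 1"
      then show "\<Psi> z x = z * (phase_Down \<omega> (n + 1) * (of_real r * \<Psi> z (Up, n + 1) + of_real t * \<Psi> z (Down, n + 1)))"
        using box_wave_Down[of z n] Suc.prems by (simp add: x Down)
    qed
    finally show ?thesis .
  qed
qed

lemma unitary_walk': "unitary (walk r t \<omega>)"
  by (rule unitary_walk[OF rt])

lemma walk_upow_coord:
  assumes "\<bar>snd x\<bar> + \<bar>n\<bar> < L - 1" "\<bar>snd y\<bar> + \<bar>n\<bar> < L - 1"
  shows "cinner (ket x) (upow (walk r t \<omega>) n (ket y)) = (\<integral>z. z powi (- n) * \<Psi> z x * cnj (\<Psi> z y) \<partial>circle_measure)"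
proof (cases "0 \<le> n")
  case True
  then show ?thesis using walk_power_coord[of x "nat n" y] assms
    by (simp add: cinner_ket_left upow_def)
next
  case False
  then have n: "int (nat (- n)) = - n" by simp
  have "cinner (ket x) (upow (walk r t \<omega>) n (ket y)) = cnj (cinner (ket y) (upow (walk r t \<omega>) (- n) (ket x)))"
    using upow_adj[OF unitary_walk', of "- n" "ket x" "ket y"] by (metis cinner_commute minus_minus)
  also have "cinner (ket y) (upow (walk r t \<omega>) (- n) (ket x)) = (\<integral>z. z powi n * \<Psi> z y * cnj (\<Psi> z x) \<partial>circle_measure)"
    using walk_power_coord[of y "nat (- n)" x] False assms by (simp add: cinner_ket_left upow_def n)
  also have "cnj \<dots> = (\<integral>z. cnj (z powi n * \<Psi> z y * cnj (\<Psi> z x)) \<partial>circle_measure)"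
    by (rule Bochner_Integration.integral_cnj[symmetric])
  also have "\<dots> = (\<integral>z. z powi (- n) * \<Psi> z x * cnj (\<Psi> z y) \<partial>circle_measure)"
  proof (rule integral_cong_AE)
    show "AE z in circle_measure. cnj (z powi n * \<Psi> z y * cnj (\<Psi> z x)) = z powi (- n) * \<Psi> z x * cnj (\<Psi> z y)"
      using AE_circle_measure
    proof eventually_elim
      case (elim z)
      have "cnj z = inverse z" using elim by (rule cnj_eq_inverse)
      then have "cnj (z powi n) = z powi (- n)" by (simp add: power_int_minus power_int_inverse)
      then show ?case by (simp add: mult_ac)
    qed
  qed measurable
  finally show ?thesis .
qed

text \<open>The scattering state at \<open>z\<close> has eigenvalue 1/z, which is why the polynomial
  is evaluated at \<open>inverse z\<close>. Bounding it by 1 under the integral removes the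
  polynomial from the estimate.\<close>

lemma norm_laurent_op_walk_le:
  assumes dist: "\<And>c n. (c, n) \<in> set xs \<Longrightarrow> \<bar>snd x\<bar> + \<bar>n\<bar> < L - 1 \<and> \<bar>snd y\<bar> + \<bar>n\<bar> < L - 1"
    and le1: "\<And>z. cmod z = 1 \<Longrightarrow> cmod (laurent_eval xs z) \<le> 1"
  shows "ennreal (cmod (cinner (ket x) (laurent_op (walk r t \<omega>) xs (ket y))))
    \<le> (\<integral>\<^sup>+z. ennreal (cmod (\<Psi> z x) * cmod (\<Psi> z y)) \<partial>circle_measure)"
proof -
  have int: "integrable circle_measure (\<lambda>z. laurent_eval ys (inverse z) * \<Psi> z x * cnj (\<Psi> z y))" for ys
  proof (induction ys)
    case (Cons u ys)
    obtain c n where u: "u = (c, n)" by force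
    have "laurent_eval (u # ys) (inverse z) * \<Psi> z x * cnj (\<Psi> z y)
      = c * (z powi (- n) * \<Psi> z x * cnj (\<Psi> z y)) + laurent_eval ys (inverse z) * \<Psi> z x * cnj (\<Psi> z y)" for z
      by (simp add: u power_int_minus power_int_inverse algebra_simps)
    then show ?case by (simp only:) (intro Bochner_Integration.integrable_add integrable_mult_right integrable_box_wave Cons)
  qed simp
  have "cinner (ket x) (laurent_op (walk r t \<omega>) xs (ket y)) = (\<integral>z. laurent_eval xs (inverse z) * \<Psi> z x * cnj (\<Psi> z y) \<partial>circle_measure)"
    using dist
  proof (induction xs)
    case (Cons u ys)
    obtain c n where u: "u = (c, n)" by force
    have "(\<integral>z. laurent_eval (u # ys) (inverse z) * \<Psi> z x * cnj (\<Psi> z y) \<partial>circle_measure)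
      = (\<integral>z. c * (z powi (- n) * \<Psi> z x * cnj (\<Psi> z y)) + laurent_eval ys (inverse z) * \<Psi> z x * cnj (\<Psi> z y) \<partial>circle_measure)"
      by (intro Bochner_Integration.integral_cong refl) (simp add: u power_int_minus power_int_inverse algebra_simps)
    also have "\<dots> = c * (\<integral>z. z powi (- n) * \<Psi> z x * cnj (\<Psi> z y) \<partial>circle_measure)
      + (\<integral>z. laurent_eval ys (inverse z) * \<Psi> z x * cnj (\<Psi> z y) \<partial>circle_measure)"
      by (simp only: integral_mult_right_zero Bochner_Integration.integral_add[OF integrable_mult_right[OF integrable_box_wave] int])
    also have "(\<integral>z. z powi (- n) * \<Psi> z x * cnj (\<Psi> z y) \<partial>circle_measure) = cinner (ket x) (upow (walk r t \<omega>) n (ket y))"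
      using Cons.prems[of c n] by (intro walk_upow_coord[symmetric]) (auto simp: u)
    also have "(\<integral>z. laurent_eval ys (inverse z) * \<Psi> z x * cnj (\<Psi> z y) \<partial>circle_measure) = cinner (ket x) (laurent_op (walk r t \<omega>) ys (ket y))"
      using Cons.prems by (intro Cons.IH[symmetric]) auto
    finally show ?case by (simp add: u cinner_add_right cinner_scaleC_right)
  qed simp
  then have "ennreal (cmod (cinner (ket x) (laurent_op (walk r t \<omega>) xs (ket y))))
    \<le> (\<integral>\<^sup>+z. ennreal (cmod (laurent_eval xs (inverse z) * \<Psi> z x * cnj (\<Psi> z y))) \<partial>circle_measure)"
    using integral_norm_bound_ennreal[OF int] by simp
  also have "\<dots> \<le> (\<integral>\<^sup>+z. ennreal (cmod (\<Psi> z x) * cmod (\<Psi> z y)) \<partial>circle_measure)"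
  proof (rule nn_integral_mono_AE)
    show "AE z in circle_measure. ennreal (cmod (laurent_eval xs (inverse z) * \<Psi> z x * cnj (\<Psi> z y))) \<le> ennreal (cmod (\<Psi> z x) * cmod (\<Psi> z y))"
      using AE_circle_measure
    proof eventually_elim
      case (elim z)
      have "cmod (laurent_eval xs (inverse z)) \<le> 1" using elim by (intro le1) (simp add: norm_inverse)
      then have "cmod (laurent_eval xs (inverse z)) * (cmod (\<Psi> z x) * cmod (\<Psi> z y)) \<le> cmod (\<Psi> z x) * cmod (\<Psi> z y)"
        by (intro mult_left_le_one_le) auto
      then show ?case by (intro ennreal_leI) (simp add: norm_mult mult_ac)
    qed
  qed
  finally show ?thesis .
qed

end

section \<open>Operators on functions on the circle\<close>

abbreviation mean :: "(complex \<Rightarrow> real) \<Rightarrow> real"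
  where "mean f \<equiv> \<integral>z. f z \<partial>circle_measure"

abbreviation sqnorm :: "(complex \<Rightarrow> real) \<Rightarrow> real"
  where "sqnorm f \<equiv> \<integral>z. (f z)\<^sup>2 \<partial>circle_measure"

text \<open>Cut off outside the circle to be bounded on the whole plane, since the quotient blows up
  near -1/r. Only the values on the circle matter.\<close>

definition kap :: "real \<Rightarrow> real \<Rightarrow> complex \<Rightarrow> real"
  where "kap r t z = indicator (sphere 0 1) z * (t / cmod (1 + of_real r * z))"

lemma measurable_kap [measurable]: "kap r t \<in> borel_measurable borel"
proof -
  have [measurable]: "sphere (0::complex) 1 \<in> sets borel" by (intro borel_closed) simp
  show ?thesis unfolding kap_def[abs_def] by measurable
qed

lemma kap_circle: "cmod z = 1 \<Longrightarrow> kap r t z = t / cmod (1 + of_real r * z)"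
  by (simp add: kap_def)

lemma kap_nonneg: "0 < t \<Longrightarrow> 0 \<le> kap r t z"
  by (simp add: kap_def)

lemma kap_le:
  assumes "0 < r" "r < 1" "0 < t"
  shows "kap r t z \<le> t / (1 - r)"
proof (cases "cmod z = 1")
  case True
  then show ?thesis using one_plus_ry_bound[of r z] assms by (simp add: kap_circle frac_le)
qed (use assms in \<open>simp add: kap_def\<close>)

text \<open>\<open>kap\<^sup>2\<close> is the modulus of the derivative of the Moebius map \<open>mob\<close> on the circle.\<close>

lemma nn_integral_mob:
  assumes r: "0 < r" "r < 1" and t: "0 < t" and rt: "r\<^sup>2 + t\<^sup>2 = 1" and A[measurable]: "A \<in> sets borel"
  shows "(\<integral>\<^sup>+z. ennreal ((kap r t z)\<^sup>2) * indicator A (mob r z) \<partial>circle_measure) = emeasure circle_measure A"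
proof -
  define Q where "Q \<theta> = 1 + of_real r * cis \<theta>" for \<theta>
  \<comment> \<open>On the circle the Moebius map sends z to z * cnj Q / Q, so its angle is \<theta>
    - 2 arg Q. As Q has positive real part, the principal logarithm gives a smooth lift, to which
    one-dimensional substitution applies.\<close>
  define g where "g \<theta> = \<theta> - 2 * Im (Ln (Q \<theta>))" for \<theta>
  define g' where "g' \<theta> = (kap r t (cis \<theta>))\<^sup>2" for \<theta>
  have Qpos: "0 < Re (Q \<theta>)" for \<theta>
  proof -
    have "- cos \<theta> * r \<le> 1 * r" using r by (intro mult_right_mono) (auto intro: cos_ge_minus_one simp: minus_le_iff)
    then show ?thesis using r by (simp add: Q_def mult.commute)
  qed
  then have Qn: "Q \<theta> \<notin> \<real>\<^sub>\<le>\<^sub>0" "Q \<theta> \<noteq> 0" for \<theta>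
    using complex_nonpos_Reals_iff by (metis not_le, metis less_irrefl zero_complex.sel(1))
  have g'_eq: "g' \<theta> = t\<^sup>2 / (cmod (Q \<theta>))\<^sup>2" for \<theta>
    by (simp add: g'_def kap_circle power_divide Q_def)
  have deriv: "(g has_real_derivative g' \<theta>) (at \<theta>)" for \<theta>
  proof -
    have "(Q has_vector_derivative of_real r * (\<i> * cis \<theta>)) (at \<theta>)"
      unfolding Q_def has_vector_derivative_def
      by (auto intro!: derivative_eq_intros simp: scaleR_conv_of_real algebra_simps fun_eq_iff)
    then have "((Ln \<circ> Q) has_vector_derivative (of_real r * (\<i> * cis \<theta>)) * inverse (Q \<theta>)) (at \<theta>)"
      by (rule field_vector_diff_chain_at) (rule has_field_derivative_Ln[OF Qn(1)])
    then have "((\<lambda>\<theta>. Im ((Ln \<circ> Q) \<theta>)) has_vector_derivative Im ((of_real r * (\<i> * cis \<theta>)) * inverse (Q \<theta>))) (at \<theta>)"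
      by (rule bounded_linear.has_vector_derivative[OF bounded_linear_Im])
    then have "((\<lambda>\<theta>. Im (Ln (Q \<theta>))) has_real_derivative Im ((of_real r * (\<i> * cis \<theta>)) * inverse (Q \<theta>))) (at \<theta>)"
      by (simp add: has_real_derivative_iff_has_vector_derivative)
    from DERIV_diff[OF DERIV_ident DERIV_cmult[OF this, of 2]]
    have "(g has_real_derivative (1 - 2 * Im ((of_real r * (\<i> * cis \<theta>)) * inverse (Q \<theta>)))) (at \<theta>)"
      unfolding g_def .
    also have "1 - 2 * Im ((of_real r * (\<i> * cis \<theta>)) * inverse (Q \<theta>)) = g' \<theta>"
    proof -
      have n: "(cmod (Q \<theta>))\<^sup>2 = 1 + 2 * r * cos \<theta> + r\<^sup>2"
      proof -
        have "(1 + r * x)\<^sup>2 + (r * y)\<^sup>2 = 1 + 2 * r * x + r\<^sup>2 * (x\<^sup>2 + y\<^sup>2)" for x y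
          by (simp add: power2_eq_square algebra_simps)
        from this[of "cos \<theta>" "sin \<theta>"] show ?thesis
          unfolding cmod_power2 by (simp add: Q_def)
      qed
      have "Im ((of_real r * (\<i> * cis \<theta>)) * inverse (Q \<theta>)) = Im ((of_real r * (\<i> * cis \<theta>)) * cnj (Q \<theta>)) / (cmod (Q \<theta>))\<^sup>2"
      proof -
        have inv: "inverse (Q \<theta>) = cnj (Q \<theta>) / of_real ((cmod (Q \<theta>))\<^sup>2)"
          by (simp only: inverse_eq_divide complex_div_cnj[of 1] mult_1_left of_real_power)
        show ?thesis unfolding inv times_divide_eq_right Im_divide_of_real ..
      qed
      also have "(of_real r * (\<i> * cis \<theta>)) * cnj (Q \<theta>) = of_real r * \<i> * cis \<theta> + of_real (r\<^sup>2) * \<i> * (cis \<theta> * cis (- \<theta>))"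
        by (simp add: Q_def cis_cnj power2_eq_square algebra_simps)
      also have "Im \<dots> = r * cos \<theta> + r\<^sup>2" by (simp add: cis_mult)
      finally have "1 - 2 * Im ((of_real r * (\<i> * cis \<theta>)) * inverse (Q \<theta>)) = ((cmod (Q \<theta>))\<^sup>2 - 2 * (r * cos \<theta> + r\<^sup>2)) / (cmod (Q \<theta>))\<^sup>2"
        using Qn(2)[of \<theta>] by (simp add: diff_divide_distrib)
      also have "(cmod (Q \<theta>))\<^sup>2 - 2 * (r * cos \<theta> + r\<^sup>2) = t\<^sup>2"
        unfolding n using rt by (simp add: algebra_simps)
      finally show ?thesis by (simp add: g'_eq)
    qed
    finally show ?thesis .
  qed
  have cis_g: "cis (g \<theta>) = mob r (cis \<theta>)" for \<theta>
  proof -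
    have "\<i> * of_real (Im (Ln (Q \<theta>))) = Ln (Q \<theta>) - of_real (ln (cmod (Q \<theta>)))"
      using Qn(2)[of \<theta>] by (simp add: complex_eq_iff)
    then have e: "exp (\<i> * of_real (Im (Ln (Q \<theta>)))) = Q \<theta> / of_real (cmod (Q \<theta>))"
      using Qn(2)[of \<theta>] by (simp only: exp_diff exp_Ln exp_of_real) simp
    have "cis (g \<theta>) = cis \<theta> / (exp (\<i> * of_real (Im (Ln (Q \<theta>)))))\<^sup>2"
      by (simp add: g_def cis_conv_exp exp_diff exp_double algebra_simps power2_eq_square mult_exp_exp)
    also have "\<dots> = cis \<theta> * ((of_real (cmod (Q \<theta>)))\<^sup>2 / (Q \<theta>)\<^sup>2)"
      unfolding e by (simp add: power_divide)
    also have "(complex_of_real (cmod (Q \<theta>)))\<^sup>2 = Q \<theta> * cnj (Q \<theta>)"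
      by (metis complex_norm_square of_real_power)
    also have "cis \<theta> * (Q \<theta> * cnj (Q \<theta>) / (Q \<theta>)\<^sup>2) = (cis \<theta> * cnj (Q \<theta>)) / Q \<theta>"
      using Qn(2)[of \<theta>] by (simp add: power2_eq_square)
    also have "cis \<theta> * cnj (Q \<theta>) = of_real r + cis \<theta>"
      by (simp add: Q_def algebra_simps cis_mult cis_cnj)
    finally show ?thesis by (simp add: mob_def Q_def)
  qed
  have ends: "g 0 = 0" "g (2 * pi) = 2 * pi"
  proof -
    have "Q 0 = of_real (1 + r)" "Q (2 * pi) = of_real (1 + r)" by (simp_all add: Q_def)
    moreover have "Im (Ln (of_real (1 + r))) = 0" using r by (subst Ln_of_real) auto
    ultimately show "g 0 = 0" "g (2 * pi) = 2 * pi" by (simp_all add: g_def)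
  qed
  define F where "F \<theta> = indicat_real A (cis \<theta>)" for \<theta>
  have [measurable]: "F \<in> borel_measurable borel" unfolding F_def by measurable
  have contg': "continuous_on {0..2*pi} g'"
    unfolding g'_eq[abs_def] using Qn(2) unfolding Q_def by (intro continuous_intros) auto
  have swap: "(\<integral>\<^sup>+\<theta>. h \<theta> * indicator {0..2*pi} \<theta> \<partial>lborel) = (\<integral>\<^sup>+\<theta>\<in>{0..<2*pi}. h \<theta> \<partial>lborel)" for h :: "real \<Rightarrow> ennreal"
    by (rule nn_integral_cong_AE) (use AE_lborel_singleton[of "2*pi"] in \<open>auto elim!: eventually_mono split: split_indicator\<close>)
  have "(\<integral>\<^sup>+x. F x * indicator {g 0..g (2*pi)} x \<partial>lborel) = (\<integral>\<^sup>+x. F (g x) * g' x * indicator {0..2*pi} x \<partial>lborel)"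
    by (rule nn_integral_substitution[OF _ deriv contg'])
      (auto simp: set_borel_measurable_def g'_def)
  then have sub: "(\<integral>\<^sup>+x. ennreal (F x) * indicator {0..2*pi} x \<partial>lborel) = (\<integral>\<^sup>+x. ennreal (F (g x) * g' x) * indicator {0..2*pi} x \<partial>lborel)"
    by (simp add: ends ennreal_mult' ennreal_indicator[symmetric] F_def g'_def del: ennreal_indicator)
  have [measurable]: "(\<lambda>z. ennreal ((kap r t z)\<^sup>2) * indicator A (mob r z)) \<in> borel_measurable borel" by measurable
  have "(\<integral>\<^sup>+z. ennreal ((kap r t z)\<^sup>2) * indicator A (mob r z) \<partial>circle_measure)
    = ennreal (1 / (2*pi)) * (\<integral>\<^sup>+\<theta>\<in>{0..<2*pi}. ennreal ((kap r t (cis \<theta>))\<^sup>2) * indicator A (mob r (cis \<theta>)) \<partial>lborel)"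
    by (rule nn_integral_circle_measure) measurable
  also have "(\<integral>\<^sup>+\<theta>\<in>{0..<2*pi}. ennreal ((kap r t (cis \<theta>))\<^sup>2) * indicator A (mob r (cis \<theta>)) \<partial>lborel)
    = (\<integral>\<^sup>+\<theta>\<in>{0..<2*pi}. ennreal (F (g \<theta>) * g' \<theta>) \<partial>lborel)"
    by (intro nn_integral_cong) (auto simp: F_def g'_def cis_g split: split_indicator)
  also have "\<dots> = (\<integral>\<^sup>+\<theta>\<in>{0..<2*pi}. ennreal (F \<theta>) \<partial>lborel)"
    using sub unfolding swap by simp
  also have "ennreal (1 / (2*pi)) * \<dots> = (\<integral>\<^sup>+z. indicator A z \<partial>circle_measure)"
    by (subst nn_integral_circle_measure) (auto simp: F_def ennreal_indicator)
  finally show ?thesis by simp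
qed

lemma mob_preserves_circle_measure:
  assumes "0 < r" "r < 1" "0 < t" "r\<^sup>2 + t\<^sup>2 = 1"
  shows "distr (density circle_measure (\<lambda>z. ennreal ((kap r t z)\<^sup>2))) borel (mob r) = circle_measure"
proof (rule measure_eqI)
  fix A assume "A \<in> sets (distr (density circle_measure (\<lambda>z. ennreal ((kap r t z)\<^sup>2))) borel (mob r))"
  then have [measurable]: "A \<in> sets borel" by simp
  have "emeasure (distr (density circle_measure (\<lambda>z. ennreal ((kap r t z)\<^sup>2))) borel (mob r)) A
    = (\<integral>\<^sup>+z. indicator A z \<partial>(distr (density circle_measure (\<lambda>z. ennreal ((kap r t z)\<^sup>2))) borel (mob r)))"
    by simp
  also have "\<dots> = (\<integral>\<^sup>+z. ennreal ((kap r t z)\<^sup>2) * indicator A (mob r z) \<partial>circle_measure)"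
    by (subst nn_integral_distr, (measurable)[2], subst nn_integral_density) measurable
  finally show "emeasure (distr (density circle_measure (\<lambda>z. ennreal ((kap r t z)\<^sup>2))) borel (mob r)) A = emeasure circle_measure A"
    by (simp add: nn_integral_mob[OF assms])
qed simp

lemma integral_mob:
  fixes f :: "complex \<Rightarrow> real"
  assumes "0 < r" "r < 1" "0 < t" "r\<^sup>2 + t\<^sup>2 = 1" and [measurable]: "f \<in> borel_measurable borel"
  shows "(\<integral>z. (kap r t z)\<^sup>2 * f (mob r z) \<partial>circle_measure) = mean f"
proof -
  have "mean f = (\<integral>z. f z \<partial>(distr (density circle_measure (\<lambda>z. ennreal ((kap r t z)\<^sup>2))) borel (mob r)))"
    by (simp only: mob_preserves_circle_measure[OF assms(1-4)])
  also have "\<dots> = (\<integral>z. (kap r t z)\<^sup>2 * f (mob r z) \<partial>circle_measure)"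
    by (subst integral_distr, (measurable)[2], subst integral_density) auto
  finally show ?thesis by simp
qed

text \<open>Bounded Borel functions on the plane stand in for $L^2$ of the circle: all integrals
  exist, and the functions keep the pointwise values that are later needed at reflection
  coefficients.\<close>

definition bounded_measurable :: "(complex \<Rightarrow> real) \<Rightarrow> bool"
  where "bounded_measurable f \<longleftrightarrow> f \<in> borel_measurable borel \<and> (\<exists>M. \<forall>z. \<bar>f z\<bar> \<le> M)"

lemma bounded_measurable_measurable : "bounded_measurable f \<Longrightarrow> f \<in> borel_measurable borel"
  by (simp add: bounded_measurable_def)

lemma bounded_measurable_bound:
  assumes "bounded_measurable f" obtains M where "0 \<le> M" "\<And>z. \<bar>f z\<bar> \<le> M"
  using assms unfolding bounded_measurable_def by (meson abs_ge_zero order_trans)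

lemma bounded_measurable_integrable:
  assumes "bounded_measurable f" shows "integrable circle_measure f"
proof -
  obtain M where "\<And>z. \<bar>f z\<bar> \<le> M" using bounded_measurable_bound[OF assms] by blast
  then show ?thesis
    by (intro integrable_circle_measure[of _ M] bounded_measurable_measurable[OF assms]) auto
qed

lemma bounded_measurable_const [intro, simp]: "bounded_measurable (\<lambda>z. c)"
  by (auto simp: bounded_measurable_def)

lemma bounded_measurable_add [intro]:
  assumes "bounded_measurable f" "bounded_measurable g" shows "bounded_measurable (\<lambda>z. f z + g z)"
proof -
  obtain M where "\<And>z. \<bar>f z\<bar> \<le> M" using bounded_measurable_bound[OF assms(1)] by blast
  moreover obtain N where "\<And>z. \<bar>g z\<bar> \<le> N" using bounded_measurable_bound[OF assms(2)] by blast
  ultimately have "\<bar>f z + g z\<bar> \<le> M + N" for z by (meson abs_triangle_ineq add_mono order_trans)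
  then show ?thesis using assms unfolding bounded_measurable_def by auto
qed

lemma bounded_measurable_mult [intro]:
  assumes "bounded_measurable f" "bounded_measurable g" shows "bounded_measurable (\<lambda>z. f z * g z)"
proof -
  obtain M where "0 \<le> M" "\<And>z. \<bar>f z\<bar> \<le> M" using bounded_measurable_bound[OF assms(1)] by blast
  moreover obtain N where "0 \<le> N" "\<And>z. \<bar>g z\<bar> \<le> N" using bounded_measurable_bound[OF assms(2)] by blast
  ultimately have "\<bar>f z * g z\<bar> \<le> M * N" for z by (auto simp: abs_mult intro!: mult_mono)
  then show ?thesis using assms unfolding bounded_measurable_def by auto
qed

lemma bounded_measurable_diff [intro]:
  assumes "bounded_measurable f" "bounded_measurable g" shows "bounded_measurable (\<lambda>z. f z - g z)"
  using bounded_measurable_add[OF assms(1) bounded_measurable_mult[OF bounded_measurable_const[of "-1"] assms(2)]] by simp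

lemma bounded_measurable_power2 [intro]:
  assumes "bounded_measurable f" shows "bounded_measurable (\<lambda>z. (f z)\<^sup>2)"
  using bounded_measurable_mult[OF assms assms] by (simp add: power2_eq_square)

lemma bounded_measurable_comp:
  assumes f: "bounded_measurable f" and [measurable]: "g \<in> borel_measurable borel"
  shows "bounded_measurable (\<lambda>z. f (g z))"
proof -
  note [measurable] = bounded_measurable_measurable[OF f]
  obtain M where "\<And>z. \<bar>f z\<bar> \<le> M" using bounded_measurable_bound[OF f] by blast
  then show ?thesis unfolding bounded_measurable_def by auto
qed

lemma bounded_measurable_rotate: "bounded_measurable f \<Longrightarrow> bounded_measurable (\<lambda>z. f (c * z))"
  by (rule bounded_measurable_comp[of f "\<lambda>z. c * z"]) auto

lemma bounded_measurable_sum [intro]: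
  "(\<And>i. i \<in> I \<Longrightarrow> bounded_measurable (f i)) \<Longrightarrow> bounded_measurable (\<lambda>z. \<Sum>i\<in>I. f i z)"
  by (induction I rule: infinite_finite_induct) auto

lemma measure_circle_measure [simp]: "measure circle_measure UNIV = 1"
  using circle.prob_space by simp

lemma bounded_measurable_kap:
  assumes "0 < r" "r < 1" "0 < t" shows "bounded_measurable (kap r t)"
  unfolding bounded_measurable_def using kap_le[OF assms] kap_nonneg[OF assms(3)] by auto

definition Kop :: "complex measure \<Rightarrow> (complex \<Rightarrow> real) \<Rightarrow> complex \<Rightarrow> real"
  where "Kop m f z = (\<integral>u. f (u * z) \<partial>m)"

text \<open>Composition with the Moebius map, weighted by the square root of its Jacobian so as to
  preserve the $L^2$ norm.\<close>

definition Vop :: "real \<Rightarrow> real \<Rightarrow> (complex \<Rightarrow> real) \<Rightarrow> complex \<Rightarrow> real"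
  where "Vop r t f z = kap r t z * f (mob r z)"

lemma bounded_measurable_Vop [intro]:
  assumes "0 < r" "r < 1" "0 < t" "bounded_measurable f" shows "bounded_measurable (Vop r t f)"
  unfolding Vop_def[abs_def] using assms
  by (intro bounded_measurable_mult bounded_measurable_kap bounded_measurable_comp[OF assms(4)]) auto

lemma norm_Vop:
  assumes "0 < r" "r < 1" "0 < t" "r\<^sup>2 + t\<^sup>2 = 1" "bounded_measurable f"
  shows "sqnorm (Vop r t f) = sqnorm f"
  unfolding Vop_def power_mult_distrib
  by (rule integral_mob[OF assms(1-4)]) (rule bounded_measurable_measurable[OF bounded_measurable_power2[OF assms(5)]])

definition Dist2 :: "(complex \<Rightarrow> real) \<Rightarrow> complex \<Rightarrow> real"
  where "Dist2 f w = (\<integral>z. (f (w * z) - f z)\<^sup>2 \<partial>circle_measure)"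

lemma Dist2_nonneg: "0 \<le> Dist2 f w"
  by (simp add: Dist2_def)

lemma Dist2_eq:
  assumes f: "bounded_measurable f" and u: "cmod u = 1" and v: "cmod v = 1"
  shows "Dist2 f (u * cnj v) = 2 * sqnorm f - 2 * (\<integral>z. f (u * z) * f (v * z) \<partial>circle_measure)"
proof -
  note [measurable] = bounded_measurable_measurable[OF f]
  have vv: "u * cnj v * (v * z) = u * z" for z
  proof -
    have "cnj v * v = 1" using v by (metis complex_norm_square mult.commute of_real_1 one_power2)
    then show ?thesis by (metis mult.assoc mult.left_commute mult_1_left)
  qed
  have "Dist2 f (u * cnj v) = (\<integral>z. (f (u * cnj v * (v * z)) - f (v * z))\<^sup>2 \<partial>circle_measure)"
    unfolding Dist2_def by (rule integral_circle_rotate[OF v, symmetric]) measurable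
  also have "\<dots> = (\<integral>z. (f (u * z))\<^sup>2 + (f (v * z))\<^sup>2 - 2 * (f (u * z) * f (v * z)) \<partial>circle_measure)"
    unfolding vv by (simp add: power2_diff mult.assoc)
  also have "\<dots> = (\<integral>z. (f (u * z))\<^sup>2 \<partial>circle_measure) + (\<integral>z. (f (v * z))\<^sup>2 \<partial>circle_measure)
      - 2 * (\<integral>z. f (u * z) * f (v * z) \<partial>circle_measure)"
  proof -
    have i: "integrable circle_measure (\<lambda>z. (f (u * z))\<^sup>2)" "integrable circle_measure (\<lambda>z. (f (v * z))\<^sup>2)"
      "integrable circle_measure (\<lambda>z. 2 * (f (u * z) * f (v * z)))"
      by (intro bounded_measurable_integrable bounded_measurable_power2 bounded_measurable_rotate[OF f]
        bounded_measurable_mult[OF bounded_measurable_const bounded_measurable_mult[OF bounded_measurable_rotate[OF f] bounded_measurable_rotate[OF f]]])+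
    show ?thesis
      unfolding Bochner_Integration.integral_diff[OF Bochner_Integration.integrable_add[OF i(1,2)] i(3)]
        Bochner_Integration.integral_add[OF i(1,2)] by simp
  qed
  also have "(\<integral>z. (f (u * z))\<^sup>2 \<partial>circle_measure) = sqnorm f"
    by (rule integral_circle_rotate[OF u, of "\<lambda>z. (f z)\<^sup>2"]) measurable
  also have "(\<integral>z. (f (v * z))\<^sup>2 \<partial>circle_measure) = sqnorm f"
    by (rule integral_circle_rotate[OF v, of "\<lambda>z. (f z)\<^sup>2"]) measurable
  finally show ?thesis by simp
qed

text \<open>Telescoping along the powers of \<open>w\<close>: by rotation invariance all
  \<open>k\<close> increments have the same norm, and Cauchy-Schwarz gives the factor
  \<open>k\<close> a second time.\<close>

lemma Dist2_power:
  assumes f: "bounded_measurable f" and w: "cmod w = 1"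
  shows "Dist2 f (w ^ k) \<le> (real k)\<^sup>2 * Dist2 f w"
proof -
  note [measurable] = bounded_measurable_measurable[OF f]
  define a where "a i z = f (w ^ Suc i * z) - f (w ^ i * z)" for i z
  have bma: "bounded_measurable (\<lambda>z. (a i z)\<^sup>2)" for i
    unfolding a_def by (intro bounded_measurable_power2 bounded_measurable_diff bounded_measurable_rotate[OF f])
  have "(f (w ^ k * z) - f z)\<^sup>2 \<le> real k * (\<Sum>i<k. (a i z)\<^sup>2)" for z
  proof -
    have "f (w ^ k * z) - f z = (\<Sum>i<k. a i z)"
      unfolding a_def using sum_lessThan_telescope[of "\<lambda>i. f (w ^ i * z)" k] by simp
    also have "\<dots>\<^sup>2 \<le> (\<Sum>i<k. (a i z)\<^sup>2) * real (card {..<k})"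
      by (rule sum_squared_le_sum_of_squares)
    finally show ?thesis by (simp add: mult.commute)
  qed
  then have "Dist2 f (w ^ k) \<le> (\<integral>z. real k * (\<Sum>i<k. (a i z)\<^sup>2) \<partial>circle_measure)"
    unfolding Dist2_def
    by (intro integral_mono bounded_measurable_integrable
      bounded_measurable_power2[OF bounded_measurable_diff[OF bounded_measurable_rotate[OF f] f]]
      bounded_measurable_mult[OF bounded_measurable_const bounded_measurable_sum[OF bma]])
  also have "\<dots> = real k * (\<Sum>i<k. sqnorm (a i))"
    by (simp only: integral_mult_right_zero Bochner_Integration.integral_sum[OF bounded_measurable_integrable[OF bma]])
  also have "(\<Sum>i<k. sqnorm (a i)) = (\<Sum>i<k. Dist2 f w)"
  proof (rule sum.cong[OF refl])
    fix i
    have "sqnorm (a i) = (\<integral>z. (f (w * (w ^ i * z)) - f (w ^ i * z))\<^sup>2 \<partial>circle_measure)"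
      by (simp add: a_def mult.assoc)
    also have "\<dots> = Dist2 f w"
      unfolding Dist2_def
    proof (rule integral_circle_rotate[of "w ^ i" "\<lambda>z. (f (w * z) - f z)\<^sup>2"])
      show "cmod (w ^ i) = 1" by (simp add: norm_power w)
    qed measurable
    finally show "sqnorm (a i) = Dist2 f w" .
  qed
  finally show ?thesis by (simp add: power2_eq_square)
qed

locale circle_law = prob_space m for m :: "complex measure" +
  assumes sets_law [simp, measurable_cong]: "sets m = sets borel"
    and AE_law: "AE u in m. cmod u = 1"
begin

lemma bounded_measurable_integrable_law:
  assumes f: "bounded_measurable f" shows "integrable m f"
proof -
  note [measurable] = bounded_measurable_measurable[OF f]
  obtain M where "\<And>z. \<bar>f z\<bar> \<le> M" using bounded_measurable_bound[OF f] by blast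
  then show ?thesis by (intro integrable_const_bound[of _ M]) auto
qed

lemma bounded_measurable_Kop [intro]:
  assumes f: "bounded_measurable f" shows "bounded_measurable (Kop m f)"
proof -
  note [measurable] = bounded_measurable_measurable[OF f]
  obtain M where M: "\<And>z. \<bar>f z\<bar> \<le> M" using bounded_measurable_bound[OF f] by blast
  have "\<bar>Kop m f z\<bar> \<le> M" for z
  proof -
    have i: "integrable m (\<lambda>u. f (u * z))"
      using bounded_measurable_integrable_law[OF bounded_measurable_comp[OF f, of "\<lambda>u. u * z"]] by simp
    have "\<bar>Kop m f z\<bar> \<le> (\<integral>u. \<bar>f (u * z)\<bar> \<partial>m)"
      unfolding Kop_def by (rule integral_abs_bound)
    also have "\<dots> \<le> M" using i M by (intro integral_le_const) auto
    finally show ?thesis .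
  qed
  then show ?thesis unfolding bounded_measurable_def Kop_def[abs_def] by auto
qed

lemma Kop_integrable: "bounded_measurable f \<Longrightarrow> integrable m (\<lambda>u. f (u * z))"
  using bounded_measurable_integrable_law[OF bounded_measurable_comp[of f "\<lambda>u. u * z"]] by simp

lemma Kop_pairing:
  assumes f: "bounded_measurable f" and g: "bounded_measurable g"
  shows "(\<integral>v. (\<integral>z. g z * f (v * z) \<partial>circle_measure) \<partial>m) = (\<integral>z. g z * Kop m f z \<partial>circle_measure)"
proof -
  note [measurable] = bounded_measurable_measurable[OF f] bounded_measurable_measurable[OF g]
  interpret P: pair_prob_space m circle_measure ..
  obtain M where M: "0 \<le> M" "\<And>z. \<bar>f z\<bar> \<le> M" using bounded_measurable_bound[OF f] by blast
  obtain N where N: "0 \<le> N" "\<And>z. \<bar>g z\<bar> \<le> N" using bounded_measurable_bound[OF g] by blast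
  have "integrable (m \<Otimes>\<^sub>M circle_measure) (\<lambda>(v, z). g z * f (v * z))"
    by (rule P.integrable_const_bound[of _ "N * M"]) (use M N in \<open>auto simp: abs_mult split_beta intro!: mult_mono AE_I2\<close>)
  from P.Fubini_integral[OF this]
  show ?thesis by (simp add: Kop_def)
qed

lemma mean_Kop:
  assumes f: "bounded_measurable f"
  shows "mean (Kop m f) = mean f"
proof -
  note [measurable] = bounded_measurable_measurable[OF f]
  have "mean (Kop m f) = (\<integral>v. (\<integral>z. f (v * z) \<partial>circle_measure) \<partial>m)"
    using Kop_pairing[OF f bounded_measurable_const[of 1]] by simp
  also have "\<dots> = (\<integral>v. mean f \<partial>m)"
  proof (rule integral_cong_AE)
    show "AE v in m. (\<integral>z. f (v * z) \<partial>circle_measure) = mean f"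
      using AE_law by eventually_elim (rule integral_circle_rotate, auto)
  qed measurable
  also have "\<dots> = mean f" by (simp add: prob_space)
  finally show ?thesis .
qed

lemma measurable_Dist2 [measurable]:
  assumes [measurable]: "f \<in> borel_measurable borel"
  shows "Dist2 f \<in> borel_measurable borel"
  unfolding Dist2_def[abs_def] by measurable

lemma bounded_measurable_Dist2:
  assumes f: "bounded_measurable f" shows "bounded_measurable (Dist2 f)"
proof -
  obtain M where M: "0 \<le> M" "\<And>z. \<bar>f z\<bar> \<le> M" using bounded_measurable_bound[OF f] by blast
  have "\<bar>f (w * z) - f z\<bar> \<le> 2 * M" for w z using M(2)[of "w * z"] M(2)[of z] by linarith
  then have "(f (w * z) - f z)\<^sup>2 \<le> (2 * M)\<^sup>2" for w z by (metis abs_ge_zero power2_abs power_mono)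
  then have "Dist2 f w \<le> (2 * M)\<^sup>2" for w
    unfolding Dist2_def
    by (intro circle.integral_le_const bounded_measurable_integrable bounded_measurable_power2 bounded_measurable_diff
      bounded_measurable_rotate[OF f] f) auto
  moreover note measurable_Dist2[OF bounded_measurable_measurable[OF f]]
  ultimately show ?thesis using Dist2_nonneg[of f] unfolding bounded_measurable_def[of "Dist2 f"] by auto
qed

text \<open>Expanding the square, the cross term averaged over independent \<open>u\<close> and
  \<open>v\<close> is the square of the convolution. The norm lost under \<open>Kop\<close> thus
  measures how far \<open>f\<close> is from being invariant under the random rotations
  \<open>u * cnj v\<close>.\<close>

lemma integral_Dist2:
  assumes f: "bounded_measurable f"
  shows "(\<integral>u. (\<integral>v. Dist2 f (u * cnj v) \<partial>m) \<partial>m) = 2 * sqnorm f - 2 * sqnorm (Kop m f)"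
proof -
  note [measurable] = bounded_measurable_measurable[OF f]
  let ?n = "sqnorm f"
  have bmK: "bounded_measurable (Kop m f)" by (rule bounded_measurable_Kop[OF f])
  note [measurable] = bounded_measurable_measurable[OF bmK]
  obtain M where M: "0 \<le> M" "\<And>z. \<bar>f z\<bar> \<le> M" using bounded_measurable_bound[OF f] by blast
  have le: "\<bar>\<integral>z. g z * f (v * z) \<partial>circle_measure\<bar> \<le> N * M" if g: "g \<in> borel_measurable borel" "\<And>z. \<bar>g z\<bar> \<le> N" "0 \<le> N" for g N v
  proof -
    have b: "\<bar>g z * f (v * z)\<bar> \<le> N * M" for z using that M by (auto simp: abs_mult intro!: mult_mono)
    have "bounded_measurable (\<lambda>z. g z * f (v * z))"
      using g by (intro bounded_measurable_mult[OF _ bounded_measurable_rotate[OF f]]) (auto simp: bounded_measurable_def)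
    then have "integrable circle_measure (\<lambda>z. \<bar>g z * f (v * z)\<bar>)" by (intro integrable_abs bounded_measurable_integrable)
    then show ?thesis using b by (intro order_trans[OF integral_abs_bound] circle.integral_le_const) auto
  qed
  have int: "integrable m (\<lambda>v. \<integral>z. g z * f (v * z) \<partial>circle_measure)" if "bounded_measurable g" for g
  proof -
    obtain N where N: "0 \<le> N" "\<And>z. \<bar>g z\<bar> \<le> N" using bounded_measurable_bound[OF \<open>bounded_measurable g\<close>] by blast
    note [measurable] = bounded_measurable_measurable[OF that]
    show ?thesis by (rule integrable_const_bound[of _ "N * M"]) (use le[OF _ N(2,1)] in auto)
  qed
  have inner: "(\<integral>v. Dist2 f (u * cnj v) \<partial>m) = 2 * ?n - 2 * (\<integral>z. Kop m f z * f (u * z) \<partial>circle_measure)" if u: "cmod u = 1" for u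
  proof -
    have "(\<integral>v. Dist2 f (u * cnj v) \<partial>m) = (\<integral>v. 2 * ?n - 2 * (\<integral>z. f (u * z) * f (v * z) \<partial>circle_measure) \<partial>m)"
    proof (rule integral_cong_AE)
      show "AE v in m. Dist2 f (u * cnj v) = 2 * ?n - 2 * (\<integral>z. f (u * z) * f (v * z) \<partial>circle_measure)"
        using AE_law by eventually_elim (rule Dist2_eq[OF f u])
    qed measurable
    also have "\<dots> = 2 * ?n - 2 * (\<integral>v. (\<integral>z. f (u * z) * f (v * z) \<partial>circle_measure) \<partial>m)"
      using int[OF bounded_measurable_rotate[OF f, of u]] by (simp add: prob_space)
    also have "(\<integral>v. (\<integral>z. f (u * z) * f (v * z) \<partial>circle_measure) \<partial>m) = (\<integral>z. f (u * z) * Kop m f z \<partial>circle_measure)"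
      by (rule Kop_pairing[OF f bounded_measurable_rotate[OF f]])
    finally show ?thesis by (simp add: mult.commute)
  qed
  have "(\<integral>u. (\<integral>v. Dist2 f (u * cnj v) \<partial>m) \<partial>m) = (\<integral>u. 2 * ?n - 2 * (\<integral>z. Kop m f z * f (u * z) \<partial>circle_measure) \<partial>m)"
  proof (rule integral_cong_AE)
    show "AE u in m. (\<integral>v. Dist2 f (u * cnj v) \<partial>m) = 2 * ?n - 2 * (\<integral>z. Kop m f z * f (u * z) \<partial>circle_measure)"
      using AE_law by eventually_elim (rule inner)
  qed measurable
  also have "\<dots> = 2 * ?n - 2 * (\<integral>u. (\<integral>z. Kop m f z * f (u * z) \<partial>circle_measure) \<partial>m)"
    using int[OF bmK] by (simp add: prob_space)
  also have "(\<integral>u. (\<integral>z. Kop m f z * f (u * z) \<partial>circle_measure) \<partial>m) = (\<integral>z. Kop m f z * Kop m f z \<partial>circle_measure)"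
    by (rule Kop_pairing[OF f bmK])
  finally show ?thesis by (simp add: power2_eq_square)
qed

lemma norm_Kop_le:
  assumes f: "bounded_measurable f"
  shows "sqnorm (Kop m f) \<le> sqnorm f"
proof -
  have "0 \<le> (\<integral>u. (\<integral>v. Dist2 f (u * cnj v) \<partial>m) \<partial>m)" by (intro Bochner_Integration.integral_nonneg) (simp add: Dist2_nonneg)
  then show ?thesis using integral_Dist2[OF f] by simp
qed

lemma Kop_diff_const:
  assumes f: "bounded_measurable f"
  shows "Kop m (\<lambda>z. f z - a) = (\<lambda>z. Kop m f z - a)"
  unfolding Kop_def using Kop_integrable[OF f] by (auto simp: fun_eq_iff prob_space)

end

interpretation circle: circle_law circle_measure
  by unfold_locales (use AE_circle_measure in auto)

text \<open>The same expansion for one uniform rotation, under which the averaged function is the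
  constant \<open>mean f\<close>, so that the variance appears in place of the loss of norm.\<close>

lemma integral_Dist2_circle:
  assumes f: "bounded_measurable f"
  shows "mean (Dist2 f) = 2 * sqnorm f - 2 * (mean f)\<^sup>2"
proof -
  note [measurable] = bounded_measurable_measurable[OF f] circle.measurable_Dist2
  let ?n = "sqnorm f"
  have K: "Kop circle_measure f z = mean f" if "cmod z = 1" for z
    unfolding Kop_def using integral_circle_rotate[OF that, of f] by (simp add: mult.commute)
  have eq: "Dist2 f w = 2 * ?n - 2 * (\<integral>z. f z * f (w * z) \<partial>circle_measure)" if "cmod w = 1" for w
    using Dist2_eq[OF f that, of 1] by (simp add: mult.commute)
  have "integrable circle_measure (\<lambda>w. 2 * ?n - 2 * (\<integral>z. f z * f (w * z) \<partial>circle_measure))"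
    by (rule Bochner_Integration.integrable_cong_AE_imp[OF bounded_measurable_integrable[OF circle.bounded_measurable_Dist2[OF f]]])
      (use AE_circle_measure in \<open>auto elim!: eventually_mono simp: eq\<close>)
  from Bochner_Integration.integrable_diff[OF circle.integrable_const[of "2 * ?n"] this]
  have int: "integrable circle_measure (\<lambda>w. 2 * (\<integral>z. f z * f (w * z) \<partial>circle_measure))" by simp
  have "mean (Dist2 f) = (\<integral>w. 2 * ?n - 2 * (\<integral>z. f z * f (w * z) \<partial>circle_measure) \<partial>circle_measure)"
  proof (rule integral_cong_AE)
    show "AE w in circle_measure. Dist2 f w = 2 * ?n - 2 * (\<integral>z. f z * f (w * z) \<partial>circle_measure)"
      using AE_circle_measure by eventually_elim (rule eq)
  qed measurable
  also have "\<dots> = 2 * ?n - 2 * (\<integral>w. (\<integral>z. f z * f (w * z) \<partial>circle_measure) \<partial>circle_measure)"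
    using int by (subst Bochner_Integration.integral_diff) simp_all
  also have "(\<integral>w. (\<integral>z. f z * f (w * z) \<partial>circle_measure) \<partial>circle_measure) = (\<integral>z. f z * Kop circle_measure f z \<partial>circle_measure)"
    by (rule circle.Kop_pairing[OF f f])
  also have "\<dots> = (\<integral>z. f z * mean f \<partial>circle_measure)"
  proof (rule integral_cong_AE)
    note [measurable] = bounded_measurable_measurable[OF circle.bounded_measurable_Kop[OF f]]
    show "(\<lambda>z. f z * Kop circle_measure f z) \<in> borel_measurable circle_measure" by measurable
    show "AE z in circle_measure. f z * Kop circle_measure f z = f z * mean f"
      using AE_circle_measure by eventually_elim (simp add: K)
  qed measurable
  finally show ?thesis by (simp add: power2_eq_square)
qed

text \<open>A Poincare inequality: if convolution by \<open>m\<close> hardly shrinks \<open>f\<close>, then \<open>f\<close> is almost invariant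
  under rotations by the small angles charged by \<open>u * cnj v\<close>, hence under all rotations.\<close>

lemma (in circle_law) poincare:
  assumes c: "0 < c" and \<delta>: "0 < \<delta>"
    and spread: "\<And>F :: complex \<Rightarrow> ennreal. F \<in> borel_measurable borel \<Longrightarrow>
      ennreal c * (\<integral>\<^sup>+h\<in>{0..<\<delta>}. F (cis h) \<partial>lborel) \<le> (\<integral>\<^sup>+u. (\<integral>\<^sup>+v. F (u * cnj v) \<partial>m) \<partial>m)"
  shows "\<exists>C>0. \<forall>f. bounded_measurable f \<longrightarrow>
    sqnorm f - (mean f)\<^sup>2
      \<le> C * (sqnorm f - sqnorm (Kop m f))"
proof -
  \<comment> \<open>Every angle in a full turn is \<open>k\<close> times an angle below 2 pi / k <
    \<delta>, where the hypothesis \<open>spread\<close> has something to say.\<close>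
  obtain k where k: "2 * pi / \<delta> < real k" using reals_Archimedean2 by blast
  have k0: "0 < real k" using k \<delta> by (smt (verit) divide_nonneg_pos pi_gt_zero)
  have kd: "2 * pi / real k < \<delta>" using k k0 \<delta> by (simp add: field_simps)
  \<comment> \<open>One factor \<open>k\<close> comes from rescaling the angle and two from
    \<open>Dist2_power\<close>; 1 / (2 pi) normalises the circle measure and 1 / c is due to
    \<open>spread\<close>. The factors 2 of the two expansions cancel.\<close>
  show ?thesis
  proof (intro exI[of _ "real k ^ 3 / (2 * pi * c)"] conjI allI impI)
    show "0 < real k ^ 3 / (2 * pi * c)" using k0 c by simp
    fix f assume f: "bounded_measurable f"
    note [measurable] = bounded_measurable_measurable[OF f] bounded_measurable_measurable[OF bounded_measurable_Dist2[OF f]]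
    let ?I = "\<integral>\<^sup>+h\<in>{0..<2*pi/real k}. ennreal (Dist2 f (cis h)) \<partial>lborel"
    let ?J = "\<integral>\<^sup>+h. ennreal (Dist2 f (cis (real k * h))) * indicator {0..<2*pi} (real k * h) \<partial>lborel"
    have "ennreal (mean (Dist2 f)) = (\<integral>\<^sup>+w. ennreal (Dist2 f w) \<partial>circle_measure)"
      by (rule nn_integral_eq_integral[symmetric])
        (use f Dist2_nonneg in \<open>auto intro: bounded_measurable_integrable bounded_measurable_Dist2\<close>)
    also have "\<dots> = ennreal (1 / (2*pi)) * (\<integral>\<^sup>+\<theta>\<in>{0..<2*pi}. ennreal (Dist2 f (cis \<theta>)) \<partial>lborel)"
      by (rule nn_integral_circle_measure) measurable
    also have "(\<integral>\<^sup>+\<theta>\<in>{0..<2*pi}. ennreal (Dist2 f (cis \<theta>)) \<partial>lborel) = ennreal (real k) * ?J"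
      using nn_integral_real_affine[of "\<lambda>\<theta>. ennreal (Dist2 f (cis \<theta>)) * indicator {0..<2*pi} \<theta>" "real k" 0] k0 by simp
    finally have 0: "ennreal (mean (Dist2 f)) = ennreal (1 / (2*pi)) * (ennreal (real k) * ?J)" .
    have "?J \<le> (\<integral>\<^sup>+h. ennreal ((real k)\<^sup>2) * (ennreal (Dist2 f (cis h)) * indicator {0..<2*pi/real k} h) \<partial>lborel)"
    proof (rule nn_integral_mono)
      fix h
      have "Dist2 f (cis (real k * h)) \<le> (real k)\<^sup>2 * Dist2 f (cis h)"
        using Dist2_power[OF f, of "cis h" k] by (simp add: Complex.DeMoivre)
      then have "ennreal (Dist2 f (cis (real k * h))) \<le> ennreal ((real k)\<^sup>2) * ennreal (Dist2 f (cis h))"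
        by (simp add: ennreal_mult'[symmetric] Dist2_nonneg ennreal_leI)
      then show "ennreal (Dist2 f (cis (real k * h))) * indicator {0..<2*pi} (real k * h)
          \<le> ennreal ((real k)\<^sup>2) * (ennreal (Dist2 f (cis h)) * indicator {0..<2*pi/real k} h)"
        using k0 by (auto split: split_indicator simp: field_simps zero_le_mult_iff)
    qed
    also have "\<dots> = ennreal ((real k)\<^sup>2) * ?I"
    proof (rule nn_integral_cmult)
      show "(\<lambda>h. ennreal (Dist2 f (cis h)) * indicator {0..<2*pi/real k} h) \<in> borel_measurable lborel"
        by measurable
    qed
    finally have "?J \<le> ennreal ((real k)\<^sup>2) * ?I" .
    then have 1: "ennreal (mean (Dist2 f)) \<le> ennreal (1 / (2*pi)) * (ennreal (real k) * (ennreal ((real k)\<^sup>2) * ?I))"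
      unfolding 0 by (rule mult_left_mono[OF mult_left_mono]) simp_all
    have "ennreal c * ?I \<le> ennreal c * (\<integral>\<^sup>+h\<in>{0..<\<delta>}. ennreal (Dist2 f (cis h)) \<partial>lborel)"
    proof (rule mult_left_mono)
      have "{0..<2*pi/real k} \<subseteq> {0..<\<delta>}" using kd by (simp add: atLeastLessThan_subset_iff)
      then show "?I \<le> (\<integral>\<^sup>+h\<in>{0..<\<delta>}. ennreal (Dist2 f (cis h)) \<partial>lborel)"
        by (rule nn_set_integral_set_mono)
    qed simp
    also have "\<dots> \<le> (\<integral>\<^sup>+u. (\<integral>\<^sup>+v. ennreal (Dist2 f (u * cnj v)) \<partial>m) \<partial>m)"
      by (rule spread) measurable
    also have "\<dots> = (\<integral>\<^sup>+u. ennreal (\<integral>v. Dist2 f (u * cnj v) \<partial>m) \<partial>m)"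
    proof (rule nn_integral_cong, rule nn_integral_eq_integral)
      show "integrable m (\<lambda>v. Dist2 f (u * cnj v))" for u
        by (intro bounded_measurable_integrable_law bounded_measurable_comp[OF bounded_measurable_Dist2[OF f]]) measurable
    qed (simp add: Dist2_nonneg)
    also have "\<dots> = ennreal (\<integral>u. (\<integral>v. Dist2 f (u * cnj v) \<partial>m) \<partial>m)"
    proof (rule nn_integral_eq_integral)
      obtain M where M: "\<And>z. \<bar>Dist2 f z\<bar> \<le> M" using bounded_measurable_bound[OF bounded_measurable_Dist2[OF f]] by blast
      have "norm (\<integral>v. Dist2 f (u * cnj v) \<partial>m) \<le> M" for u
        unfolding real_norm_def using M
        by (intro order_trans[OF integral_abs_bound] integral_le_const integrable_abs
          bounded_measurable_integrable_law bounded_measurable_comp[OF bounded_measurable_Dist2[OF f]]) auto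
      then show "integrable m (\<lambda>u. \<integral>v. Dist2 f (u * cnj v) \<partial>m)"
        by (intro integrable_const_bound[of _ M]) auto
    qed (simp add: Dist2_nonneg)
    finally have 2: "ennreal c * ?I \<le> ennreal (2 * (sqnorm f - sqnorm (Kop m f)))"
      by (simp add: integral_Dist2[OF f] right_diff_distrib)
    let ?d = "sqnorm f - sqnorm (Kop m f)"
    have d0: "0 \<le> ?d" using norm_Kop_le[OF f] by simp
    have "ennreal (c * mean (Dist2 f)) = ennreal c * ennreal (mean (Dist2 f))"
      using c by (intro ennreal_mult) (auto intro!: Bochner_Integration.integral_nonneg simp: Dist2_nonneg)
    also have "\<dots> \<le> ennreal c * (ennreal (1 / (2*pi)) * (ennreal (real k) * (ennreal ((real k)\<^sup>2) * ?I)))"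
      by (rule mult_left_mono[OF 1]) simp
    also have "\<dots> = ennreal (1 / (2*pi)) * (ennreal (real k) * (ennreal ((real k)\<^sup>2) * (ennreal c * ?I)))"
      by (simp add: mult_ac)
    also have "\<dots> \<le> ennreal (1 / (2*pi)) * (ennreal (real k) * (ennreal ((real k)\<^sup>2) * ennreal (2 * ?d)))"
      by (rule mult_left_mono[OF mult_left_mono[OF mult_left_mono[OF 2]]]) simp_all
    also have "\<dots> = ennreal (1 / (2*pi) * (real k * ((real k)\<^sup>2 * (2 * ?d))))"
      using d0 by (simp add: ennreal_mult[symmetric])
    finally have "c * mean (Dist2 f) \<le> 1 / (2*pi) * (real k * ((real k)\<^sup>2 * (2 * ?d)))"
      using d0 by (subst (asm) ennreal_le_iff) auto
    then have "c * (2 * (sqnorm f - (mean f)\<^sup>2)) \<le> real k ^ 3 / (2 * pi) * (2 * ?d)"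
      unfolding integral_Dist2_circle[OF f] by (simp add: power3_eq_cube power2_eq_square right_diff_distrib mult_ac)
    then show "sqnorm f - (mean f)\<^sup>2 \<le> real k ^ 3 / (2 * pi * c) * ?d"
      using c by (simp add: field_simps)
  qed
qed

text \<open>\<open>kap\<close> has square mean 1 and is at most t < 1 on the right half of the
  circle, hence keeps a positive $L^2$ distance from the constant 1. As \<open>Vop\<close> maps 1 to
  \<open>kap\<close>, this is the quantitative form of the isometry moving the constants.\<close>

lemma mean_kap_less:
  assumes "0 < r" "r < 1" "0 < t" "r\<^sup>2 + t\<^sup>2 = 1"
  shows "(mean (kap r t))\<^sup>2 < 1"
proof -
  have bk: "bounded_measurable (kap r t)" by (rule bounded_measurable_kap[OF assms(1-3)])
  have sq: "sqnorm (kap r t) = 1"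
    using integral_mob[OF assms, of "\<lambda>_. 1"] by simp
  define e where "e = 1 - t"
  have t1: "t < 1"
  proof -
    have "t\<^sup>2 < 1\<^sup>2" using assms(1,4) zero_less_power2[of r] unfolding one_power2 by linarith
    then show ?thesis by (rule power2_less_imp_less) simp
  qed
  let ?A = "{z :: complex. 0 \<le> Re z}"
  have [measurable]: "?A \<in> sets borel" by measurable
  have half: "1 / 2 \<le> mean (indicat_real ?A)"
  proof -
    have i: "integrable circle_measure (\<lambda>z. indicat_real ?A (c * z))" for c
      by (rule integrable_circle_measure[of _ 1]) (auto split: split_indicator)
    have "1 = (\<integral>z. (1 :: real) \<partial>circle_measure)" by simp
    also have "\<dots> \<le> (\<integral>z. indicat_real ?A (1 * z) + indicat_real ?A (-1 * z) \<partial>circle_measure)"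
      by (intro integral_mono Bochner_Integration.integrable_add i) (auto split: split_indicator)
    also have "\<dots> = (\<integral>z. indicat_real ?A (1 * z) \<partial>circle_measure) + (\<integral>z. indicat_real ?A (-1 * z) \<partial>circle_measure)"
      by (intro Bochner_Integration.integral_add i)
    also have "(\<integral>z. indicat_real ?A (-1 * z) \<partial>circle_measure) = mean (indicat_real ?A)"
      by (rule integral_circle_rotate) auto
    finally show ?thesis by simp
  qed
  have pw: "e\<^sup>2 * indicat_real ?A z \<le> (kap r t z - 1)\<^sup>2" if "cmod z = 1" for z
  proof (cases "z \<in> ?A")
    case True
    have "Re (1 + of_real r * z) \<ge> 1" using True assms by simp
    then have "1 \<le> cmod (1 + of_real r * z)" using complex_Re_le_cmod order_trans by blast
    then have "kap r t z \<le> t" using assms by (simp add: kap_circle[OF that] divide_le_eq mult_le_cancel_left1)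
    then have "e \<le> 1 - kap r t z" by (simp add: e_def)
    then have "e\<^sup>2 \<le> (1 - kap r t z)\<^sup>2" using t1 by (intro power_mono) (auto simp: e_def)
    then show ?thesis using True by (simp add: power2_commute)
  qed simp
  have "0 < e\<^sup>2 * (1/2)" using t1 by (simp add: e_def)
  also have "\<dots> \<le> e\<^sup>2 * mean (indicat_real ?A)" using half by (intro mult_left_mono) auto
  also have "\<dots> = (\<integral>z. e\<^sup>2 * indicat_real ?A z \<partial>circle_measure)" by simp
  also have "\<dots> \<le> (\<integral>z. (kap r t z - 1)\<^sup>2 \<partial>circle_measure)"
  proof (rule integral_mono_AE)
    show "AE z in circle_measure. e\<^sup>2 * indicat_real ?A z \<le> (kap r t z - 1)\<^sup>2"
      using AE_circle_measure by eventually_elim (rule pw)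
    show "integrable circle_measure (\<lambda>z. e\<^sup>2 * indicat_real ?A z)"
      by (rule integrable_circle_measure[of _ "e\<^sup>2"]) (auto split: split_indicator)
    show "integrable circle_measure (\<lambda>z. (kap r t z - 1)\<^sup>2)"
      using bk by (intro bounded_measurable_integrable bounded_measurable_power2 bounded_measurable_diff) auto
  qed
  also have "(\<integral>z. (kap r t z - 1)\<^sup>2 \<partial>circle_measure) = (\<integral>z. (kap r t z)\<^sup>2 + 1 - 2 * kap r t z \<partial>circle_measure)"
    by (simp add: power2_diff)
  also have "\<dots> = 2 - 2 * mean (kap r t)"
    using bounded_measurable_integrable[OF bk] bounded_measurable_integrable[OF bounded_measurable_power2[OF bk]]
    by (simp add: sq)
  finally have "mean (kap r t) < 1" by simp
  moreover have "0 \<le> mean (kap r t)" using kap_nonneg[OF assms(3)] by simp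
  ultimately show ?thesis by (simp add: abs_square_less_1)
qed

lemma variance_add_le:
  assumes f: "bounded_measurable f" and g: "bounded_measurable g"
  shows "sqnorm f - (mean f)\<^sup>2
    \<le> 2 * (sqnorm g - (mean g)\<^sup>2) + 2 * (\<integral>z. (f z - g z)\<^sup>2 \<partial>circle_measure)"
proof -
  have var: "(\<integral>z. (h z - mean h)\<^sup>2 \<partial>circle_measure) = sqnorm h - (mean h)\<^sup>2"
    if h: "bounded_measurable h" for h
    using circle.variance_eq[OF bounded_measurable_integrable[OF h] bounded_measurable_integrable[OF bounded_measurable_power2[OF h]]] .
  define a where "a = mean f"
  define b where "b = mean g"
  note bm = f g bounded_measurable_diff[OF f g]
  define h where "h z = f z - g z" for z
  have h: "bounded_measurable h" unfolding h_def using bm by simp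
  have hab: "mean h = a - b"
    unfolding h_def a_def b_def using bm by (intro Bochner_Integration.integral_diff bounded_measurable_integrable)
  have "(\<integral>z. (f z - a)\<^sup>2 \<partial>circle_measure) \<le> (\<integral>z. 2 * (g z - b)\<^sup>2 + 2 * (h z - (a - b))\<^sup>2 \<partial>circle_measure)"
  proof (rule integral_mono)
    show "(f z - a)\<^sup>2 \<le> 2 * (g z - b)\<^sup>2 + 2 * (h z - (a - b))\<^sup>2" for z
    proof -
      have "(x + y)\<^sup>2 \<le> 2 * x\<^sup>2 + 2 * y\<^sup>2" for x y :: real
        using sum_squares_bound[of x y] by (simp add: power2_sum)
      moreover have "f z - a = (g z - b) + (h z - (a - b))" by (simp add: h_def)
      ultimately show ?thesis by metis
    qed
  qed (intro bounded_measurable_integrable bounded_measurable_add bounded_measurable_power2 bounded_measurable_diff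
      bounded_measurable_const bounded_measurable_mult[OF bounded_measurable_const] f g h)+
  also have "\<dots> = 2 * (\<integral>z. (g z - b)\<^sup>2 \<partial>circle_measure) + 2 * (\<integral>z. (h z - (a - b))\<^sup>2 \<partial>circle_measure)"
    by (subst Bochner_Integration.integral_add) (simp_all add: bounded_measurable_integrable bounded_measurable_power2
      bounded_measurable_diff g h bounded_measurable_mult[OF bounded_measurable_const])
  also have "(\<integral>z. (h z - (a - b))\<^sup>2 \<partial>circle_measure) \<le> sqnorm h"
    using var[OF h] by (simp add: hab)
  finally show ?thesis using var[OF f] var[OF g] by (simp add: a_def b_def h_def)
qed

text \<open>If both applications of \<open>K\<close> lose little, the functions they act on have
  small variance by \<open>C\<close>. The first is then close to its mean \<open>a\<close>, so
  \<open>Vop\<close> sends it close to \<open>a * kap\<close>, whose variance is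
  \<open>a\<^sup>2\<close> times the positive number \<open>v\<close>; hence \<open>a\<close>, and
  with it the whole norm of \<open>f\<close>, is small.\<close>

lemma contraction:
  assumes r: "0 < r" "r < 1" and t: "0 < t" "r\<^sup>2 + t\<^sup>2 = 1"
    and K: "\<And>f. bounded_measurable f \<Longrightarrow> bounded_measurable (K f)"
    and K_diff: "\<And>f a. bounded_measurable f \<Longrightarrow> K (\<lambda>z. f z - a) = (\<lambda>z. K f z - a)"
    and K_norm: "\<And>f. bounded_measurable f \<Longrightarrow> sqnorm (K f) \<le> sqnorm f"
    and C: "0 < C" "\<And>f. bounded_measurable f \<Longrightarrow>
      sqnorm f - (mean f)\<^sup>2
        \<le> C * (sqnorm f - sqnorm (K f))"
  shows "\<exists>q. 0 < q \<and> q < 1 \<and> (\<forall>f c. bounded_measurable f \<longrightarrow> cmod c = 1 \<longrightarrow>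
    sqnorm (K (Vop r t (\<lambda>z. K f (c * z)))) \<le> q * sqnorm f)"
proof -
  let ?n = "\<lambda>f :: complex \<Rightarrow> real. \<integral>z. (f z)\<^sup>2 \<partial>circle_measure"
  let ?e = "\<lambda>f :: complex \<Rightarrow> real. \<integral>z. f z \<partial>circle_measure"
  let ?v = "\<lambda>f. ?n f - (?e f)\<^sup>2"
  note bk = bounded_measurable_kap[OF r t(1)]
  have nk: "?n (kap r t) = 1"
    using integral_mob[OF r t, of "\<lambda>_. 1"] by simp
  define v where "v = ?v (kap r t)"
  have v: "0 < v" "v \<le> 1" using mean_kap_less[OF r t] by (simp_all add: v_def nk)
  define x where "x = v / ((2 + v) * C)"
  have x: "0 < x" using v C by (simp add: x_def)
  have main: "?n (K (Vop r t (\<lambda>z. K f (c * z)))) \<le> (1 - x) * ?n f" if f: "bounded_measurable f" and c: "cmod c = 1" for f c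
  proof -
    define h where "h z = K f (c * z)" for z
    define g where "g = Vop r t h"
    define a where "a = ?e f"
    have Kf: "bounded_measurable (K f)" by (rule K[OF f])
    have h: "bounded_measurable h" unfolding h_def by (rule bounded_measurable_rotate[OF Kf])
    have g: "bounded_measurable g" unfolding g_def by (rule bounded_measurable_Vop[OF r t(1) h])
    have nh: "?n h = ?n (K f)"
      unfolding h_def using bounded_measurable_measurable[OF Kf] by (intro integral_circle_rotate[OF c, of "\<lambda>z. (K f z)\<^sup>2"]) measurable
    have ng: "?n g = ?n (K f)" unfolding g_def norm_Vop[OF r t h] by (rule nh)
    have ak: "bounded_measurable (\<lambda>z. a * kap r t z)" using bk by auto
    have ha: "bounded_measurable (\<lambda>z. a - h z)" using h by auto
    have "?n (\<lambda>z. a * kap r t z - g z) = ?n (Vop r t (\<lambda>z. a - h z))"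
      by (simp add: g_def Vop_def algebra_simps)
    also have "\<dots> = ?n (\<lambda>z. a - h z)" by (rule norm_Vop[OF r t ha])
    also have "\<dots> = ?n (\<lambda>z. K f (c * z) - a)" by (simp add: h_def power2_commute)
    also have "\<dots> = ?n (\<lambda>z. K f z - a)"
      by (intro integral_circle_rotate[OF c, of "\<lambda>z. (K f z - a)\<^sup>2"] bounded_measurable_measurable
        bounded_measurable_power2 bounded_measurable_diff Kf bounded_measurable_const)
    also have "\<dots> = ?n (K (\<lambda>z. f z - a))" by (simp add: K_diff[OF f])
    also have "\<dots> \<le> ?n (\<lambda>z. f z - a)" using f by (intro K_norm) auto
    also have "\<dots> = ?v f"
      unfolding a_def by (rule circle.variance_eq[OF bounded_measurable_integrable[OF f] bounded_measurable_integrable[OF bounded_measurable_power2[OF f]]])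
    finally have diff: "?n (\<lambda>z. a * kap r t z - g z) \<le> ?v f" .
    have "a\<^sup>2 * v = ?v (\<lambda>z. a * kap r t z)"
      by (simp add: v_def power_mult_distrib right_diff_distrib)
    also have "\<dots> \<le> 2 * ?v g + 2 * ?n (\<lambda>z. a * kap r t z - g z)" by (rule variance_add_le[OF ak g])
    also have "\<dots> \<le> 2 * ?v g + 2 * ?v f" by (intro add_left_mono mult_left_mono diff) simp
    finally have "a\<^sup>2 * v \<le> 2 * ?v g + 2 * ?v f" .
    moreover have "a\<^sup>2 = ?n f - ?v f" by (simp add: a_def)
    moreover have "0 \<le> v * ?v g"
    proof -
      have "0 \<le> ?v g"
        using circle.variance_eq[OF bounded_measurable_integrable[OF g] bounded_measurable_integrable[OF bounded_measurable_power2[OF g]]]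
        by (metis circle.variance_positive)
      then show ?thesis using v by simp
    qed
    moreover have "v * N \<le> (2 + v) * (F + G)" if "A * v \<le> 2 * G + 2 * F" "A = N - F" "0 \<le> v * G" for A N F G
      using that by (simp add: algebra_simps)
    ultimately have "v * ?n f \<le> (2 + v) * (?v f + ?v g)" by blast
    also have "\<dots> \<le> (2 + v) * (C * (?n f - ?n (K f)) + C * (?n g - ?n (K g)))"
      using v C(2)[OF f] C(2)[OF g] by (intro mult_left_mono add_mono) auto
    \<comment> \<open>The two losses telescope, because rotation and \<open>Vop\<close> are
      isometric and so \<open>?n g = ?n (K f)\<close>.\<close>
    also have "\<dots> = ((2 + v) * C) * (?n f - ?n (K g))"
      unfolding ng by (simp add: algebra_simps)
    finally have "x * ?n f \<le> ?n f - ?n (K g)"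
      using v C by (simp add: x_def divide_le_eq mult.commute)
    then show ?thesis by (simp add: g_def h_def[abs_def] algebra_simps)
  qed
  \<comment> \<open>The maximum keeps the factor positive; its real powers and its logarithm are
    taken later.\<close>
  have "?n (K (Vop r t (\<lambda>z. K f (c * z)))) \<le> max (1/2) (1 - x) * ?n f" if "bounded_measurable f" "cmod c = 1" for f c
    using main[OF that] by (rule order_trans) (intro mult_right_mono, auto)
  then show ?thesis using x by (intro exI[of _ "max (1/2) (1 - x)"]) auto
qed

section \<open>The law of a random phase\<close>

lemma measurable_abs_torus [measurable]: "abs_torus \<in> borel_measurable borel"
  by (rule borel_measurable_continuous_onI[OF continuous_on_abs_torus])

lemma torus_phase_abs: "torus_phase (abs_torus x) = cis (- x)"
  by (simp add: torus_phase.abs_eq cis_conv_exp)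

lemma measurable_torus_phase [measurable]: "torus_phase \<in> borel_measurable borel"
proof (rule borel_measurable_continuous_onI)
  have "open (torus_phase -` S)" if "open S" for S
  proof -
    have "abs_torus -` (torus_phase -` S) = (\<lambda>x. cis (- x)) -` S"
      by (auto simp: torus_phase_abs)
    moreover have "open ((\<lambda>x :: real. cis (- x)) -` S)"
      using that by (intro open_vimage continuous_intros)
    ultimately show ?thesis by (simp add: open_torus_def)
  qed
  then show "continuous_on UNIV torus_phase" by (simp add: continuous_on_open_vimage)
qed

lemma sets_lebesgue_torus [simp, measurable_cong]: "sets lebesgue_torus = sets borel"
  by (simp add: lebesgue_torus_def)

lemma nn_integral_lebesgue_torus:
  assumes [measurable]: "F \<in> borel_measurable borel"
  shows "(\<integral>\<^sup>+x. F x \<partial>lebesgue_torus) = (\<integral>\<^sup>+\<theta>\<in>{0..<2*pi}. F (abs_torus \<theta>) \<partial>lborel)"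
proof -
  have [measurable]: "abs_torus \<in> measurable (restrict_space lborel {0..<2*pi}) borel"
    by (rule measurable_restrict_space1) simp
  show ?thesis
    unfolding lebesgue_torus_def
    by (subst nn_integral_distr) (simp_all add: nn_integral_restrict_space)
qed

text \<open>Needed because \<open>torus_phase\<close> carries the angle with a minus sign. The
  reflected half-open period differs from the original one in its two endpoints only.\<close>

lemma nn_integral_circle_reflect:
  assumes [measurable]: "F \<in> borel_measurable borel"
  shows "(\<integral>\<^sup>+\<theta>\<in>{0..<2*pi}. F (cis (- \<theta>)) \<partial>lborel) = ennreal (2*pi) * (\<integral>\<^sup>+z. F z \<partial>circle_measure)"
proof -
  have "(\<integral>\<^sup>+\<theta>\<in>{0..<2*pi}. F (cis (- \<theta>)) \<partial>lborel)
    = (\<integral>\<^sup>+\<theta>. F (cis (- (2*pi + (-1) * \<theta>))) * indicator {0..<2*pi} (2*pi + (-1) * \<theta>) \<partial>lborel)"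
    using nn_integral_real_affine[of "\<lambda>\<theta>. F (cis (- \<theta>)) * indicator {0..<2*pi} \<theta>" "-1" "2*pi"] by simp
  also have "\<dots> = (\<integral>\<^sup>+\<theta>\<in>{0..<2*pi}. F (cis \<theta>) \<partial>lborel)"
  proof (rule nn_integral_cong_AE)
    have per: "cis (- (2*pi + (-1) * \<theta>)) = cis \<theta>" for \<theta>
      by (simp add: complex_eq_iff cos_diff sin_diff)
    show "AE \<theta> in lborel. F (cis (- (2*pi + (-1) * \<theta>))) * indicator {0..<2*pi} (2*pi + (-1) * \<theta>)
        = F (cis \<theta>) * indicator {0..<2*pi} \<theta>"
      using AE_lborel_singleton[of 0] AE_lborel_singleton[of "2*pi"]
      by eventually_elim (unfold per, auto split: split_indicator)
  qed
  also have "\<dots> = ennreal (2*pi) * (\<integral>\<^sup>+z. F z \<partial>circle_measure)"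
    by (subst nn_integral_circle_measure) (simp_all add: mult.assoc[symmetric] ennreal_mult[symmetric])
  finally show ?thesis .
qed

text \<open>Steinhaus: a compact subset \<open>T\<close> of \<open>A\<close> and its small translates lie in an open set \<open>V\<close> of measure
  less than \<open>3/2\<close> times that of \<open>T\<close>, so they overlap.\<close>

lemma overlap_translate:
  fixes A :: "real set"
  assumes [measurable]: "A \<in> sets borel" and bdd: "bounded A" and pos: "0 < emeasure lborel A"
  obtains c \<delta> :: real where "0 < c" "0 < \<delta>"
    "\<And>h. 0 \<le> h \<Longrightarrow> h < \<delta> \<Longrightarrow> ennreal c \<le> (\<integral>\<^sup>+\<theta>. indicator A \<theta> * indicator A (\<theta> + h) \<partial>lborel)"
proof -
  have fin: "emeasure lborel A < \<infinity>" using bdd by (rule emeasure_bounded_finite)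
  define a where "a = measure lborel A"
  have a: "emeasure lborel A = ennreal a" using fin by (simp add: a_def emeasure_eq_ennreal_measure top.not_eq_extremum)
  then have a0: "0 < a" using pos by simp
  obtain T where T: "closed T" "T \<subseteq> A" "emeasure lebesgue (A - T) < ennreal (a/2)"
    by (rule sets_lebesgue_inner_closed[of A "a/2"]) (use a0 in simp_all)
  have [measurable]: "T \<in> sets borel" using T(1) by simp
  have AT: "emeasure lborel (A - T) < ennreal (a/2)" using T(3) by simp
  have "bounded T" using bdd T(2) bounded_subset by blast
  then have compT: "compact T" using T(1) compact_eq_bounded_closed by blast
  define k where "k = measure lborel T"
  have Tfin: "emeasure lborel T = ennreal k"
    using emeasure_bounded_finite[OF \<open>bounded T\<close>] by (simp add: k_def emeasure_eq_ennreal_measure top.not_eq_extremum)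
  have k: "0 < k"
  proof (rule ccontr)
    assume "\<not> 0 < k"
    then have "emeasure lborel T = 0" using Tfin by (simp add: ennreal_neg)
    moreover have "emeasure lborel A \<le> emeasure lborel T + emeasure lborel (A - T)"
    proof -
      have "emeasure lborel A = emeasure lborel (T \<union> (A - T))" using T(2) by (simp add: Un_absorb1)
      also have "\<dots> \<le> emeasure lborel T + emeasure lborel (A - T)" by (rule emeasure_subadditive) auto
      finally show ?thesis .
    qed
    ultimately have "ennreal a < ennreal (a/2)" using AT a by simp
    then show False using a0 by (simp add: ennreal_less_iff)
  qed
  obtain V where V: "open V" "T \<subseteq> V" "emeasure lebesgue (V - T) < ennreal (k/2)"
    by (rule sets_lebesgue_outer_open[of T "k/2"]) (use k in simp_all)
  have [measurable]: "V \<in> sets borel" using V(1) by simp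
  have VT: "emeasure lborel (V - T) \<le> ennreal (k/2)" using V(3) by simp
  have "T \<inter> - V = {}" using V(2) by auto
  from separate_compact_closed[OF compT _ this] V(1)
  have "\<exists>d>0. \<forall>x\<in>T. \<forall>y\<in>- V. d \<le> dist x y" by (simp add: closed_Compl)
  then obtain d where d: "0 < d" "\<And>x y. x \<in> T \<Longrightarrow> y \<in> - V \<Longrightarrow> d \<le> dist x y"
    by blast
  show ?thesis
  proof (rule that[of "k/2" d])
    fix h :: real assume h: "0 \<le> h" "h < d"
    let ?X = "\<integral>\<^sup>+\<theta>. indicator T \<theta> * indicator T (\<theta> + h) \<partial>lborel"
    have "ennreal k = (\<integral>\<^sup>+\<theta>. indicator T \<theta> \<partial>lborel)" using Tfin by simp
    also have "\<dots> \<le> (\<integral>\<^sup>+\<theta>. indicator T \<theta> * indicator T (\<theta> + h) + indicator (V - T) (h + 1 * \<theta>) \<partial>lborel)"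
    proof (rule nn_integral_mono)
      fix \<theta>
      have "\<theta> + h \<in> V" if "\<theta> \<in> T"
        using d(2)[OF that, of "\<theta> + h"] h by (auto simp: dist_real_def)
      then show "indicator T \<theta> \<le> indicator T \<theta> * indicator T (\<theta> + h) + (indicator (V - T) (h + 1 * \<theta>) :: ennreal)"
        by (auto simp: indicator_def add.commute)
    qed
    also have "\<dots> = ?X + (\<integral>\<^sup>+\<theta>. indicator (V - T) (h + 1 * \<theta>) \<partial>lborel)"
      by (rule nn_integral_add) measurable
    also have "(\<integral>\<^sup>+\<theta>. indicator (V - T) (h + 1 * \<theta>) \<partial>lborel) = emeasure lborel (V - T)"
      using nn_integral_real_affine[of "indicator (V - T)" 1 h] by simp
    also have "?X + emeasure lborel (V - T) \<le> ?X + ennreal (k/2)" by (intro add_left_mono VT)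
    finally have "ennreal (k/2) + ennreal (k/2) \<le> ?X + ennreal (k/2)"
      using k by (simp add: ennreal_plus[symmetric] del: ennreal_plus)
    then have "ennreal (k/2) = \<infinity> \<or> ennreal (k/2) \<le> ?X"
      unfolding add.commute[of ?X] ennreal_add_left_cancel_le .
    then have "ennreal (k/2) \<le> ?X" by simp
    also have "\<dots> \<le> (\<integral>\<^sup>+\<theta>. indicator A \<theta> * indicator A (\<theta> + h) \<partial>lborel)"
      using T(2) by (intro nn_integral_mono) (auto split: split_indicator)
    finally show "ennreal (k/2) \<le> (\<integral>\<^sup>+\<theta>. indicator A \<theta> * indicator A (\<theta> + h) \<partial>lborel)" .
  qed (use k d in auto)
qed

locale phase_law =
  fixes \<mu> :: "torus measure" and \<tau> :: "torus \<Rightarrow> real"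
  assumes prob_\<mu>: "prob_space \<mu>"
    and \<tau> [measurable]: "\<tau> \<in> borel_measurable borel"
    and \<tau>_bounded: "\<exists>B. AE x in lebesgue_torus. \<bar>\<tau> x\<bar> \<le> B"
    and \<mu>_density: "\<mu> = density lebesgue_torus (\<lambda>x. ennreal (\<tau> x))"
begin

lemma sets_\<mu> [simp, measurable_cong]: "sets \<mu> = sets borel"
  by (simp add: \<mu>_density)

definition m :: "complex measure"
  where "m = distr \<mu> borel torus_phase"

lemma measurable_torus_phase_\<mu> [measurable]: "torus_phase \<in> borel_measurable \<mu>"
  using measurable_torus_phase by (simp add: measurable_cong_sets[OF sets_\<mu> refl])

sublocale law: circle_law m
proof -
  interpret prob_space \<mu> by (rule prob_\<mu>)
  interpret d: prob_space m unfolding m_def by (rule prob_space_distr) measurable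
  show "circle_law m"
  proof
    show "sets m = sets borel" by (simp add: m_def)
    show "AE u in m. cmod u = 1" unfolding m_def by (subst AE_distr_iff) auto
  qed
qed

lemma nn_integral_m:
  assumes [measurable]: "F \<in> borel_measurable borel"
  shows "(\<integral>\<^sup>+u. F u \<partial>m) = (\<integral>\<^sup>+\<theta>\<in>{0..<2*pi}. ennreal (\<tau> (abs_torus \<theta>)) * F (cis (- \<theta>)) \<partial>lborel)"
proof -
  have "(\<integral>\<^sup>+u. F u \<partial>m) = (\<integral>\<^sup>+x. F (torus_phase x) \<partial>\<mu>)"
    unfolding m_def by (rule nn_integral_distr) measurable
  also have "\<dots> = (\<integral>\<^sup>+x. ennreal (\<tau> x) * F (torus_phase x) \<partial>lebesgue_torus)"
    unfolding \<mu>_density by (rule nn_integral_density) measurable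
  also have "\<dots> = (\<integral>\<^sup>+\<theta>\<in>{0..<2*pi}. ennreal (\<tau> (abs_torus \<theta>)) * F (torus_phase (abs_torus \<theta>)) \<partial>lborel)"
    by (rule nn_integral_lebesgue_torus) measurable
  finally show ?thesis by (simp only: torus_phase_abs)
qed

lemma density_bound:
  obtains B :: real where "1 \<le> B" "\<And>F. F \<in> borel_measurable borel \<Longrightarrow> (\<integral>\<^sup>+u. F u \<partial>m) \<le> ennreal B * (\<integral>\<^sup>+z. F z \<partial>circle_measure)"
proof -
  obtain B where B: "AE x in lebesgue_torus. \<bar>\<tau> x\<bar> \<le> B" using \<tau>_bounded by blast
  \<comment> \<open>Raising the bound to at least 1 lets the constant function 1 satisfy the
    pointwise bound from which \<open>Ex_weight_2\<close> starts.\<close>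
  define B' where "B' = max B 1"
  have B': "AE x in lebesgue_torus. \<tau> x \<le> B'" "1 \<le> B'" using B by (auto simp: B'_def elim!: eventually_mono)
  show ?thesis
  proof (rule that[of "B' * (2 * pi)"])
    have "1 \<le> 2 * pi" using pi_gt3 by simp
    then show "1 \<le> B' * (2 * pi)" using mult_mono[of 1 B' 1 "2*pi"] B'(2) by simp
    fix F :: "complex \<Rightarrow> ennreal" assume [measurable]: "F \<in> borel_measurable borel"
    have "(\<integral>\<^sup>+u. F u \<partial>m) = (\<integral>\<^sup>+x. F (torus_phase x) \<partial>\<mu>)"
      unfolding m_def by (rule nn_integral_distr) measurable
    also have "\<dots> = (\<integral>\<^sup>+x. ennreal (\<tau> x) * F (torus_phase x) \<partial>lebesgue_torus)"
      unfolding \<mu>_density by (rule nn_integral_density) measurable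
    also have "\<dots> \<le> (\<integral>\<^sup>+x. ennreal B' * F (torus_phase x) \<partial>lebesgue_torus)"
      by (rule nn_integral_mono_AE) (use B'(1) in \<open>eventually_elim, auto intro!: mult_right_mono ennreal_leI\<close>)
    also have "\<dots> = ennreal B' * (\<integral>\<^sup>+x. F (torus_phase x) \<partial>lebesgue_torus)"
      by (rule nn_integral_cmult) measurable
    also have "(\<integral>\<^sup>+x. F (torus_phase x) \<partial>lebesgue_torus) = (\<integral>\<^sup>+\<theta>\<in>{0..<2*pi}. F (torus_phase (abs_torus \<theta>)) \<partial>lborel)"
      by (rule nn_integral_lebesgue_torus) measurable
    also have "\<dots> = ennreal (2*pi) * (\<integral>\<^sup>+z. F z \<partial>circle_measure)"
      unfolding torus_phase_abs by (rule nn_integral_circle_reflect) measurable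
    finally show "(\<integral>\<^sup>+u. F u \<partial>m) \<le> ennreal (B' * (2*pi)) * (\<integral>\<^sup>+z. F z \<partial>circle_measure)"
      using B'(2) by (simp add: ennreal_mult mult.assoc)
  qed
qed

text \<open>Having total mass 1, the density exceeds some \<open>b > 0\<close> on a set
  \<open>A\<close> of positive measure. For phases with angles -\<theta> and -\<theta>' the product
  \<open>u * cnj v\<close> has angle h = \<theta>' - \<theta>, so its law has density at least b^2
  times the overlap of \<open>A\<close> with its translate by -h, and this overlap is bounded below
  for small h.\<close>

lemma spread:
  obtains c \<delta> :: real where "0 < c" "0 < \<delta>"
    "\<And>F :: complex \<Rightarrow> ennreal. F \<in> borel_measurable borel \<Longrightarrow>
      ennreal c * (\<integral>\<^sup>+h\<in>{0..<\<delta>}. F (cis h) \<partial>lborel) \<le> (\<integral>\<^sup>+u. (\<integral>\<^sup>+v. F (u * cnj v) \<partial>m) \<partial>m)"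
proof -
  define T where "T \<theta> = \<tau> (abs_torus \<theta>)" for \<theta>
  have [measurable]: "T \<in> borel_measurable borel" unfolding T_def by measurable
  define E where "E n = {\<theta> \<in> {0..<2*pi}. inverse (real (Suc n)) \<le> T \<theta>}" for n
  have [measurable]: "E n \<in> sets borel" for n unfolding E_def by measurable
  have "\<exists>n. emeasure lborel (E n) > 0"
  proof (rule ccontr)
    assume "\<not> (\<exists>n. emeasure lborel (E n) > 0)"
    then have "E n \<in> null_sets lborel" for n by (auto simp: null_sets_def not_gr_zero)
    then have "(\<Union>n. E n) \<in> null_sets lborel" by (rule null_sets_UN)
    then have ae: "AE \<theta> in lborel. \<theta> \<notin> (\<Union>n. E n)" by (rule AE_not_in)
    have "(\<integral>\<^sup>+\<theta>\<in>{0..<2*pi}. ennreal (T \<theta>) * 1 \<partial>lborel) = (\<integral>\<^sup>+\<theta>. 0 \<partial>(lborel :: real measure))"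
    proof (rule nn_integral_cong_AE)
      show "AE \<theta> in lborel. ennreal (T \<theta>) * 1 * indicator {0..<2*pi} \<theta> = 0"
        using ae
      proof eventually_elim
        case (elim \<theta>)
        have "T \<theta> \<le> 0" if "\<theta> \<in> {0..<2*pi}"
        proof (rule ccontr)
          assume "\<not> T \<theta> \<le> 0"
          then obtain n where "inverse (real (Suc n)) < T \<theta>" using reals_Archimedean[of "T \<theta>"] by auto
          then have "\<theta> \<in> E n" using that by (simp add: E_def)
          then show False using elim by blast
        qed
        then show ?case by (auto simp: ennreal_neg split: split_indicator)
      qed
    qed
    moreover have "(\<integral>\<^sup>+u. 1 \<partial>m) = 1" by (simp add: law.emeasure_space_1)
    ultimately show False using nn_integral_m[of "\<lambda>_. 1"] by (simp add: T_def)
  qed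
  then obtain n where n: "emeasure lborel (E n) > 0" by blast
  define A where "A = E n"
  define b where "b = inverse (real (Suc n))"
  have b: "0 < b" by (simp add: b_def)
  have A[measurable]: "A \<in> sets borel" by (simp add: A_def)
  have "A \<subseteq> {0..2*pi}" by (auto simp: A_def E_def)
  then have "bounded A" by (rule bounded_subset[OF bounded_closed_interval])
  then obtain c \<delta> where c: "0 < c" "0 < \<delta>"
    "\<And>h. 0 \<le> h \<Longrightarrow> h < \<delta> \<Longrightarrow> ennreal c \<le> (\<integral>\<^sup>+\<theta>. indicator A \<theta> * indicator A (\<theta> + h) \<partial>lborel)"
    using overlap_translate[OF A] n unfolding A_def by blast
  have Tb: "ennreal b * indicator A \<theta> \<le> ennreal (T \<theta>) * indicator {0..<2*pi} \<theta>" for \<theta>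
    by (auto simp: A_def E_def b_def indicator_def intro!: ennreal_leI)
  show ?thesis
  proof (rule that[of "b * b * c" \<delta>])
    show "0 < b * b * c" using b c by simp
    show "0 < \<delta>" by (rule c)
    fix F :: "complex \<Rightarrow> ennreal" assume [measurable]: "F \<in> borel_measurable borel"
    let ?G = "\<lambda>\<theta> h. indicator A \<theta> * indicator A (\<theta> + h) * F (cis h)"
    have inner: "ennreal b * (\<integral>\<^sup>+h. indicator A (\<theta> + h) * F (cis h) \<partial>lborel) \<le> (\<integral>\<^sup>+v. F (cis (- \<theta>) * cnj v) \<partial>m)" for \<theta>
    proof -
      have "ennreal b * (\<integral>\<^sup>+h. indicator A (\<theta> + h) * F (cis h) \<partial>lborel)
        = (\<integral>\<^sup>+h. ennreal b * (indicator A (\<theta> + 1 * h) * F (cis (\<theta> + 1 * h - \<theta>))) \<partial>lborel)"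
        by (subst nn_integral_cmult) (auto intro!: arg_cong2[of _ _ _ _ "(*)"] nn_integral_cong)
      also have "\<dots> = (\<integral>\<^sup>+\<theta>'. ennreal b * (indicator A \<theta>' * F (cis (\<theta>' - \<theta>))) \<partial>lborel)"
        using nn_integral_real_affine[of "\<lambda>\<theta>'. ennreal b * (indicator A \<theta>' * F (cis (\<theta>' - \<theta>)))" 1 \<theta>] by simp
      also have "\<dots> \<le> (\<integral>\<^sup>+\<theta>'\<in>{0..<2*pi}. ennreal (T \<theta>') * F (cis (\<theta>' - \<theta>)) \<partial>lborel)"
      proof (rule nn_integral_mono)
        fix \<theta>'
        have "(ennreal b * indicator A \<theta>') * F (cis (\<theta>' - \<theta>)) \<le> (ennreal (T \<theta>') * indicator {0..<2*pi} \<theta>') * F (cis (\<theta>' - \<theta>))"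
          by (rule mult_right_mono[OF Tb]) simp
        then show "ennreal b * (indicator A \<theta>' * F (cis (\<theta>' - \<theta>))) \<le> ennreal (T \<theta>') * F (cis (\<theta>' - \<theta>)) * indicator {0..<2*pi} \<theta>'"
          by (simp add: mult_ac)
      qed
      also have "\<dots> = (\<integral>\<^sup>+v. F (cis (- \<theta>) * cnj v) \<partial>m)"
      proof -
        have "(\<integral>\<^sup>+v. F (cis (- \<theta>) * cnj v) \<partial>m)
          = (\<integral>\<^sup>+\<theta>'\<in>{0..<2*pi}. ennreal (T \<theta>') * F (cis (- \<theta>) * cnj (cis (- \<theta>'))) \<partial>lborel)"
          unfolding T_def by (rule nn_integral_m[of "\<lambda>v. F (cis (- \<theta>) * cnj v)"]) measurable
        then show ?thesis by (simp add: cis_cnj cis_mult)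
      qed
      finally show ?thesis .
    qed
    have "ennreal (b * b * c) * (\<integral>\<^sup>+h\<in>{0..<\<delta>}. F (cis h) \<partial>lborel)
      = ennreal (b * b) * (\<integral>\<^sup>+h\<in>{0..<\<delta>}. ennreal c * F (cis h) \<partial>lborel)"
      using b c by (subst (2) mult.assoc, subst nn_integral_cmult) (auto simp: ennreal_mult mult.assoc)
    also have "\<dots> \<le> ennreal (b * b) * (\<integral>\<^sup>+h. (\<integral>\<^sup>+\<theta>. ?G \<theta> h \<partial>lborel) \<partial>lborel)"
    proof (rule mult_left_mono, rule nn_integral_mono)
      fix h
      have "(\<integral>\<^sup>+\<theta>. ?G \<theta> h \<partial>lborel) = (\<integral>\<^sup>+\<theta>. indicator A \<theta> * indicator A (\<theta> + h) \<partial>lborel) * F (cis h)"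
        by (rule nn_integral_multc) measurable
      then show "ennreal c * F (cis h) * indicator {0..<\<delta>} h \<le> (\<integral>\<^sup>+\<theta>. ?G \<theta> h \<partial>lborel)"
        using c(3)[of h] by (auto simp: indicator_def intro!: mult_right_mono)
    qed simp
    also have "(\<integral>\<^sup>+h. (\<integral>\<^sup>+\<theta>. ?G \<theta> h \<partial>lborel) \<partial>lborel) = (\<integral>\<^sup>+\<theta>. (\<integral>\<^sup>+h. ?G \<theta> h \<partial>lborel) \<partial>lborel)"
      by (rule lborel_pair.Fubini') measurable
    also have "ennreal (b * b) * \<dots> = (\<integral>\<^sup>+\<theta>. ennreal b * indicator A \<theta> * (ennreal b * (\<integral>\<^sup>+h. indicator A (\<theta> + h) * F (cis h) \<partial>lborel)) \<partial>lborel)"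
    proof -
      define J where "J \<theta> = (\<integral>\<^sup>+h. indicator A (\<theta> + h) * F (cis h) \<partial>lborel)" for \<theta>
      have [measurable]: "J \<in> borel_measurable borel" unfolding J_def by measurable
      have "(\<integral>\<^sup>+h. ?G \<theta> h \<partial>lborel) = indicator A \<theta> * J \<theta>" for \<theta>
        unfolding J_def mult.assoc by (rule nn_integral_cmult) measurable
      then have "ennreal (b * b) * (\<integral>\<^sup>+\<theta>. (\<integral>\<^sup>+h. ?G \<theta> h \<partial>lborel) \<partial>lborel)
        = ennreal (b * b) * (\<integral>\<^sup>+\<theta>. indicator A \<theta> * J \<theta> \<partial>lborel)" by simp
      also have "\<dots> = (\<integral>\<^sup>+\<theta>. ennreal (b * b) * (indicator A \<theta> * J \<theta>) \<partial>lborel)"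
        by (rule nn_integral_cmult[symmetric]) measurable
      also have "\<dots> = (\<integral>\<^sup>+\<theta>. ennreal b * indicator A \<theta> * (ennreal b * J \<theta>) \<partial>lborel)"
        using b by (simp add: ennreal_mult mult_ac)
      finally show ?thesis unfolding J_def .
    qed
    also have "\<dots> \<le> (\<integral>\<^sup>+\<theta>\<in>{0..<2*pi}. ennreal (T \<theta>) * (\<integral>\<^sup>+v. F (cis (- \<theta>) * cnj v) \<partial>m) \<partial>lborel)"
    proof (rule nn_integral_mono)
      fix \<theta>
      have "(ennreal b * indicator A \<theta>) * (ennreal b * (\<integral>\<^sup>+h. indicator A (\<theta> + h) * F (cis h) \<partial>lborel))
        \<le> (ennreal (T \<theta>) * indicator {0..<2*pi} \<theta>) * (\<integral>\<^sup>+v. F (cis (- \<theta>) * cnj v) \<partial>m)"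
        by (rule mult_mono[OF Tb inner]) simp_all
      then show "ennreal b * indicator A \<theta> * (ennreal b * (\<integral>\<^sup>+h. indicator A (\<theta> + h) * F (cis h) \<partial>lborel))
        \<le> ennreal (T \<theta>) * (\<integral>\<^sup>+v. F (cis (- \<theta>) * cnj v) \<partial>m) * indicator {0..<2*pi} \<theta>"
        by (simp only: mult_ac)
    qed
    also have "\<dots> = (\<integral>\<^sup>+u. (\<integral>\<^sup>+v. F (u * cnj v) \<partial>m) \<partial>m)"
      unfolding T_def by (rule nn_integral_m[of "\<lambda>u. \<integral>\<^sup>+v. F (u * cnj v) \<partial>m", symmetric]) measurable
    finally show "ennreal (b * b * c) * (\<integral>\<^sup>+h\<in>{0..<\<delta>}. F (cis h) \<partial>lborel) \<le> (\<integral>\<^sup>+u. (\<integral>\<^sup>+v. F (u * cnj v) \<partial>m) \<partial>m)" .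
  qed
qed

end

section \<open>Expectation of the scattering states\<close>

lemma measurable_refl:
  assumes [measurable]: "\<And>e. p e \<in> borel_measurable M" "\<And>e. q e \<in> borel_measurable M" "z \<in> borel_measurable M"
  shows "(\<lambda>x. refl r (\<lambda>e. p e x) (\<lambda>e. q e x) (z x) d) \<in> borel_measurable M"
  by (induction d) simp_all

lemma measurable_refl_arg:
  assumes [measurable]: "\<And>e. p e \<in> borel_measurable M" "\<And>e. q e \<in> borel_measurable M" "z \<in> borel_measurable M"
  shows "(\<lambda>x. refl_arg r (\<lambda>e. p e x) (\<lambda>e. q e x) (z x) d) \<in> borel_measurable M"
proof -
  note [measurable] = measurable_refl[of p M q z, OF assms]
  show ?thesis unfolding refl_arg_def by measurable
qed

lemma measurable_wave_joint:
  assumes [measurable]: "\<And>e. p e \<in> borel_measurable M" "\<And>e. q e \<in> borel_measurable M" "z \<in> borel_measurable M"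
  shows "(\<lambda>x. wave r t (\<lambda>e. p e x) (\<lambda>e. q e x) D (z x) u) \<in> borel_measurable M"
proof -
  note [measurable] = measurable_refl[of p M q z, OF assms] measurable_refl_arg[of p M q z, OF assms]
  show ?thesis by (cases u) (simp_all add: wave_def)
qed

text \<open>The Markov property: the reflection coefficient at distance \<open>d\<close> does not
  see the phases with index \<open>d\<close> or beyond.\<close>

lemma refl_cong:
  "(\<And>e. e < d \<Longrightarrow> p e = p' e) \<Longrightarrow> (\<And>e. e < d \<Longrightarrow> q e = q' e) \<Longrightarrow> refl r p q z d = refl r p' q' z d"
  by (induction d) simp_all

context phase_law
begin

interpretation \<mu>: prob_space \<mu> by (rule prob_\<mu>)

abbreviation P :: "(int \<Rightarrow> torus) measure"
  where "P \<equiv> \<Pi>\<^sub>M i\<in>(UNIV :: int set). \<mu>"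

interpretation env: prob_space P
  by (rule prob_space_PiM) (rule prob_\<mu>)

text \<open>Redrawing one coordinate independently preserves the product measure. A phase can thus
  be integrated out without splitting the index set.\<close>

lemma nn_integral_resample:
  assumes F [measurable]: "F \<in> borel_measurable P"
  shows "(\<integral>\<^sup>+\<omega>. F \<omega> \<partial>P) = (\<integral>\<^sup>+\<omega>. (\<integral>\<^sup>+x. F (fun_upd \<omega> i x) \<partial>\<mu>) \<partial>P)"
proof -
  interpret PP: pair_prob_space \<mu> P ..
  have upd: "(\<lambda>(x, X). fun_upd X i x) \<in> measurable (\<mu> \<Otimes>\<^sub>M P) P"
  proof -
    have "(\<lambda>y. fun_upd (snd y) i (fst y)) \<in> measurable (\<mu> \<Otimes>\<^sub>M P) P"
      by (rule measurable_fun_upd[of _ UNIV]) auto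
    then show ?thesis by (simp add: split_beta')
  qed
  have "distr (\<mu> \<Otimes>\<^sub>M P) P (\<lambda>(x, X). fun_upd X i x) = P"
    using distr_pair_PiM_eq_PiM[of UNIV "\<lambda>_. \<mu>" i] prob_\<mu> by simp
  then have "(\<integral>\<^sup>+\<omega>. F \<omega> \<partial>P) = (\<integral>\<^sup>+\<omega>. F \<omega> \<partial>(distr (\<mu> \<Otimes>\<^sub>M P) P (\<lambda>(x, X). fun_upd X i x)))"
    by simp
  also have "\<dots> = (\<integral>\<^sup>+y. F ((\<lambda>(x, X). fun_upd X i x) y) \<partial>(\<mu> \<Otimes>\<^sub>M P))"
    by (rule nn_integral_distr[OF upd]) simp
  also have "\<dots> = (\<integral>\<^sup>+\<omega>. (\<integral>\<^sup>+x. F (fun_upd \<omega> i x) \<partial>\<mu>) \<partial>P)"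
    by (subst PP.nn_integral_snd[symmetric]) (use measurable_compose[OF upd F] in simp_all)
  finally show ?thesis .
qed

lemma measurable_phases [measurable]:
  "(\<lambda>\<omega>. phase_Up \<omega> n) \<in> borel_measurable P" "(\<lambda>\<omega>. phase_Down \<omega> n) \<in> borel_measurable P"
  unfolding phase_Up_def phase_Down_def by measurable

text \<open>Two convolutions, since the round trip between neighbouring sites picks up two
  independent phases, one in each direction.\<close>

definition KK :: "(complex \<Rightarrow> real) \<Rightarrow> complex \<Rightarrow> real"
  where "KK f = Kop m (Kop m f)"

lemma bounded_measurable_KK: "bounded_measurable f \<Longrightarrow> bounded_measurable (KK f)"
  unfolding KK_def by (intro law.bounded_measurable_Kop)

lemma Kop_nonneg: "(\<And>z. 0 \<le> f z) \<Longrightarrow> 0 \<le> Kop m f z"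
  unfolding Kop_def by (rule Bochner_Integration.integral_nonneg)

lemma KK_nonneg: "(\<And>z. 0 \<le> f z) \<Longrightarrow> 0 \<le> KK f z"
  unfolding KK_def by (intro Kop_nonneg)

lemma nn_integral_KK:
  assumes f: "bounded_measurable f" and nonneg: "\<And>z. 0 \<le> f z"
  shows "(\<integral>\<^sup>+x. (\<integral>\<^sup>+y. ennreal (f (torus_phase x * torus_phase y * s)) \<partial>\<mu>) \<partial>\<mu>) = ennreal (KK f s)"
proof -
  note [measurable] = bounded_measurable_measurable[OF f] bounded_measurable_measurable[OF law.bounded_measurable_Kop[OF f]]
  have K: "(\<integral>\<^sup>+y. ennreal (g (torus_phase y * w)) \<partial>\<mu>) = ennreal (Kop m g w)"
    if g: "bounded_measurable g" and g0: "\<And>z. 0 \<le> g z" for g w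
  proof -
    note [measurable] = bounded_measurable_measurable[OF g]
    have "(\<integral>\<^sup>+y. ennreal (g (torus_phase y * w)) \<partial>\<mu>) = (\<integral>\<^sup>+u. ennreal (g (u * w)) \<partial>m)"
      unfolding m_def by (rule nn_integral_distr[symmetric]) measurable
    also have "\<dots> = ennreal (Kop m g w)"
      unfolding Kop_def by (rule nn_integral_eq_integral[OF law.Kop_integrable[OF g]]) (simp add: g0)
    finally show ?thesis .
  qed
  have "(\<integral>\<^sup>+y. ennreal (f (torus_phase x * torus_phase y * s)) \<partial>\<mu>) = ennreal (Kop m f (torus_phase x * s))" for x
    using K[OF f nonneg, of "torus_phase x * s"] by (simp add: mult_ac)
  then show ?thesis
    using K[OF law.bounded_measurable_Kop[OF f] Kop_nonneg[OF nonneg], of s] by (simp add: KK_def)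
qed

lemma mean_KK: "bounded_measurable f \<Longrightarrow> mean (KK f) = mean f"
  unfolding KK_def by (simp add: law.mean_Kop law.bounded_measurable_Kop)

lemma norm_KK_le: "bounded_measurable f \<Longrightarrow> sqnorm (KK f) \<le> sqnorm f"
  unfolding KK_def by (rule order_trans[OF law.norm_Kop_le[OF law.bounded_measurable_Kop] law.norm_Kop_le])

text \<open>Averaging over a law with bounded density turns a mean into a pointwise bound; this is
  done for the outer convolution, while the inner one preserves the mean.\<close>

lemma KK_sup_bound:
  obtains B where "1 \<le> B" "\<And>f s. bounded_measurable f \<Longrightarrow> (\<And>z. 0 \<le> f z) \<Longrightarrow> cmod s = 1 \<Longrightarrow>
    KK f s \<le> B * mean f"
proof -
  obtain B where B: "1 \<le> B" "\<And>F. F \<in> borel_measurable borel \<Longrightarrow> (\<integral>\<^sup>+u. F u \<partial>m) \<le> ennreal B * (\<integral>\<^sup>+z. F z \<partial>circle_measure)"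
    by (rule density_bound) blast
  have K: "Kop m f s \<le> B * mean f"
    if f: "bounded_measurable f" and f0: "\<And>z. 0 \<le> f z" and s: "cmod s = 1" for f s
  proof -
    note [measurable] = bounded_measurable_measurable[OF f]
    have i0: "0 \<le> mean f" using f0 by simp
    have "ennreal (Kop m f s) = (\<integral>\<^sup>+u. ennreal (f (u * s)) \<partial>m)"
      unfolding Kop_def by (rule nn_integral_eq_integral[OF law.Kop_integrable[OF f], symmetric]) (simp add: f0)
    also have "\<dots> \<le> ennreal B * (\<integral>\<^sup>+u. ennreal (f (u * s)) \<partial>circle_measure)"
      by (rule B(2)) measurable
    also have "(\<integral>\<^sup>+u. ennreal (f (u * s)) \<partial>circle_measure) = (\<integral>\<^sup>+z. ennreal (f z) \<partial>circle_measure)"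
      using nn_integral_circle_rotate[OF s, of "\<lambda>z. ennreal (f z)"] by (simp add: mult.commute)
    also have "\<dots> = ennreal (mean f)"
      by (rule nn_integral_eq_integral[OF bounded_measurable_integrable[OF f]]) (simp add: f0)
    also have "ennreal B * \<dots> = ennreal (B * mean f)"
      using B(1) i0 by (simp add: ennreal_mult)
    finally show ?thesis using B(1) i0 by (subst (asm) ennreal_le_iff) auto
  qed
  show ?thesis
  proof (rule that[OF B(1)])
    fix f :: "complex \<Rightarrow> real" and s :: complex
    assume f: "bounded_measurable f" "\<And>z. 0 \<le> f z" "cmod s = 1"
    show "KK f s \<le> B * mean f"
      using K[OF law.bounded_measurable_Kop[OF f(1)] Kop_nonneg[OF f(2)] f(3)]
      by (simp add: KK_def law.mean_Kop[OF f(1)])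
  qed
qed

context
  fixes r t :: real
  assumes r: "0 < r" "r < 1" and t: "0 < t" and rt: "r\<^sup>2 + t\<^sup>2 = 1"
begin

lemma KK_contraction:
  "\<exists>q. 0 < q \<and> q < 1 \<and> (\<forall>f c. bounded_measurable f \<longrightarrow> cmod c = 1 \<longrightarrow>
    sqnorm (KK (Vop r t (\<lambda>z. KK f (c * z)))) \<le> q * sqnorm f)"
proof -
  obtain c \<delta> where c: "0 < c" "0 < \<delta>" "\<And>F :: complex \<Rightarrow> ennreal. F \<in> borel_measurable borel \<Longrightarrow>
      ennreal c * (\<integral>\<^sup>+h\<in>{0..<\<delta>}. F (cis h) \<partial>lborel) \<le> (\<integral>\<^sup>+u. (\<integral>\<^sup>+v. F (u * cnj v) \<partial>m) \<partial>m)"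
    by (rule spread) blast
  obtain C where C: "0 < C" "\<And>f. bounded_measurable f \<Longrightarrow>
    sqnorm f - (mean f)\<^sup>2
      \<le> C * (sqnorm f - sqnorm (Kop m f))"
    using law.poincare[OF c] by blast
  show ?thesis
  proof (rule contraction[OF r t rt _ _ _ C(1)])
    show "KK (\<lambda>z. f z - a) = (\<lambda>z. KK f z - a)" if "bounded_measurable f" for f a
      unfolding KK_def using that by (simp add: law.Kop_diff_const law.bounded_measurable_Kop)
    fix f assume f: "bounded_measurable f"
    have "sqnorm f - (mean f)\<^sup>2
      \<le> C * (sqnorm f - sqnorm (Kop m f))"
      by (rule C(2)[OF f])
    also have "\<dots> \<le> C * (sqnorm f - sqnorm (KK f))"
      unfolding KK_def using C(1) law.norm_Kop_le[OF law.bounded_measurable_Kop[OF f]] by (intro mult_left_mono) auto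
    finally show "sqnorm f - (mean f)\<^sup>2
      \<le> C * (sqnorm f - sqnorm (KK f))" .
  qed (auto intro: bounded_measurable_KK norm_KK_le)
qed

abbreviation "pU L \<omega> \<equiv> (\<lambda>e. phase_Up \<omega> (L - int e - 1))"
abbreviation "pD L \<omega> \<equiv> (\<lambda>e. phase_Down \<omega> (L - int e))"

text \<open>One step of the chain: the two phases entering at distance \<open>d\<close> are integrated out.\<close>

definition Tstep :: "complex \<Rightarrow> nat \<Rightarrow> (complex \<Rightarrow> real) \<Rightarrow> complex \<Rightarrow> real"
  where "Tstep z k G s = KK (\<lambda>y. kap r t y ^ k * G (mob r y)) (z\<^sup>2 * s)"

lemma bounded_measurable_weight:
  assumes G: "bounded_measurable G" shows "bounded_measurable (\<lambda>y. kap r t y ^ k * G (mob r y))"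
proof -
  have "bounded_measurable (\<lambda>y. kap r t y ^ k)"
    by (induction k) (simp_all add: bounded_measurable_mult bounded_measurable_kap[OF r t])
  then show ?thesis by (rule bounded_measurable_mult) (rule bounded_measurable_comp[OF G], simp)
qed

lemma bounded_measurable_Tstep: "bounded_measurable G \<Longrightarrow> bounded_measurable (Tstep z k G)"
  unfolding Tstep_def[abs_def] by (intro bounded_measurable_rotate bounded_measurable_KK bounded_measurable_weight)

lemma Tstep_nonneg: "(\<And>z. 0 \<le> G z) \<Longrightarrow> 0 \<le> Tstep z k G s"
  unfolding Tstep_def using kap_nonneg[OF t] by (intro KK_nonneg) simp

text \<open>\<open>G\<close> is the part beyond distance \<open>d\<close>, already integrated out,
  as a function of the reflection coefficient at \<open>d\<close>. Leaving the exponents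
  \<open>k\<close> free makes one recursion serve all three stretches of the chain.\<close>

definition Ex :: "int \<Rightarrow> complex \<Rightarrow> (nat \<Rightarrow> nat) \<Rightarrow> nat \<Rightarrow> (complex \<Rightarrow> real) \<Rightarrow> ennreal"
  where "Ex L z k d G = (\<integral>\<^sup>+\<omega>. ennreal (G (refl r (pU L \<omega>) (pD L \<omega>) z d)
    * (\<Prod>e<d. kap r t (refl_arg r (pU L \<omega>) (pD L \<omega>) z e) ^ k e)) \<partial>P)"

lemma measurable_refl_P [measurable]: "(\<lambda>\<omega>. refl r (pU L \<omega>) (pD L \<omega>) z d) \<in> borel_measurable P"
  by (rule measurable_refl) measurable

lemma measurable_refl_arg_P [measurable]: "(\<lambda>\<omega>. refl_arg r (pU L \<omega>) (pD L \<omega>) z d) \<in> borel_measurable P"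
  by (rule measurable_refl_arg) measurable

text \<open>The phases with index \<open>d\<close> enter the integrand only through
  \<open>refl_arg\<close> at \<open>d\<close>. Redrawing both leaves \<open>?W\<close> and the
  reflection coefficient at \<open>d\<close> untouched, and their average is
  \<open>KK\<close>.\<close>

lemma Ex_Suc:
  assumes G: "bounded_measurable G" and G0: "\<And>z. 0 \<le> G z"
  shows "Ex L z k (Suc d) G = Ex L z k d (Tstep z (k d) G)"
proof -
  note [measurable] = bounded_measurable_measurable[OF G]
  define f where "f y = kap r t y ^ k d * G (mob r y)" for y
  have f: "bounded_measurable f" unfolding f_def by (rule bounded_measurable_weight[OF G])
  have f0: "0 \<le> f y" for y using kap_nonneg[OF t] G0 by (simp add: f_def)
  note [measurable] = bounded_measurable_measurable[OF f]
  let ?S = "\<lambda>\<omega> e. refl r (pU L \<omega>) (pD L \<omega>) z e"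
  let ?m = "\<lambda>\<omega> e. refl_arg r (pU L \<omega>) (pD L \<omega>) z e"
  let ?W = "\<lambda>\<omega>. \<Prod>e<d. kap r t (?m \<omega> e) ^ k e"
  have W0: "0 \<le> ?W \<omega>" for \<omega> using kap_nonneg[OF t] by (intro prod_nonneg) simp
  \<comment> \<open>\<open>i\<close> and \<open>j\<close> are the coordinates of \<omega> that carry
    the phases \<open>pU L \<omega> d\<close> and \<open>pD L \<omega> d\<close>.\<close>
  define i where "i = 2 * (L - int d - 1)"
  define j where "j = 2 * (L - int d) + 1"
  define F where "F \<omega> = ennreal (?W \<omega>) * ennreal (f (z\<^sup>2 * (pU L \<omega> d * pD L \<omega> d) * ?S \<omega> d))" for \<omega>
  have [measurable]: "F \<in> borel_measurable P" unfolding F_def by measurable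
  have ij: "i \<noteq> j" unfolding i_def j_def by presburger
  have ne: "2 * (L - int e - 1) \<noteq> i" "2 * (L - int e - 1) \<noteq> j" "2 * (L - int e) + 1 \<noteq> i" "2 * (L - int e) + 1 \<noteq> j"
    if "e < d" for e
    using that unfolding i_def j_def by presburger+
  have upd: "?S (fun_upd (fun_upd \<omega> i x) j y) e = ?S \<omega> e" "pU L (fun_upd (fun_upd \<omega> i x) j y) e' = pU L \<omega> e'"
    "pD L (fun_upd (fun_upd \<omega> i x) j y) e' = pD L \<omega> e'" if "e \<le> d" "e' < d" for \<omega> x y e e'
  proof -
    have pq: "pU L (fun_upd (fun_upd \<omega> i x) j y) e' = pU L \<omega> e'" "pD L (fun_upd (fun_upd \<omega> i x) j y) e' = pD L \<omega> e'" if "e' < d" for e'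
      by (simp_all only: phase_Up_def phase_Down_def fun_upd_apply ne[OF that] if_False)
    show "pU L (fun_upd (fun_upd \<omega> i x) j y) e' = pU L \<omega> e'" "pD L (fun_upd (fun_upd \<omega> i x) j y) e' = pD L \<omega> e'" using pq that by auto
    show "?S (fun_upd (fun_upd \<omega> i x) j y) e = ?S \<omega> e" using that by (intro refl_cong pq) auto
  qed
  have at_d: "pU L (fun_upd (fun_upd \<omega> i x) j y) d = torus_phase x" "pD L (fun_upd (fun_upd \<omega> i x) j y) d = torus_phase y" for \<omega> x y
    by (simp_all only: phase_Up_def phase_Down_def i_def[symmetric] j_def[symmetric] fun_upd_apply ij if_False if_True refl)
  have Wupd: "?W (fun_upd (fun_upd \<omega> i x) j y) = ?W \<omega>" for \<omega> x y
  proof (rule prod.cong[OF refl])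
    fix e assume "e \<in> {..<d}"
    then have e: "e < d" "e \<le> d" by auto
    show "kap r t (?m (fun_upd (fun_upd \<omega> i x) j y) e) ^ k e = kap r t (?m \<omega> e) ^ k e"
      unfolding refl_arg_def using upd[OF e(2) e(1)] by (simp only:)
  qed
  have "Ex L z k (Suc d) G = (\<integral>\<^sup>+\<omega>. F \<omega> \<partial>P)"
    unfolding Ex_def F_def
  proof (rule nn_integral_cong)
    fix \<omega>
    have "G (?S \<omega> (Suc d)) * (\<Prod>e<Suc d. kap r t (?m \<omega> e) ^ k e) = ?W \<omega> * f (?m \<omega> d)"
      by (simp add: f_def refl_arg_def mult_ac)
    then show "ennreal (G (?S \<omega> (Suc d)) * (\<Prod>e<Suc d. kap r t (?m \<omega> e) ^ k e))
        = ennreal (?W \<omega>) * ennreal (f (z\<^sup>2 * (pU L \<omega> d * pD L \<omega> d) * ?S \<omega> d))"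
      using W0[of \<omega>] f0 by (simp only: ennreal_mult refl_arg_def)
  qed
  also have "\<dots> = (\<integral>\<^sup>+\<omega>. (\<integral>\<^sup>+y. F (fun_upd \<omega> j y) \<partial>\<mu>) \<partial>P)"
    by (rule nn_integral_resample) measurable
  also have "\<dots> = (\<integral>\<^sup>+\<omega>. (\<integral>\<^sup>+x. (\<integral>\<^sup>+y. F (fun_upd (fun_upd \<omega> i x) j y) \<partial>\<mu>) \<partial>\<mu>) \<partial>P)"
  proof (rule nn_integral_resample)
    have "(\<lambda>y. F (fun_upd (fst y) j (snd y))) \<in> borel_measurable (P \<Otimes>\<^sub>M \<mu>)"
      by (rule measurable_compose[OF measurable_fun_upd[of _ UNIV]]) auto
    then show "(\<lambda>\<omega>. \<integral>\<^sup>+y. F (fun_upd \<omega> j y) \<partial>\<mu>) \<in> borel_measurable P"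
      by (intro \<mu>.borel_measurable_nn_integral) (simp add: split_beta')
  qed
  also have "\<dots> = (\<integral>\<^sup>+\<omega>. ennreal (?W \<omega>) * ennreal (KK f (z\<^sup>2 * ?S \<omega> d)) \<partial>P)"
  proof (rule nn_integral_cong)
    fix \<omega>
    have "F (fun_upd (fun_upd \<omega> i x) j y) = ennreal (?W \<omega>) * ennreal (f (torus_phase x * torus_phase y * (z\<^sup>2 * ?S \<omega> d)))" for x y
    proof -
      have S: "?S (fun_upd (fun_upd \<omega> i x) j y) d = ?S \<omega> d"
        by (rule refl_cong) (simp_all only: phase_Up_def phase_Down_def fun_upd_apply ne if_False)
      show ?thesis unfolding F_def Wupd at_d S by (simp only: mult_ac)
    qed
    then have "(\<integral>\<^sup>+x. (\<integral>\<^sup>+y. F (fun_upd (fun_upd \<omega> i x) j y) \<partial>\<mu>) \<partial>\<mu>)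
      = ennreal (?W \<omega>) * (\<integral>\<^sup>+x. (\<integral>\<^sup>+y. ennreal (f (torus_phase x * torus_phase y * (z\<^sup>2 * ?S \<omega> d))) \<partial>\<mu>) \<partial>\<mu>)"
      by (simp add: nn_integral_cmult)
    then show "(\<integral>\<^sup>+x. (\<integral>\<^sup>+y. F (fun_upd (fun_upd \<omega> i x) j y) \<partial>\<mu>) \<partial>\<mu>) = ennreal (?W \<omega>) * ennreal (KK f (z\<^sup>2 * ?S \<omega> d))"
      by (simp only: nn_integral_KK[OF f f0])
  qed
  also have "\<dots> = Ex L z k d (Tstep z (k d) G)"
    unfolding Ex_def Tstep_def f_def[symmetric] using W0 KK_nonneg[OF f0]
    by (intro nn_integral_cong) (simp add: ennreal_mult[symmetric] mult.commute)
  finally show ?thesis .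
qed

lemma Tstep_1: "Tstep z 1 G = (\<lambda>s. KK (Vop r t G) (z\<^sup>2 * s))"
  by (simp add: Tstep_def[abs_def] Vop_def[abs_def])

lemma norm_rotate:
  assumes "bounded_measurable f" "cmod c = 1"
  shows "(\<integral>z. (f (c * z))\<^sup>2 \<partial>circle_measure) = sqnorm f"
  by (rule integral_circle_rotate[OF assms(2), of "\<lambda>z. (f z)\<^sup>2"])
    (rule bounded_measurable_measurable[OF bounded_measurable_power2[OF assms(1)]])

lemma norm_Tstep_1:
  assumes G: "bounded_measurable G" and z: "cmod z = 1"
  shows "sqnorm (Tstep z 1 G) \<le> sqnorm G"
proof -
  have V: "bounded_measurable (Vop r t G)" by (rule bounded_measurable_Vop[OF r t G])
  have "sqnorm (Tstep z 1 G) = sqnorm (KK (Vop r t G))"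
    unfolding Tstep_1 using z by (intro norm_rotate bounded_measurable_KK V) (simp add: norm_power)
  also have "\<dots> \<le> sqnorm (Vop r t G)" by (rule norm_KK_le[OF V])
  also have "\<dots> = sqnorm G" by (rule norm_Vop[OF r t rt G])
  finally show ?thesis .
qed

lemma mean_le_norm:
  assumes G: "bounded_measurable G"
  shows "mean G \<le> sqrt (sqnorm G)"
proof (rule real_le_rsqrt)
  have "0 \<le> sqnorm G - (mean G)\<^sup>2"
    using circle.variance_eq[OF bounded_measurable_integrable[OF G] bounded_measurable_integrable[OF bounded_measurable_power2[OF G]]]
    by (metis circle.variance_positive)
  then show "(mean G)\<^sup>2 \<le> sqnorm G" by simp
qed

lemma norm_refl_P: "cmod z = 1 \<Longrightarrow> cmod (refl r (pU L \<omega>) (pD L \<omega>) z d) = 1"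
proof -
  interpret ch: chain r t "pU L \<omega>" "pD L \<omega>" 0
    by unfold_locales (use r t rt in auto)
  show "cmod z = 1 \<Longrightarrow> cmod (refl r (pU L \<omega>) (pD L \<omega>) z d) = 1" by (rule ch.norm_S)
qed

lemma norm_wave_Inl:
  assumes "cmod z = 1"
  shows "cmod (wave r t (pU L \<omega>) (pD L \<omega>) D z (Inl d)) = (\<Prod>e\<in>{d..<D}. kap r t (refl_arg r (pU L \<omega>) (pD L \<omega>) z e))"
    and "cmod (wave r t (pU L \<omega>) (pD L \<omega>) D z (Inr d)) = cmod (wave r t (pU L \<omega>) (pD L \<omega>) D z (Inl d))"
proof -
  interpret ch: chain r t "pU L \<omega>" "pD L \<omega>" D
    by unfold_locales (use r t rt in auto)
  show "cmod (wave r t (pU L \<omega>) (pD L \<omega>) D z (Inl d)) = (\<Prod>e\<in>{d..<D}. kap r t (refl_arg r (pU L \<omega>) (pD L \<omega>) z e))"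
    unfolding ch.wave_Inl prod_norm[symmetric] using t
    by (intro prod.cong refl) (simp add: norm_divide norm_mult assms kap_circle ch.norm_m)
  show "cmod (wave r t (pU L \<omega>) (pD L \<omega>) D z (Inr d)) = cmod (wave r t (pU L \<omega>) (pD L \<omega>) D z (Inl d))"
    using assms by (simp add: ch.wave_Inr norm_mult ch.norm_S)
qed

section \<open>Estimates for the three stretches of the chain\<close>

context
  fixes B q :: real
  assumes B: "1 \<le> B" "\<And>f s. bounded_measurable f \<Longrightarrow> (\<And>z. 0 \<le> f z) \<Longrightarrow> cmod s = 1 \<Longrightarrow> KK f s \<le> B * mean f"
    and q: "0 < q" "\<And>f c. bounded_measurable f \<Longrightarrow> cmod c = 1 \<Longrightarrow>
    sqnorm (KK (Vop r t (\<lambda>z. KK f (c * z)))) \<le> q * sqnorm f"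
begin

text \<open>\<open>B\<close> is the price of a pointwise bound;
  \<open>((1 + r) / t)\<^sup>2\<close>, the largest value of the inverse Jacobian on the circle, is
  that of a change of variables without weight; the root bounds a mean by an $L^2$ norm.\<close>

abbreviation decay :: "real \<Rightarrow> ennreal"
  where "decay x \<equiv> ennreal (B * ((1 + r) / t)\<^sup>2 * sqrt x)"

lemma norm_Tstep_2:
  assumes G: "bounded_measurable G" and z: "cmod z = 1"
  shows "sqnorm (Tstep z 1 (Tstep z 1 G)) \<le> q * sqnorm G"
proof -
  have V: "bounded_measurable (Vop r t G)" by (rule bounded_measurable_Vop[OF r t G])
  have z2: "cmod (z\<^sup>2) = 1" using z by (simp add: norm_power)
  have "bounded_measurable (KK (Vop r t (\<lambda>s. KK (Vop r t G) (z\<^sup>2 * s))))"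
    by (intro bounded_measurable_KK bounded_measurable_Vop[OF r t] bounded_measurable_rotate V)
  then have "sqnorm (Tstep z 1 (Tstep z 1 G))
    = sqnorm (KK (Vop r t (\<lambda>s. KK (Vop r t G) (z\<^sup>2 * s))))"
    unfolding Tstep_1 by (rule norm_rotate[OF _ z2])
  also have "\<dots> \<le> q * sqnorm (Vop r t G)" by (rule q(2)[OF V z2])
  also have "sqnorm (Vop r t G) = sqnorm G" by (rule norm_Vop[OF r t rt G])
  finally show ?thesis .
qed

text \<open>A single smoothing step, the outermost one, turns the mean into a bound on the whole
  circle; the remaining unweighted steps are averages and preserve it. Hence the form
  \<open>Suc d\<close>, which guarantees one such step.\<close>

lemma Ex_unweighted:
  assumes G: "bounded_measurable G" and G0: "\<And>z. 0 \<le> G z" and z: "cmod z = 1" and k: "\<And>e. e < Suc d \<Longrightarrow> k e = 0"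
  shows "Ex L z k (Suc d) G \<le> decay (sqnorm G)"
proof -
  note [measurable] = bounded_measurable_measurable[OF G]
  have Gm: "bounded_measurable (\<lambda>y. G (mob r y))" by (rule bounded_measurable_comp[OF G]) simp
  have wt: "bounded_measurable (\<lambda>y. (kap r t y)\<^sup>2 * G (mob r y))" by (rule bounded_measurable_weight[OF G])
  have "(\<integral>y. G (mob r y) \<partial>circle_measure) \<le> (\<integral>y. ((1 + r) / t)\<^sup>2 * ((kap r t y)\<^sup>2 * G (mob r y)) \<partial>circle_measure)"
  proof (rule integral_mono_AE[OF bounded_measurable_integrable[OF Gm]])
    show "integrable circle_measure (\<lambda>y. ((1 + r) / t)\<^sup>2 * ((kap r t y)\<^sup>2 * G (mob r y)))"
      by (rule bounded_measurable_integrable[OF bounded_measurable_mult[OF bounded_measurable_const wt]])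
    show "AE y in circle_measure. G (mob r y) \<le> ((1 + r) / t)\<^sup>2 * ((kap r t y)\<^sup>2 * G (mob r y))"
      using AE_circle_measure
    proof eventually_elim
      case (elim y)
      have nz: "1 + of_real r * y \<noteq> 0" by (rule one_plus_ry_nonzero[OF r]) (simp add: elim)
      have "cmod (1 + of_real r * y) \<le> 1 + r"
        using norm_triangle_ineq[of 1 "of_real r * y"] elim r by (simp add: norm_mult)
      then have "1 \<le> (1 + r) / t * kap r t y"
        using nz t by (simp add: kap_circle[OF elim] le_divide_eq)
      then have "1 \<le> ((1 + r) / t * kap r t y)\<^sup>2" by (simp add: one_le_power)
      from mult_right_mono[OF this G0[of "mob r y"]] show ?case
        by (simp only: power_mult_distrib mult.assoc mult_1_left)
    qed
  qed
  also have "\<dots> = ((1 + r) / t)\<^sup>2 * mean G"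
    using integral_mob[OF r t rt, of G] by simp
  also have "\<dots> \<le> ((1 + r) / t)\<^sup>2 * sqrt (sqnorm G)"
    by (intro mult_left_mono mean_le_norm G) simp
  finally have mean: "(\<integral>y. G (mob r y) \<partial>circle_measure) \<le> ((1 + r) / t)\<^sup>2 * sqrt (sqnorm G)" .
  have T: "Tstep z 0 G s \<le> B * ((1 + r) / t)\<^sup>2 * sqrt (sqnorm G)" if "cmod s = 1" for s
  proof -
    have "Tstep z 0 G s \<le> B * (\<integral>y. G (mob r y) \<partial>circle_measure)"
      unfolding Tstep_def using z that by (simp, intro B(2) Gm G0) (simp add: norm_mult norm_power)
    also have "\<dots> \<le> B * (((1 + r) / t)\<^sup>2 * sqrt (sqnorm G))"
      using B(1) by (intro mult_left_mono mean) auto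
    finally show ?thesis by (simp add: mult.assoc)
  qed
  have "Ex L z k (Suc d) G = Ex L z k d (Tstep z 0 G)" using Ex_Suc[OF G G0] k[of d] by simp
  also have "\<dots> \<le> (\<integral>\<^sup>+\<omega>. decay (sqnorm G) \<partial>P)"
    unfolding Ex_def using k by (intro nn_integral_mono ennreal_leI) (simp add: T norm_refl_P z)
  also have "\<dots> = decay (sqnorm G)"
    by (simp add: env.emeasure_space_1)
  finally show ?thesis .
qed

text \<open>The induction proceeds by two, since a single step is only known not to increase the
  norm; this explains the exponent \<open>n div 2\<close>.\<close>

lemma Ex_weight_1:
  assumes G: "bounded_measurable G" "\<And>z. 0 \<le> G z" and z: "cmod z = 1"
    and k: "\<And>e. e < Suc d \<Longrightarrow> k e = 0" "\<And>e. Suc d \<le> e \<Longrightarrow> e < Suc d + n \<Longrightarrow> k e = 1"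
  shows "Ex L z k (Suc d + n) G \<le> decay (q ^ (n div 2) * sqnorm G)"
  using G k(2)
proof (induction n arbitrary: G rule: induct_nat_012)
  case 0
  have "Ex L z k (Suc d) G \<le> decay (sqnorm G)"
    by (rule Ex_unweighted[OF 0(1,2) z k(1)])
  then show ?case by simp
next
  case 1
  have k1: "k (Suc d) = 1" by (rule 1(3)) auto
  have "Ex L z k (Suc (Suc d)) G = Ex L z k (Suc d) (Tstep z 1 G)"
    unfolding Ex_Suc[OF 1(1,2)] k1 ..
  also have "\<dots> \<le> decay (sqnorm (Tstep z 1 G))"
    by (rule Ex_unweighted[OF bounded_measurable_Tstep[OF 1(1)] Tstep_nonneg[OF 1(2)] z k(1)])
  also have "\<dots> \<le> decay (sqnorm G)"
    by (intro ennreal_leI mult_left_mono real_sqrt_le_mono norm_Tstep_1[OF 1(1) z]) (use B(1) in simp)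
  finally show ?case by simp
next
  case (ge2 n)
  let ?G = "Tstep z 1 (Tstep z 1 G)"
  have b1: "bounded_measurable (Tstep z 1 G)" by (rule bounded_measurable_Tstep[OF ge2.prems(1)])
  have n1: "0 \<le> Tstep z 1 G s" for s by (rule Tstep_nonneg[OF ge2.prems(2)])
  have k2: "k (Suc d + Suc n) = 1" "k (Suc d + n) = 1" by (rule ge2.prems(3); simp)+
  have "Ex L z k (Suc d + Suc (Suc n)) G = Ex L z k (Suc d + n) ?G"
    using Ex_Suc[OF ge2.prems(1,2), of L z k "Suc d + Suc n"] Ex_Suc[OF b1 n1, of L z k "Suc d + n"]
    unfolding k2[unfolded add_Suc_right] add_Suc_right by (rule trans)
  also have "\<dots> \<le> decay (q ^ (n div 2) * sqnorm ?G)"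
  proof (rule ge2.IH(1)[OF bounded_measurable_Tstep[OF b1] Tstep_nonneg[OF n1]])
    show "k e = 1" if "Suc d \<le> e" "e < Suc d + n" for e
      by (rule ge2.prems(3)) (use that in simp_all)
  qed
  also have "\<dots> \<le> decay (q ^ (n div 2) * (q * sqnorm G))"
    by (intro ennreal_leI mult_left_mono real_sqrt_le_mono norm_Tstep_2[OF ge2.prems(1) z])
      (use B(1) q(1) in simp_all)
  finally show ?case by (simp add: mult_ac)
qed

text \<open>Steps of weight 2 preserve the mean by change of variables, and smoothing then restores
  the pointwise bound \<open>B\<close>. From both, \<open>(G s)\<^sup>2 \<le> B * G s\<close> gives
  the $L^2$ bound that the middle stretch needs. The result does not depend on \<open>l\<close>, so
  the open end may recede to infinity.\<close>

lemma Ex_weight_2: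
  assumes G: "bounded_measurable G" "\<And>z. 0 \<le> G z" "mean G \<le> 1" "\<And>s. cmod s = 1 \<Longrightarrow> G s \<le> B"
    and z: "cmod z = 1"
    and k: "\<And>e. e < Suc d \<Longrightarrow> k e = 0" "\<And>e. Suc d \<le> e \<Longrightarrow> e < Suc d + n \<Longrightarrow> k e = 1"
      "\<And>e. Suc d + n \<le> e \<Longrightarrow> k e = 2"
  shows "Ex L z k (Suc d + n + l) G \<le> decay (q ^ (n div 2) * B)"
  using G
proof (induction l arbitrary: G)
  case 0
  have "sqnorm G \<le> (\<integral>s. B * G s \<partial>circle_measure)"
  proof (rule integral_mono_AE)
    show "AE s in circle_measure. (G s)\<^sup>2 \<le> B * G s"
      using AE_circle_measure
      by eventually_elim (use 0 in \<open>auto simp: power2_eq_square intro!: mult_right_mono\<close>)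
  qed (intro bounded_measurable_integrable bounded_measurable_power2 bounded_measurable_mult[OF bounded_measurable_const] 0)+
  also have "\<dots> \<le> B" using 0(3) B(1) by (simp add: mult_left_le)
  finally have "sqrt (q ^ (n div 2) * sqnorm G) \<le> sqrt (q ^ (n div 2) * B)"
    using q(1) by (intro real_sqrt_le_mono mult_left_mono) auto
  then have "decay (q ^ (n div 2) * sqnorm G)
    \<le> decay (q ^ (n div 2) * B)"
    using B(1) by (intro ennreal_leI mult_left_mono) auto
  moreover have "Ex L z k (Suc d + n) G \<le> decay (q ^ (n div 2) * sqnorm G)"
    by (rule Ex_weight_1[OF 0(1,2) z k(1,2)])
  ultimately show ?case unfolding add_0_right by (rule order_trans[rotated])
next
  case (Suc l)
  have wt: "bounded_measurable (\<lambda>y. (kap r t y)\<^sup>2 * G (mob r y))" by (rule bounded_measurable_weight[OF Suc.prems(1)])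
  have w0: "0 \<le> (kap r t y)\<^sup>2 * G (mob r y)" for y using Suc.prems(2) by simp
  have z2: "cmod (z\<^sup>2) = 1" using z by (simp add: norm_power)
  have wm: "(\<integral>y. (kap r t y)\<^sup>2 * G (mob r y) \<partial>circle_measure) = mean G"
    by (rule integral_mob[OF r t rt bounded_measurable_measurable[OF Suc.prems(1)]])
  have "Ex L z k (Suc d + n + Suc l) G = Ex L z k (Suc d + n + l) (Tstep z 2 G)"
    unfolding add_Suc_right Ex_Suc[OF Suc.prems(1,2)] k(3)[of "Suc d + n + l", OF le_add1] ..
  also have "\<dots> \<le> decay (q ^ (n div 2) * B)"
  proof (rule Suc.IH)
    show "bounded_measurable (Tstep z 2 G)" by (rule bounded_measurable_Tstep[OF Suc.prems(1)])
    show "0 \<le> Tstep z 2 G s" for s by (rule Tstep_nonneg[OF Suc.prems(2)])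
    have "mean (Tstep z 2 G) = mean (KK (\<lambda>y. (kap r t y)\<^sup>2 * G (mob r y)))"
      unfolding Tstep_def by (rule integral_circle_rotate[OF z2 bounded_measurable_measurable[OF bounded_measurable_KK[OF wt]]])
    also have "\<dots> = mean G" by (simp only: mean_KK[OF wt] wm)
    finally show "mean (Tstep z 2 G) \<le> 1" using Suc.prems(3) by simp
    fix s :: complex assume s: "cmod s = 1"
    have "Tstep z 2 G s \<le> B * (\<integral>y. (kap r t y)\<^sup>2 * G (mob r y) \<partial>circle_measure)"
      unfolding Tstep_def by (rule B(2)[OF wt w0]) (simp add: norm_mult s z2)
    also have "\<dots> \<le> B" unfolding wm using Suc.prems(3) B(1) by (simp add: mult_left_le)
    finally show "Tstep z 2 G s \<le> B" .
  qed
  finally show ?case .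
qed

lemma wave_expectation:
  assumes z: "cmod z = 1" and d: "0 < d" "d + n \<le> D"
  shows "(\<integral>\<^sup>+\<omega>. ennreal (cmod (wave r t (pU L \<omega>) (pD L \<omega>) D z (Inl d)) * cmod (wave r t (pU L \<omega>) (pD L \<omega>) D z (Inl (d + n)))) \<partial>P)
    \<le> decay (q ^ (n div 2) * B)"
proof -
  obtain d' where d': "d = Suc d'" using d(1) gr0_implies_Suc by blast
  obtain l where l: "D = Suc d' + n + l" using d(2) d' le_Suc_ex by blast
  \<comment> \<open>The exponents count powers of \<open>kap\<close>, the square root of the
    Jacobian. The assumption \<open>0 < d\<close> ensures that the exponent 0 occurs at least
    once.\<close>
  define k where "k e = (if e < Suc d' then 0 else if e < Suc d' + n then 1 else 2 :: nat)" for e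
  have "cmod (wave r t (pU L \<omega>) (pD L \<omega>) D z (Inl d)) * cmod (wave r t (pU L \<omega>) (pD L \<omega>) D z (Inl (d + n)))
    = 1 * (\<Prod>e<D. kap r t (refl_arg r (pU L \<omega>) (pD L \<omega>) z e) ^ k e)" for \<omega>
  proof -
    define x where "x e = kap r t (refl_arg r (pU L \<omega>) (pD L \<omega>) z e)" for e
    have pr: "(\<Prod>e<D. if a \<le> e then x e else 1) = (\<Prod>e\<in>{a..<D}. x e)" for a
      by (rule prod.mono_neutral_cong_right) auto
    have "(\<Prod>e<D. x e ^ k e) = (\<Prod>e<D. (if d \<le> e then x e else 1) * (if d + n \<le> e then x e else 1))"
      by (intro prod.cong refl) (auto simp: k_def d' power2_eq_square)
    also have "\<dots> = (\<Prod>e<D. if d \<le> e then x e else 1) * (\<Prod>e<D. if d + n \<le> e then x e else 1)"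
      by (rule prod.distrib)
    also have "\<dots> = (\<Prod>e\<in>{d..<D}. x e) * (\<Prod>e\<in>{d + n..<D}. x e)" by (simp only: pr)
    finally show ?thesis unfolding norm_wave_Inl(1)[OF z] x_def mult_1_left by (rule sym)
  qed
  then have "(\<integral>\<^sup>+\<omega>. ennreal (cmod (wave r t (pU L \<omega>) (pD L \<omega>) D z (Inl d)) * cmod (wave r t (pU L \<omega>) (pD L \<omega>) D z (Inl (d + n)))) \<partial>P)
    = Ex L z k (Suc d' + n + l) (\<lambda>_. 1)"
    unfolding Ex_def by (simp add: l)
  also have "\<dots> \<le> decay (q ^ (n div 2) * B)"
    by (rule Ex_weight_2[OF _ _ _ _ z]) (use B(1) in \<open>simp_all add: k_def\<close>)
  finally show ?thesis .
qed

end

end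

end

section \<open>Dynamical localization\<close>

text \<open>By the recursion in coordinates these matrix elements are polynomials in finitely many
  phases; negative powers are later reached through the adjoint.\<close>

lemma measurable_walk_power:
  assumes [measurable]: "\<And>n. (\<lambda>\<omega>. phase_Up \<omega> n) \<in> borel_measurable M" "\<And>n. (\<lambda>\<omega>. phase_Down \<omega> n) \<in> borel_measurable M"
  shows "(\<lambda>\<omega>. coord ((walk r t \<omega> ^^ \<nu>) (ket y)) x) \<in> borel_measurable M"
proof (induction \<nu> arbitrary: x)
  case (Suc \<nu>)
  note [measurable] = Suc
  obtain \<sigma> n where x: "x = (\<sigma>, n)" by force
  show ?case by (cases \<sigma>) (simp_all add: x coord_walk_Up coord_walk_Down)
qed simp

lemma measurable_laurent_op_walk:
  assumes rt: "r\<^sup>2 + t\<^sup>2 = 1"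
    and M: "\<And>n. (\<lambda>\<omega>. phase_Up \<omega> n) \<in> borel_measurable M" "\<And>n. (\<lambda>\<omega>. phase_Down \<omega> n) \<in> borel_measurable M"
  shows "(\<lambda>\<omega>. cinner (ket x) (laurent_op (walk r t \<omega>) xs (ket y))) \<in> borel_measurable M"
proof -
  have upow: "(\<lambda>\<omega>. cinner (ket x) (upow (walk r t \<omega>) n (ket y))) \<in> borel_measurable M" for n
  proof (cases "0 \<le> n")
    case True
    then show ?thesis using measurable_walk_power[OF M] by (simp add: upow_def cinner_ket_left)
  next
    case False
    have "cinner (ket x) (upow (walk r t \<omega>) n (ket y)) = cnj (coord ((walk r t \<omega> ^^ nat (- n)) (ket x)) y)" for \<omega>
    proof -
      have "cinner (ket x) (upow (walk r t \<omega>) n (ket y)) = cnj (cinner (ket y) (upow (walk r t \<omega>) (- n) (ket x)))"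
        using upow_adj[OF unitary_walk[OF rt, where \<omega> = \<omega>], of "- n" "ket x" "ket y"] by (metis cinner_commute minus_minus)
      then show ?thesis using False by (simp add: upow_def cinner_ket_left)
    qed
    moreover have "(\<lambda>\<omega>. cnj (coord ((walk r t \<omega> ^^ nat (- n)) (ket x)) y)) \<in> borel_measurable M"
      by (rule measurable_compose[OF measurable_walk_power[OF M] borel_measurable_cnj])
    ultimately show ?thesis by simp
  qed
  show ?thesis
  proof (induction xs)
    case (Cons u us)
    obtain c n where u: "u = (c, n)" by force
    note [measurable] = Cons upow
    show ?case by (simp add: u cinner_add_right cinner_scaleC_right)
  qed simp
qed

context phase_law
begin

context
  fixes r t :: real
  assumes r: "0 < r" "r < 1" and t: "0 < t" and rt: "r\<^sup>2 + t\<^sup>2 = 1"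
begin

lemma box_wave_expectation:
  "\<exists>C \<alpha>. 0 < \<alpha> \<and> (\<forall>z L x y. cmod z = 1 \<longrightarrow> \<bar>snd x\<bar> < L - 1 \<longrightarrow> \<bar>snd y\<bar> < L - 1 \<longrightarrow>
    (\<integral>\<^sup>+\<omega>. ennreal (cmod (box_wave r t \<omega> L z x) * cmod (box_wave r t \<omega> L z y)) \<partial>P)
      \<le> ennreal (C * exp (- \<alpha> * \<bar>real_of_int (snd x) - real_of_int (snd y)\<bar>)))"
proof -
  obtain B where B: "1 \<le> B" "\<And>f s. bounded_measurable f \<Longrightarrow> (\<And>z. 0 \<le> f z) \<Longrightarrow> cmod s = 1 \<Longrightarrow>
    KK f s \<le> B * mean f"
    by (rule KK_sup_bound) blast
  obtain q where q: "0 < q" "q < 1" "\<And>f c. bounded_measurable f \<Longrightarrow> cmod c = 1 \<Longrightarrow>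
    sqnorm (KK (Vop r t (\<lambda>z. KK f (c * z)))) \<le> q * sqnorm f"
    using KK_contraction[OF r t rt] by blast
  \<comment> \<open>The factor \<open>q powr (- 1 / 2)\<close> makes up for two lost steps: one
    through the offset between the spin-up and spin-down indices, one through rounding in
    \<open>n div 2\<close>.\<close>
  define C where "C = B * ((1 + r) / t)\<^sup>2 * (sqrt B * q powr (- 1 / 2))"
  \<comment> \<open>The square root in the estimate contributes one factor 1/2, the counting of
    steps in pairs the other.\<close>
  define \<alpha> where "\<alpha> = - ln q / 4"
  have \<alpha>: "0 < \<alpha>" using q by (simp add: \<alpha>_def)
  have decay: "B * ((1 + r) / t)\<^sup>2 * sqrt (q ^ (n div 2) * B) \<le> C * exp (- \<alpha> * real_of_int a)" if "a - 1 \<le> int n" for n a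
  proof -
    have "a - 2 \<le> 2 * int (n div 2)" using that by presburger
    then have "real_of_int (a - 2) \<le> real_of_int (2 * int (n div 2))" by (simp only: of_int_le_iff)
    then have "(real_of_int a - 2) / 2 \<le> real (n div 2)" by simp
    then have "q ^ (n div 2) \<le> q powr ((real_of_int a - 2) / 2)"
      using q(1,2) by (simp add: powr_realpow[symmetric] powr_mono')
    then have "sqrt (q ^ (n div 2)) \<le> sqrt (q powr ((real_of_int a - 2) / 2))" by simp
    also have "\<dots> = q powr ((real_of_int a - 2) / 4)"
      using q(1) by (simp add: powr_half_sqrt[symmetric] powr_powr)
    also have "\<dots> = q powr (- 1 / 2) * exp (- \<alpha> * real_of_int a)"
      using q(1) by (simp add: powr_def \<alpha>_def exp_add[symmetric] field_simps)
    finally have "sqrt (q ^ (n div 2) * B) \<le> sqrt B * (q powr (- 1 / 2) * exp (- \<alpha> * real_of_int a))"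
      using B(1) by (simp add: real_sqrt_mult mult.commute mult_left_mono)
    then have "B * ((1 + r) / t)\<^sup>2 * sqrt (q ^ (n div 2) * B)
        \<le> B * ((1 + r) / t)\<^sup>2 * (sqrt B * (q powr (- 1 / 2) * exp (- \<alpha> * real_of_int a)))"
      using B(1) by (intro mult_left_mono) auto
    then show ?thesis by (simp only: C_def mult.assoc)
  qed
  \<comment> \<open>The amplitudes \<open>Inr d\<close> and \<open>Inl d\<close> have the same
    modulus on the circle, so a single distance describes either spin.\<close>
  define dd where "dd L x = (case fst x of Up \<Rightarrow> nat (L - snd x) | Down \<Rightarrow> nat (L - snd x - 1))"
    for L :: int and x :: "spin \<times> int"
  have norm: "cmod (box_wave r t \<omega> L z x) = cmod (wave r t (pU L \<omega>) (pD L \<omega>) (nat (2 * L)) z (Inl (dd L x)))"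
    if "cmod z = 1" for \<omega> L z x
    using norm_wave_Inl(2)[OF r t rt that] by (cases "fst x") (simp_all add: box_wave_def box_index_def dd_def)
  have ordered: "(\<integral>\<^sup>+\<omega>. ennreal (cmod (box_wave r t \<omega> L z x) * cmod (box_wave r t \<omega> L z y)) \<partial>P)
      \<le> ennreal (C * exp (- \<alpha> * \<bar>real_of_int (snd x) - real_of_int (snd y)\<bar>))"
    if z: "cmod z = 1" and L: "\<bar>snd x\<bar> < L - 1" "\<bar>snd y\<bar> < L - 1" and le: "dd L x \<le> dd L y" for z L x y
  proof -
    obtain n where n: "dd L y = dd L x + n" using le le_Suc_ex by blast
    have bounds: "0 < dd L x" "dd L x + n \<le> nat (2 * L)" "\<bar>snd x - snd y\<bar> - 1 \<le> int n"
      using L n by (cases "fst x"; cases "fst y"; simp add: dd_def)+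
    have "(\<integral>\<^sup>+\<omega>. ennreal (cmod (box_wave r t \<omega> L z x) * cmod (box_wave r t \<omega> L z y)) \<partial>P)
      \<le> ennreal (B * ((1 + r) / t)\<^sup>2 * sqrt (q ^ (n div 2) * B))"
      unfolding norm[OF z] n by (rule wave_expectation[OF r t rt B q(1,3) z bounds(1,2)])
    also have "\<dots> \<le> ennreal (C * exp (- \<alpha> * real_of_int \<bar>snd x - snd y\<bar>))"
      by (rule ennreal_leI[OF decay[OF bounds(3)]])
    finally show ?thesis by simp
  qed
  have "(\<integral>\<^sup>+\<omega>. ennreal (cmod (box_wave r t \<omega> L z x) * cmod (box_wave r t \<omega> L z y)) \<partial>P)
      \<le> ennreal (C * exp (- \<alpha> * \<bar>real_of_int (snd x) - real_of_int (snd y)\<bar>))"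
    if z: "cmod z = 1" and L: "\<bar>snd x\<bar> < L - 1" "\<bar>snd y\<bar> < L - 1" for z L x y
  proof (cases "dd L x \<le> dd L y")
    case True
    show ?thesis by (rule ordered[OF z L True])
  next
    case False
    then have "dd L y \<le> dd L x" by simp
    from ordered[OF z L(2,1) this] show ?thesis by (simp only: mult.commute abs_minus_commute)
  qed
  then show ?thesis using \<alpha> by blast
qed

lemma measurable_box_wave_joint:
  "(\<lambda>y. box_wave r t (fst y) L (snd y) x) \<in> borel_measurable (P \<Otimes>\<^sub>M circle_measure)"
  unfolding box_wave_def
  by (rule measurable_wave_joint) (simp_all add: measurable_compose[OF measurable_fst measurable_phases(1)]
    measurable_compose[OF measurable_fst measurable_phases(2)] measurable_cong_sets[OF sets_pair_measure_cong[OF refl sets_circle_measure] refl])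

text \<open>Each Laurent polynomial is handled by all sufficiently large boxes, though no box
  handles all of \<open>X\<close>. As \<open>Q N\<close> does not depend on the polynomial, the
  supremum is at most the liminf of \<open>Q N\<close>, and Fatou's lemma carries over the bound,
  which is uniform in the size of the box.\<close>

lemma localization:
  "\<exists>C \<alpha> :: real. \<alpha> > 0 \<and>
    (\<forall>(j :: int) (k :: int) (\<sigma> :: spin) (\<sigma>' :: spin).
      (\<lambda>\<omega>. sup_matrix_element (walk r t \<omega>) (ket (\<sigma>, j)) (ket (\<sigma>', k))) \<in> borel_measurable P \<and>
      (\<integral>\<^sup>+ \<omega>. sup_matrix_element (walk r t \<omega>) (ket (\<sigma>, j)) (ket (\<sigma>', k)) \<partial>P)
        \<le> ennreal (C * exp (- \<alpha> * \<bar>real_of_int j - real_of_int k\<bar>)))"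
proof -
  obtain C \<alpha> where \<alpha>: "0 < \<alpha>" and bound: "\<And>z L x y. cmod z = 1 \<Longrightarrow> \<bar>snd x\<bar> < L - 1 \<Longrightarrow> \<bar>snd y\<bar> < L - 1 \<Longrightarrow>
    (\<integral>\<^sup>+\<omega>. ennreal (cmod (box_wave r t \<omega> L z x) * cmod (box_wave r t \<omega> L z y)) \<partial>P)
      \<le> ennreal (C * exp (- \<alpha> * \<bar>real_of_int (snd x) - real_of_int (snd y)\<bar>))"
    using box_wave_expectation by blast
  obtain X where X: "countable X" "\<And>xs z. xs \<in> X \<Longrightarrow> cmod z = 1 \<Longrightarrow> cmod (laurent_eval xs z) \<le> 1"
    "\<And>(U :: walk_space \<Rightarrow> walk_space) \<phi> \<psi>. unitary U \<Longrightarrow>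
      sup_matrix_element U \<phi> \<psi> = (SUP xs\<in>X. ennreal (cmod (cinner \<phi> (laurent_op U xs \<psi>))))"
    by (rule sup_matrix_element_countable) blast
  note sup = X(3)[OF unitary_walk[OF rt]]
  have meas: "(\<lambda>\<omega>. ennreal (cmod (cinner (ket x) (laurent_op (walk r t \<omega>) xs (ket y))))) \<in> borel_measurable P" for x y xs
    using measurable_laurent_op_walk[OF rt measurable_phases] by measurable
  have main: "(\<integral>\<^sup>+ \<omega>. sup_matrix_element (walk r t \<omega>) (ket x) (ket y) \<partial>P)
        \<le> ennreal (C * exp (- \<alpha> * \<bar>real_of_int (snd x) - real_of_int (snd y)\<bar>))" for x y :: "spin \<times> int"
  proof -
    let ?c = "ennreal (C * exp (- \<alpha> * \<bar>real_of_int (snd x) - real_of_int (snd y)\<bar>))"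
    \<comment> \<open>Both sites, together with N further steps from either of them, stay at
      distance more than 1 from the ends of the box.\<close>
    define L where "L N = int N + \<bar>snd x\<bar> + \<bar>snd y\<bar> + 2" for N
    define Q where "Q N \<omega> = (\<integral>\<^sup>+z. ennreal (cmod (box_wave r t \<omega> (L N) z x) * cmod (box_wave r t \<omega> (L N) z y)) \<partial>circle_measure)" for N \<omega>
    interpret PP: pair_prob_space P circle_measure
      by (intro pair_prob_space.intro pair_sigma_finite.intro prob_space_imp_sigma_finite prob_space_PiM prob_space_circle_measure prob_\<mu>)
    have joint: "(\<lambda>u. ennreal (cmod (box_wave r t (fst u) (L N) (snd u) x) * cmod (box_wave r t (fst u) (L N) (snd u) y)))
        \<in> borel_measurable (P \<Otimes>\<^sub>M circle_measure)" for N
      using measurable_box_wave_joint[of "L N" x] measurable_box_wave_joint[of "L N" y] by measurable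
    have Q[measurable]: "Q N \<in> borel_measurable P" for N
      unfolding Q_def using joint[of N] by (intro circle.borel_measurable_nn_integral) (simp add: split_beta')
    have QC: "(\<integral>\<^sup>+\<omega>. Q N \<omega> \<partial>P) \<le> ?c" for N
    proof -
      have "(\<integral>\<^sup>+\<omega>. Q N \<omega> \<partial>P) = (\<integral>\<^sup>+z. (\<integral>\<^sup>+\<omega>. ennreal (cmod (box_wave r t \<omega> (L N) z x) * cmod (box_wave r t \<omega> (L N) z y)) \<partial>P) \<partial>circle_measure)"
        unfolding Q_def
        using PP.Fubini'[of "\<lambda>\<omega> z. ennreal (cmod (box_wave r t \<omega> (L N) z x) * cmod (box_wave r t \<omega> (L N) z y))"] joint[of N]
        by (simp add: split_beta')
      also have "\<dots> \<le> (\<integral>\<^sup>+z. ?c \<partial>circle_measure)"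
      proof (rule nn_integral_mono_AE)
        show "AE z in circle_measure. (\<integral>\<^sup>+\<omega>. ennreal (cmod (box_wave r t \<omega> (L N) z x) * cmod (box_wave r t \<omega> (L N) z y)) \<partial>P) \<le> ?c"
          using AE_circle_measure by eventually_elim (rule bound, simp_all add: L_def)
      qed
      also have "\<dots> = ?c" using circle.emeasure_space_1 by simp
      finally show ?thesis .
    qed
    have le: "ennreal (cmod (cinner (ket x) (laurent_op (walk r t \<omega>) xs (ket y)))) \<le> liminf (\<lambda>N. Q N \<omega>)"
      if "xs \<in> X" for xs \<omega>
    proof (rule Liminf_bounded)
      \<comment> \<open>A crude bound on the degree, convenient because the sum of a list also
        covers the empty polynomial.\<close>
      define n0 where "n0 = nat (\<Sum>(c, n)\<leftarrow>xs. \<bar>n\<bar>)"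
      have n0: "\<bar>n\<bar> \<le> int n0" if "(c, n) \<in> set xs" for c n
      proof -
        have "\<bar>n\<bar> \<in> set (map (\<lambda>(c, n). \<bar>n\<bar>) xs)" using that by force
        then have "\<bar>n\<bar> \<le> (\<Sum>(c, n)\<leftarrow>xs. \<bar>n\<bar>)" by (intro member_le_sum_list) auto
        then show ?thesis unfolding n0_def using abs_ge_zero[of n] by linarith
      qed
      show "\<forall>\<^sub>F N in sequentially. ennreal (cmod (cinner (ket x) (laurent_op (walk r t \<omega>) xs (ket y)))) \<le> Q N \<omega>"
        using eventually_ge_at_top[of n0]
      proof eventually_elim
        case (elim N)
        show ?case unfolding Q_def
        proof (rule norm_laurent_op_walk_le[OF r t rt _ X(2)[OF that]])
          fix c n assume "(c, n) \<in> set xs"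
          then have "\<bar>n\<bar> \<le> int N" using n0 elim by force
          then show "\<bar>snd x\<bar> + \<bar>n\<bar> < L N - 1 \<and> \<bar>snd y\<bar> + \<bar>n\<bar> < L N - 1"
            unfolding L_def using abs_ge_zero[of "snd x"] abs_ge_zero[of "snd y"] by linarith
        qed
      qed
    qed
    have "(\<integral>\<^sup>+ \<omega>. sup_matrix_element (walk r t \<omega>) (ket x) (ket y) \<partial>P) \<le> (\<integral>\<^sup>+ \<omega>. liminf (\<lambda>N. Q N \<omega>) \<partial>P)"
      unfolding sup by (intro nn_integral_mono SUP_least le)
    also have "\<dots> \<le> liminf (\<lambda>N. \<integral>\<^sup>+ \<omega>. Q N \<omega> \<partial>P)"
      by (rule nn_integral_liminf) measurable
    also have "\<dots> \<le> limsup (\<lambda>N. ?c)"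
      by (rule order_trans[OF Liminf_le_Limsup[OF sequentially_bot] Limsup_mono[OF always_eventually]])
        (rule allI, rule QC)
    also have "\<dots> = ?c" by (simp add: Limsup_const)
    finally show ?thesis .
  qed
  have "(\<lambda>\<omega>. sup_matrix_element (walk r t \<omega>) (ket x) (ket y)) \<in> borel_measurable P" for x y
    unfolding sup by (rule borel_measurable_SUP[OF X(1) meas])
  then show ?thesis using \<alpha> main[of "(_, _)" "(_, _)"] by (intro exI[of _ C] exI[of _ \<alpha>]) simp
qed

end

end

theorem theorem2p2:
  fixes r t :: real and \<mu> :: "torus measure" and \<tau> :: "torus \<Rightarrow> real"
  assumes "0 < r" and "r < 1" and "t = sqrt (1 - r\<^sup>2)"
    and "prob_space \<mu>"
    and "\<tau> \<in> borel_measurable borel"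
    and "AE x in lebesgue_torus. 0 \<le> \<tau> x"
    and "\<exists>B. AE x in lebesgue_torus. \<bar>\<tau> x\<bar> \<le> B"
    and "\<mu> = density lebesgue_torus (\<lambda>x. ennreal (\<tau> x))"
    and "\<exists>V. open V \<and> V \<noteq> {} \<and> V \<subseteq> measure_support \<mu>"
  shows "\<exists>C \<alpha> :: real. \<alpha> > 0 \<and>
    (\<forall>(j :: int) (k :: int) (\<sigma> :: spin) (\<sigma>' :: spin).
      (\<lambda>\<omega>. sup_matrix_element (walk r t \<omega>) (ket (\<sigma>, j)) (ket (\<sigma>', k)))
        \<in> borel_measurable (\<Pi>\<^sub>M i\<in>(UNIV :: int set). \<mu>) \<and>
      (\<integral>\<^sup>+ \<omega>. sup_matrix_element (walk r t \<omega>) (ket (\<sigma>, j)) (ket (\<sigma>', k))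
          \<partial>(\<Pi>\<^sub>M i\<in>(UNIV :: int set). \<mu>))
        \<le> ennreal (C * exp (- \<alpha> * \<bar>real_of_int j - real_of_int k\<bar>)))"
proof -
  interpret phase_law \<mu> \<tau> using assms(4,5,7,8) by (rule phase_law.intro)
  have "r\<^sup>2 < 1" using assms(1,2) by (simp add: power_less_one_iff)
  then have "0 < t" "r\<^sup>2 + t\<^sup>2 = 1" using assms(3) by simp_all
  then show ?thesis by (rule localization[OF assms(1,2)])
qed

end
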